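(* Let $1\le p<\infty$, $0<q<\infty$, $\nu\in\mathcal{D}\cap\widehat{\mathcal{D}}_q$, $f\in H^p$ and let $I$ be an inner function. Then $fI\in\mathcal{B}^{p,q}_\nu$ if and only if $f\in\mathcal{B}^{p,q}_\nu$ and $$\int_0^1\left(\int_0^{2\pi}\left(\frac{|f(re^{it})|\,(1-|I(re^{it})|)}{1-r}\right)^p dt\right)^{q/p}\nu(r)\,dr<\infty.$$
   Context: $\mathbb{D}$ is the open unit disc of $\mathbb{C}$, $\mathbb{T}$ its boundary, and $\mathcal{H}(\mathbb{D})$ the set of analytic functions in $\mathbb{D}$. For $f\in\mathcal{H}(\mathbb{D})$, $0<p<\infty$ and $0\le r<1$ let $M_p(r,f)=\left(\frac1{2\pi}\int_0^{2\pi}|f(re^{i\theta})|^p\,d\theta\right)^{1/p}$. The Hardy space $H^p$ consists of $f\in\mathcal{H}(\mathbb{D})$ with $\|f\|_{H^p}=\sup_{0\le r<1}M_p(r,f)<\infty$, and $H^\infty$ is the set of bounded functions in $\mathcal{H}(\mathbb{D})$. An inner function is a member of $H^\infty$ having unimodular radial limits almost everywhere on $\mathbb{T}$. A weight is a function $\nu:\mathbb{D}\to[0,\infty)$ that is integrable over $\mathbb{D}$ and radial, $\nu(z)=\nu(|z|)$. Put $\widehat\nu(z)=\widehat\nu(|z|)=\int_{|z|}^1\nu(s)\,ds$; it is understood that $\widehat\nu(r)>0$ for all $0\le r<1$. Write $\nu\in\widehat{\mathcal{D}}$ if there is $C=C(\nu)>0$ with $\widehat\nu(r)\le C\,\widehat\nu\left(\frac{1+r}{2}\right)$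 for all $0\le r<1$. Write $\nu\in\check{\mathcal{D}}$ if there are $K=K(\nu)>1$ and $C=C(\nu)>1$ with $\widehat\nu(r)\ge C\,\widehat\nu\left(1-\frac{1-r}{K}\right)$ for all $0\le r<1$. Set $\mathcal{D}=\widehat{\mathcal{D}}\cap\check{\mathcal{D}}$. For $0<q<\infty$, $\widehat{\mathcal{D}}_q$ is the subclass of those $\nu\in\widehat{\mathcal{D}}$ with $$\sup_{0\le r<1}\frac{(1-r)^q}{\widehat\nu(r)}\int_0^r\frac{\nu(s)}{(1-s)^q}\,ds<\infty.$$ For $g\in\mathcal{H}(\mathbb{D})$, $\|g\|_{A^{p,q}_\nu}^q=\int_0^1M_p(r,g)^q\,\nu(r)\,dr$. The weighted Besov space $\mathcal{B}^{p,q}_\nu$ consists of those $f\in H^p$ with $\|f'\|_{A^{p,q}_\nu}<\infty$. *)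

theory Defs
  imports "HOL-Complex_Analysis.Complex_Analysis"
begin

text \<open>
  Functions on the open unit disc are total functions of which only the values on
  \<open>ball 0 1\<close> are ever used. Integrals whose finiteness is in question, in particular all those
  involving a weight, are taken in \<open>ennreal\<close>. The integrals over circles are real-valued, since
  for \<open>0 \<le> r < 1\<close> their integrands are continuous.
\<close>

definition integral_mean :: "real \<Rightarrow> real \<Rightarrow> (complex \<Rightarrow> complex) \<Rightarrow> real" where
  "integral_mean p r f =
     (1 / (2 * pi) * (LINT t:{0..2 * pi}|lebesgue. cmod (f (of_real r * cis t)) powr p)) powr (1 / p)"

definition hardy_space :: "real \<Rightarrow> (complex \<Rightarrow> complex) set" where
  "hardy_space p =
     {f. f holomorphic_on ball 0 1 \<and> bdd_above ((\<lambda>r. integral_mean p r f) ` {0..<1})}"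

definition hardy_infinity :: "(complex \<Rightarrow> complex) set" where
  "hardy_infinity = {f. f holomorphic_on ball 0 1 \<and> bounded (f ` ball 0 1)}"

definition inner_function :: "(complex \<Rightarrow> complex) \<Rightarrow> bool" where
  "inner_function I \<longleftrightarrow> I \<in> hardy_infinity \<and>
     (AE t in lebesgue. t \<in> {0..2 * pi} \<longrightarrow>
        (\<exists>l. cmod l = 1 \<and> ((\<lambda>r. I (of_real r * cis t)) \<longlongrightarrow> l) (at_left 1)))"

definition weight_tail :: "(complex \<Rightarrow> real) \<Rightarrow> real \<Rightarrow> ennreal" where
  "weight_tail \<nu> r = (\<integral>\<^sup>+ s\<in>{r..<1}. ennreal (\<nu> (of_real s)) \<partial>lebesgue)"

text \<open>
  Integrability over the disc makes \<open>weight_tail \<nu> r\<close> finite for \<open>0 < r\<close> but not for \<open>r = 0\<close>;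
  finiteness at \<open>0\<close> is a consequence of the doubling condition in \<open>D_hat\<close>.
\<close>

definition weight :: "(complex \<Rightarrow> real) \<Rightarrow> bool" where
  "weight \<nu> \<longleftrightarrow>
     (\<forall>z\<in>ball 0 1. 0 \<le> \<nu> z) \<and>
     set_integrable lebesgue (ball 0 1) \<nu> \<and>
     (\<forall>z\<in>ball 0 1. \<nu> z = \<nu> (of_real (cmod z))) \<and>
     (\<forall>r\<in>{0..<1}. 0 < weight_tail \<nu> r)"

definition D_hat :: "(complex \<Rightarrow> real) set" where
  "D_hat = {\<nu>. weight \<nu> \<and>
     (\<exists>C>0. \<forall>r\<in>{0..<1}. weight_tail \<nu> r \<le> ennreal C * weight_tail \<nu> ((1 + r) / 2))}"

definition D_check :: "(complex \<Rightarrow> real) set" where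
  "D_check = {\<nu>. weight \<nu> \<and>
     (\<exists>K>1. \<exists>C>1. \<forall>r\<in>{0..<1}.
        weight_tail \<nu> r \<ge> ennreal C * weight_tail \<nu> (1 - (1 - r) / K))}"

definition D_class :: "(complex \<Rightarrow> real) set" where
  "D_class = D_hat \<inter> D_check"

definition D_hat_q :: "real \<Rightarrow> (complex \<Rightarrow> real) set" where
  "D_hat_q q = {\<nu> \<in> D_hat.
     (SUP r\<in>{0..<1}. ennreal ((1 - r) powr q) / weight_tail \<nu> r *
        (\<integral>\<^sup>+ s\<in>{0..<r}. ennreal (\<nu> (of_real s) / (1 - s) powr q) \<partial>lebesgue)) < \<infinity>}"

text \<open>The \<open>q\<close>-th power of the mixed norm.\<close>

definition mixed_norm_pow ::
    "real \<Rightarrow> real \<Rightarrow> (complex \<Rightarrow> real) \<Rightarrow> (complex \<Rightarrow> complex) \<Rightarrow> ennreal" where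
  "mixed_norm_pow p q \<nu> g =
     (\<integral>\<^sup>+ r\<in>{0..<1}. ennreal (integral_mean p r g powr q * \<nu> (of_real r)) \<partial>lebesgue)"

definition besov_space :: "real \<Rightarrow> real \<Rightarrow> (complex \<Rightarrow> real) \<Rightarrow> (complex \<Rightarrow> complex) set" where
  "besov_space p q \<nu> = {f \<in> hardy_space p. mixed_norm_pow p q \<nu> (deriv f) < \<infinity>}"

end

theory Submission
  imports Defs
begin

text \<open>
  Write \<open>F = f I\<close>. One implication is the Schwarz-Pick bound \<open>|I'| \<le> 2 (1 - |I|) / (1 - r)\<close> in
  \<open>F' = f' I + f I'\<close>.

  For the other one, \<open>|f| (1 - |I|) = |f| - |F|\<close>. Bound \<open>|f|\<close> by its Poisson integral over the circle of
  radius \<open>\<rho>\<close>. As \<open>I\<close> is inner and \<open>f\<close> lies in \<open>H\<^sup>1\<close>, the integral of \<open>|f| - |F|\<close> over that circle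
  tends to 0 as \<open>\<rho> \<rightarrow> 1\<close>, so up to a small error \<open>|f(z)| - |F(z)|\<close> is at most the Poisson mean of
  \<open>|F - F(z)|\<close>. Minkowski's inequality bounds the norm of this mean by the norms of \<open>F'\<close> on the circles of
  radius \<open>1 - K\<^sup>-\<^sup>n\<close>. The resulting double sum consists of two discrete Hardy operators: the outer one is
  bounded because the tails of the weight decay geometrically (\<open>D_check\<close>), the inner one because of \<open>D_hat_q\<close>.
  Finally \<open>f'(z)\<close> is recovered by differentiating \<open>f(w) (1 - cnj (I(z)) I(w))\<close> at \<open>w = z\<close>, where
  \<open>|1 - cnj (I(z)) I(w)| \<le> 4 (1 - |I(w)|)\<close> for \<open>w\<close> near \<open>z\<close>.
\<close>

section \<open>Integral norms on circles\<close>

text \<open>No boundary functions and no duality are used: all integrals run over circles of radius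
  less than 1, and limits towards the unit circle are taken along the single sequence
  \<open>unit_seq\<close>. Unimodular boundary values of \<open>I\<close> enter only through the
  bound \<open>|I| \<le> 1\<close> and the vanishing mean of \<open>|f| - |F|\<close>. The latter is
  delicate for \<open>p = 1\<close>, where bounded means do not prevent mass from concentrating. The
  radii \<open>1 - 1 / K ^ n\<close> are natural because the norms of \<open>F'\<close> increase
  with the radius: one value controls a whole annulus, and each condition on the weight becomes an
  inequality between tails at these radii. As \<open>q\<close> may be less than 1, the expressions
  in \<open>q\<close> need not be norms, so geometric weights take the place of Hoelder's
  inequality. The factor \<open>1 - cnj (I z) * I w\<close> stands in for a division by
  \<open>I\<close>, which is impossible near the zeros of \<open>I\<close>. Finally,
  \<open>weight\<close> speaks of measurability in the plane, whereas the weighted integrals run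
  along a radius; they are therefore treated as lower integrals.\<close>

lemma powr_tangent_le:
  fixes x c p :: real
  assumes "1 \<le> p" "0 \<le> x" "0 \<le> c"
  shows "c powr p + p * c powr (p - 1) * (x - c) \<le> x powr p"
proof (cases "c = 0")
  case True
  \<comment> \<open>Here \<open>0 powr (p - 1)\<close> is 0 even for \<open>p = 1\<close>, so the
    left side vanishes.\<close>
  then show ?thesis by simp
next
  case False
  then have c: "0 < c" using assms by simp
  show ?thesis
  proof (cases "x = 0")
    case True
    have "c powr p = c powr (p - 1) * c"
      using c by (simp add: powr_diff)
    then show ?thesis
      using True c assms by (simp add: mult_mono algebra_simps)
  next
    case False
    then have x: "0 < x" using assms by simp
    have *: "((\<lambda>y. y powr p) has_real_derivative p * y powr (p - 1)) (at y)" if "0 < y" for y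
      using that by (auto intro!: derivative_eq_intros)
    have "x powr p - c powr p \<ge> p * c powr (p - 1) * (x - c)"
      by (rule convex_on_imp_above_tangent[OF powr_convex[OF assms(1)], where c = c])
         (use c x in \<open>auto intro!: DERIV_subset[OF *] simp: interior_open\<close>)
    then show ?thesis by simp
  qed
qed

text \<open>The L^p norm over one period, without the factor \<open>1 / (2 * pi)\<close> of
  \<open>integral_mean\<close>; \<open>integral_mean_eq\<close> converts between the two.\<close>

definition cnorm :: "real \<Rightarrow> (real \<Rightarrow> real) \<Rightarrow> real" where
  "cnorm p u = (integral {0..2 * pi} (\<lambda>t. u t powr p)) powr (1 / p)"

lemma continuous_on_powr_const:
  fixes f :: "'a::topological_space \<Rightarrow> real"
  assumes "continuous_on A f" "0 < p" "\<And>x. x \<in> A \<Longrightarrow> 0 \<le> f x"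
  shows "continuous_on A (\<lambda>x. f x powr p)"
  using assms by (intro continuous_on_powr') auto

lemma cnorm_nonneg [simp]: "0 \<le> cnorm p u"
  by (simp add: cnorm_def)

lemma integral_powr_nonneg: "0 \<le> integral {a..b} (\<lambda>t. u t powr p :: real)"
  by (cases "(\<lambda>t. u t powr p) integrable_on {a..b}")
     (auto intro: integral_nonneg simp: not_integrable_integral)

lemma cnorm_powr: "0 < p \<Longrightarrow> cnorm p u powr p = integral {0..2 * pi} (\<lambda>t. u t powr p)"
  by (simp add: cnorm_def powr_powr integral_powr_nonneg)

lemma cnorm_le_iff:
  assumes "0 < p" "0 \<le> C"
  shows "cnorm p u \<le> C \<longleftrightarrow> integral {0..2 * pi} (\<lambda>t. u t powr p) \<le> C powr p"
proof -
  have "cnorm p u \<le> C \<longleftrightarrow> cnorm p u powr p \<le> C powr p"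
    using assms powr_mono2[of p "cnorm p u" C] powr_less_mono2[of p C "cnorm p u"] by (force simp: not_le)
  then show ?thesis using assms by (simp add: cnorm_powr)
qed

lemma powr_integrable_circle:
  fixes u :: "real \<Rightarrow> real"
  assumes "0 < p" "continuous_on {a..b} u" "\<And>t. t \<in> {a..b} \<Longrightarrow> 0 \<le> u t"
  shows "(\<lambda>t. u t powr p) integrable_on {a..b}"
  using assms by (intro integrable_continuous_interval continuous_on_powr_const) auto

lemma cnorm_mono:
  assumes "0 < p" "continuous_on {0..2 * pi} u" "continuous_on {0..2 * pi} v"
    and "\<And>t. t \<in> {0..2 * pi} \<Longrightarrow> 0 \<le> u t" "\<And>t. t \<in> {0..2 * pi} \<Longrightarrow> u t \<le> v t"
  shows "cnorm p u \<le> cnorm p v"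
  unfolding cnorm_def
proof (rule powr_mono2)
  show "integral {0..2 * pi} (\<lambda>t. u t powr p) \<le> integral {0..2 * pi} (\<lambda>t. v t powr p)"
    using assms by (intro integral_le powr_integrable_circle powr_mono2) force+
qed (use assms integral_powr_nonneg in auto)

lemma cnorm_cmult:
  assumes "0 < p" "0 \<le> c" "\<And>t. t \<in> {0..2 * pi} \<Longrightarrow> 0 \<le> u t"
  shows "cnorm p (\<lambda>t. c * u t) = c * cnorm p u"
proof -
  have "integral {0..2 * pi} (\<lambda>t. (c * u t) powr p) = integral {0..2 * pi} (\<lambda>t. c powr p * u t powr p)"
    using assms by (intro integral_cong) (simp add: powr_mult)
  then show ?thesis
    using assms by (simp add: cnorm_def powr_mult powr_powr integral_powr_nonneg)
qed

lemma cnorm_const: "0 < p \<Longrightarrow> 0 \<le> c \<Longrightarrow> cnorm p (\<lambda>t. c) = c * (2 * pi) powr (1 / p)"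
  by (simp add: cnorm_def powr_mult powr_powr mult.commute)

lemma continuous_on_swap_args:
  "continuous_on (A \<times> B) (\<lambda>(t, s). f t s) \<Longrightarrow> continuous_on (B \<times> A) (\<lambda>(s, t). f t s)"
  by (drule continuous_on_compose2[of _ _ "B \<times> A" "\<lambda>x. (snd x, fst x)"])
     (auto intro!: continuous_intros simp: case_prod_unfold)

lemma continuous_on_slice:
  assumes "continuous_on (A \<times> B) (\<lambda>(t, s). f t s)"
  shows "t \<in> A \<Longrightarrow> continuous_on B (f t)" "s \<in> B \<Longrightarrow> continuous_on A (\<lambda>t. f t s)"
  using continuous_on_compose2[OF assms, of B "\<lambda>s. (t, s)"]
    continuous_on_compose2[OF assms, of A "\<lambda>t. (t, s)"]
  by (auto intro!: continuous_intros simp: image_subset_iff continuous_on_Pair)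

lemma continuous_on_cnorm:
  assumes "0 < p" "continuous_on ({0..2 * pi} \<times> {c..d}) (\<lambda>(t, s). \<phi> t s)"
    and "\<And>t s. t \<in> {0..2 * pi} \<Longrightarrow> s \<in> {c..d} \<Longrightarrow> 0 \<le> \<phi> t s"
  shows "continuous_on {c..d} (\<lambda>s. cnorm p (\<lambda>t. \<phi> t s))"
proof -
  have "continuous_on ({c..d} \<times> {0..2 * pi}) (\<lambda>x. \<phi> (snd x) (fst x))"
    using continuous_on_swap_args[OF assms(2)] by (simp add: case_prod_unfold)
  then have "continuous_on ({c..d} \<times> cbox 0 (2 * pi)) (\<lambda>(s, t). \<phi> t s powr p)"
    using assms by (auto simp: case_prod_unfold intro!: continuous_on_powr_const)
  then have "continuous_on {c..d} (\<lambda>s. integral {0..2 * pi} (\<lambda>t. \<phi> t s powr p))"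
    using integral_continuous_on_param by fastforce
  then show ?thesis
    unfolding cnorm_def using assms(1) by (intro continuous_on_powr_const) (auto simp: integral_powr_nonneg)
qed

text \<open>Jensen's inequality for the probability density proportional to \<open>e\<close>, proved with the tangent line of
  \<open>x powr p\<close> at the mean.\<close>

lemma integral_powr_le_weighted:
  fixes u e :: "real \<Rightarrow> real"
  assumes p: "1 \<le> p"
    and u: "continuous_on {c..d} u" "\<And>s. s \<in> {c..d} \<Longrightarrow> 0 \<le> u s"
    and e: "continuous_on {c..d} e" "\<And>s. s \<in> {c..d} \<Longrightarrow> 0 < e s"
    and Z: "Z = integral {c..d} e" "0 < Z"
  shows "(integral {c..d} u) powr p \<le> integral {c..d} (\<lambda>s. (Z / e s) powr (p - 1) * u s powr p)"
proof -
  define X where "X = integral {c..d} u"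
  have X: "0 \<le> X"
    unfolding X_def using u by (intro integral_nonneg integrable_continuous_interval) auto
  have int: "u integrable_on {c..d}" "e integrable_on {c..d}"
    using u e by (auto intro: integrable_continuous_interval)
  \<comment> \<open>Tangent line at the mean \<open>X\<close>, taken against the density
    \<open>e / Z\<close>: its linear term integrates to 0, because \<open>u\<close> has integral
    \<open>X\<close> and \<open>e\<close> has integral \<open>Z\<close>.\<close>
  have "X powr p = integral {c..d} (\<lambda>s. X powr p / Z * e s + p * X powr (p - 1) * (u s - X / Z * e s))"
  proof (rule integral_unique[symmetric])
    have "((\<lambda>s. X powr p / Z * e s + p * X powr (p - 1) * (u s - X / Z * e s)) has_integral
        X powr p / Z * Z + p * X powr (p - 1) * (X - X / Z * Z)) {c..d}"
      using int unfolding X_def Z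
      by (intro has_integral_add has_integral_mult_right has_integral_diff integrable_integral)
    then show "((\<lambda>s. X powr p / Z * e s + p * X powr (p - 1) * (u s - X / Z * e s)) has_integral
        X powr p) {c..d}"
      using Z by simp
  qed
  also have "\<dots> \<le> integral {c..d} (\<lambda>s. (Z / e s) powr (p - 1) * u s powr p)"
  proof (rule integral_le)
    show "(\<lambda>s. X powr p / Z * e s + p * X powr (p - 1) * (u s - X / Z * e s)) integrable_on {c..d}"
      using int by (intro integrable_add integrable_on_mult_right integrable_diff) auto
    show "(\<lambda>s. (Z / e s) powr (p - 1) * u s powr p) integrable_on {c..d}"
      using u e p Z
      by (intro integrable_continuous_interval continuous_intros continuous_on_powr_const) (auto, force+)
  next
    fix s assume s: "s \<in> {c..d}"
    then have es: "0 < e s" and us: "0 \<le> u s" using u e by auto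
    have "X powr p + p * X powr (p - 1) * (Z / e s * u s - X) \<le> (Z / e s * u s) powr p"
      using p X us es Z by (intro powr_tangent_le) auto
    then have "e s / Z * (X powr p + p * X powr (p - 1) * (Z / e s * u s - X)) \<le> e s / Z * (Z / e s * u s) powr p"
      using es Z by (intro mult_left_mono) auto
    moreover have "e s / Z * (Z / e s * u s) powr p = (Z / e s) powr (p - 1) * u s powr p"
      using es Z us by (simp add: powr_mult powr_diff powr_divide divide_simps)
    moreover have "e s / Z * (X powr p + p * X powr (p - 1) * (Z / e s * u s - X))
        = X powr p / Z * e s + p * X powr (p - 1) * (u s - X / Z * e s)"
      using es Z by (simp add: field_simps)
    ultimately show "X powr p / Z * e s + p * X powr (p - 1) * (u s - X / Z * e s)
        \<le> (Z / e s) powr (p - 1) * u s powr p" by simp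
  qed
  finally show ?thesis by (simp add: X_def)
qed

text \<open>Minkowski's integral inequality. Weighted Jensen is applied for each \<open>t\<close>
  with the density proportional to \<open>e s\<close>, the norm of the slice at \<open>s\<close>
  plus \<open>\<eta>\<close>. After the integrals are exchanged, the weight reduces the
  \<open>p\<close>-th power of this norm to its first power, which integrates to \<open>Z\<close>.
  The summand \<open>\<eta>\<close> keeps the density positive and contributes
  \<open>\<epsilon>\<close> to \<open>Z\<close>.\<close>

lemma cnorm_integral_le:
  fixes \<phi> :: "real \<Rightarrow> real \<Rightarrow> real"
  assumes p: "1 \<le> p" and cd: "c < d"
    and cont: "continuous_on ({0..2 * pi} \<times> {c..d}) (\<lambda>(t, s). \<phi> t s)"
    and nn: "\<And>t s. t \<in> {0..2 * pi} \<Longrightarrow> s \<in> {c..d} \<Longrightarrow> 0 \<le> \<phi> t s"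
  shows "cnorm p (\<lambda>t. integral {c..d} (\<phi> t)) \<le> integral {c..d} (\<lambda>s. cnorm p (\<lambda>t. \<phi> t s))"
proof (rule field_le_epsilon)
  fix \<epsilon> :: real assume "0 < \<epsilon>"
  define \<eta> where "\<eta> = \<epsilon> / (d - c)"
  have \<eta>: "0 < \<eta>" using \<open>0 < \<epsilon>\<close> cd by (simp add: \<eta>_def)
  define e where "e s = cnorm p (\<lambda>t. \<phi> t s) + \<eta>" for s
  define Z where "Z = integral {c..d} e"
  have cc: "continuous_on {c..d} (\<lambda>s. cnorm p (\<lambda>t. \<phi> t s))"
    using p cont nn by (intro continuous_on_cnorm) auto
  have ce: "continuous_on {c..d} e"
    unfolding e_def by (intro continuous_intros cc)
  have epos: "0 < e s" for s
    unfolding e_def using \<eta> by (simp add: add_nonneg_pos)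
  have Zeq: "Z = integral {c..d} (\<lambda>s. cnorm p (\<lambda>t. \<phi> t s)) + \<epsilon>"
    unfolding Z_def e_def using cd
    by (subst integral_add) (auto intro: integrable_continuous_interval cc simp: \<eta>_def)
  have "0 \<le> integral {c..d} (\<lambda>s. cnorm p (\<lambda>t. \<phi> t s))"
    by (intro integral_nonneg integrable_continuous_interval cc) auto
  with Zeq \<open>0 < \<epsilon>\<close> have Z: "0 < Z" by simp
  have c1: "continuous_on {c..d} (\<phi> t)" if "t \<in> {0..2 * pi}" for t
    using continuous_on_slice(1)[OF cont that] .
  define \<psi> where "\<psi> t s = (Z / e s) powr (p - 1) * \<phi> t s powr p" for t s
  have ce2: "continuous_on ({0..2 * pi} \<times> {c..d}) (\<lambda>x. e (snd x))"
    using ce by (rule continuous_on_compose2) (auto intro!: continuous_intros)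
  have c\<psi>: "continuous_on (cbox (0, c) (2 * pi, d)) (\<lambda>(t, s). \<psi> t s)"
  proof -
    have "continuous_on ({0..2 * pi} \<times> {c..d}) (\<lambda>x. \<phi> (fst x) (snd x) powr p)"
      using cont p nn by (intro continuous_on_powr_const) (auto simp: case_prod_unfold)
    moreover have "continuous_on ({0..2 * pi} \<times> {c..d}) (\<lambda>x. (Z / e (snd x)) powr (p - 1))"
      using Z less_imp_neq[OF epos] by (intro continuous_intros ce2) auto
    ultimately show ?thesis
      unfolding \<psi>_def case_prod_unfold by (auto simp: cbox_Pair_eq intro: continuous_on_mult)
  qed
  have cI: "continuous_on {0..2 * pi} (\<lambda>t. integral (cbox c d) (\<phi> t))"
    using cont by (intro integral_continuous_on_param) auto
  have cI2: "continuous_on {0..2 * pi} (\<lambda>t. integral (cbox c d) (\<psi> t))"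
    using c\<psi> by (intro integral_continuous_on_param) (auto simp: cbox_Pair_eq)
  have "integral {0..2 * pi} (\<lambda>t. (integral {c..d} (\<phi> t)) powr p)
      \<le> integral {0..2 * pi} (\<lambda>t. integral {c..d} (\<psi> t))"
  proof (rule integral_le)
    show "(\<lambda>t. (integral {c..d} (\<phi> t)) powr p) integrable_on {0..2 * pi}"
      using p cI nn c1
      by (intro powr_integrable_circle)
         (auto intro!: integral_nonneg integrable_continuous_interval)
    show "(\<lambda>t. integral {c..d} (\<psi> t)) integrable_on {0..2 * pi}"
      using cI2 by (intro integrable_continuous_interval) auto
    show "(integral {c..d} (\<phi> t)) powr p \<le> integral {c..d} (\<psi> t)" if "t \<in> {0..2 * pi}" for t
      unfolding \<psi>_def
      using integral_powr_le_weighted[OF p c1[OF that] nn[OF that] ce epos Z_def Z] by auto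
  qed
  also have "\<dots> = integral {c..d} (\<lambda>s. integral {0..2 * pi} (\<lambda>t. \<psi> t s))"
    using integral_swap_continuous[OF c\<psi>] by simp
  also have "\<dots> = integral {c..d} (\<lambda>s. (Z / e s) powr (p - 1) * cnorm p (\<lambda>t. \<phi> t s) powr p)"
    unfolding \<psi>_def using p by (intro integral_cong) (simp add: cnorm_powr)
  also have "\<dots> \<le> integral {c..d} (\<lambda>s. Z powr (p - 1) * e s)"
  proof (rule integral_le)
    show "(\<lambda>s. (Z / e s) powr (p - 1) * cnorm p (\<lambda>t. \<phi> t s) powr p) integrable_on {c..d}"
    proof (intro integrable_continuous_interval continuous_on_mult)
      show "continuous_on {c..d} (\<lambda>s. (Z / e s) powr (p - 1))"
        using Z less_imp_neq[OF epos] by (intro continuous_intros ce) auto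
    qed (use p in \<open>auto intro: continuous_on_powr_const cc\<close>)
    show "(\<lambda>s. Z powr (p - 1) * e s) integrable_on {c..d}"
      by (intro integrable_continuous_interval continuous_intros ce)
    fix s assume s: "s \<in> {c..d}"
    have "(Z / e s) powr (p - 1) * cnorm p (\<lambda>t. \<phi> t s) powr p \<le> (Z / e s) powr (p - 1) * e s powr p"
      using p \<eta> by (intro mult_left_mono powr_mono2) (auto simp: e_def)
    also have "\<dots> = Z powr (p - 1) * e s"
      using epos[of s] Z by (simp add: powr_divide powr_diff less_imp_neq)
    finally show "(Z / e s) powr (p - 1) * cnorm p (\<lambda>t. \<phi> t s) powr p \<le> Z powr (p - 1) * e s" .
  qed
  also have "\<dots> = Z powr (p - 1) * Z" by (simp add: Z_def)
  also have "\<dots> = Z powr p" using Z by (simp add: powr_diff)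
  finally have "cnorm p (\<lambda>t. integral {c..d} (\<phi> t)) \<le> Z"
    using p Z by (subst cnorm_le_iff) auto
  then show "cnorm p (\<lambda>t. integral {c..d} (\<phi> t)) \<le> integral {c..d} (\<lambda>s. cnorm p (\<lambda>t. \<phi> t s)) + \<epsilon>"
    using Zeq by simp
qed


text \<open>The argument of \<open>cnorm_integral_le\<close> with a density on two points, of masses
  \<open>\<alpha> / Z\<close> and \<open>\<beta> / Z\<close>. No dual exponent appears, so
  \<open>p = 1\<close> is included.\<close>

lemma cnorm_add_le:
  assumes p: "1 \<le> p"
    and u: "continuous_on {0..2 * pi} u" "\<And>t. t \<in> {0..2 * pi} \<Longrightarrow> 0 \<le> u t"
    and v: "continuous_on {0..2 * pi} v" "\<And>t. t \<in> {0..2 * pi} \<Longrightarrow> 0 \<le> v t"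
  shows "cnorm p (\<lambda>t. u t + v t) \<le> cnorm p u + cnorm p v"
proof (rule field_le_epsilon)
  fix \<epsilon> :: real assume \<epsilon>: "0 < \<epsilon>"
  define \<alpha> \<beta> where "\<alpha> = cnorm p u + \<epsilon> / 2" and "\<beta> = cnorm p v + \<epsilon> / 2"
  define Z where "Z = \<alpha> + \<beta>"
  have pos: "0 < \<alpha>" "0 < \<beta>" "0 < Z"
    using \<epsilon> cnorm_nonneg[of p u] cnorm_nonneg[of p v] unfolding \<alpha>_def \<beta>_def Z_def by linarith+
  have int: "(\<lambda>t. u t powr p) integrable_on {0..2 * pi}" "(\<lambda>t. v t powr p) integrable_on {0..2 * pi}"
    using p u v by (auto intro!: powr_integrable_circle)
  have weight: "a / Z * (X powr p + p * X powr (p - 1) * (Z / a * x - X)) \<le> (Z / a) powr (p - 1) * x powr p"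
    if "0 < a" "0 \<le> x" "0 \<le> X" for a x X
  proof -
    have "X powr p + p * X powr (p - 1) * (Z / a * x - X) \<le> (Z / a * x) powr p"
      using p that pos by (intro powr_tangent_le) auto
    then have "a / Z * (X powr p + p * X powr (p - 1) * (Z / a * x - X)) \<le> a / Z * (Z / a * x) powr p"
      using that pos by (intro mult_left_mono) auto
    also have "\<dots> = (Z / a) powr (p - 1) * x powr p"
      using that pos by (simp add: powr_mult powr_diff powr_divide divide_simps)
    finally show ?thesis .
  qed
  have pw: "(u t + v t) powr p \<le> (Z / \<alpha>) powr (p - 1) * u t powr p + (Z / \<beta>) powr (p - 1) * v t powr p"
    if t: "t \<in> {0..2 * pi}" for t
  proof -
    define X where "X = u t + v t"
    have X: "0 \<le> X" "0 \<le> u t" "0 \<le> v t" using t u v by (auto simp: X_def)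
    \<comment> \<open>As the masses add up to 1, the linear terms add up to a multiple of
      \<open>u t + v t - X\<close>, which is 0.\<close>
    have "\<alpha> / Z * (X powr p + p * X powr (p - 1) * (Z / \<alpha> * u t - X))
        + \<beta> / Z * (X powr p + p * X powr (p - 1) * (Z / \<beta> * v t - X))
        = X powr p * ((\<alpha> + \<beta>) / Z) + p * X powr (p - 1) * (u t + v t - X * ((\<alpha> + \<beta>) / Z))"
      using pos by (simp add: field_simps)
    also have "\<dots> = X powr p"
      using pos by (simp add: X_def flip: Z_def)
    finally show ?thesis
      using weight[OF pos(1) X(2) X(1)] weight[OF pos(2) X(3) X(1)] by (simp add: X_def)
  qed
  have "integral {0..2 * pi} (\<lambda>t. (u t + v t) powr p) \<le>
      integral {0..2 * pi} (\<lambda>t. (Z / \<alpha>) powr (p - 1) * u t powr p + (Z / \<beta>) powr (p - 1) * v t powr p)"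
    using p u v
    by (intro integral_le powr_integrable_circle pw integrable_add integrable_on_mult_right int continuous_intros)
       (auto intro!: add_nonneg_nonneg)
  also have "\<dots> = (Z / \<alpha>) powr (p - 1) * cnorm p u powr p + (Z / \<beta>) powr (p - 1) * cnorm p v powr p"
    using int p by (subst integral_add) (auto simp: cnorm_powr integrable_on_mult_right)
  also have "\<dots> \<le> (Z / \<alpha>) powr (p - 1) * \<alpha> powr p + (Z / \<beta>) powr (p - 1) * \<beta> powr p"
    using p \<epsilon> by (intro add_mono mult_left_mono powr_mono2) (auto simp: \<alpha>_def \<beta>_def)
  also have "\<dots> = Z powr (p - 1) * \<alpha> + Z powr (p - 1) * \<beta>"
    using pos by (simp add: powr_divide powr_diff)
  also have "\<dots> = Z powr (p - 1) * Z"
    by (simp add: Z_def distrib_left)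
  also have "\<dots> = Z powr p" using pos by (simp add: powr_diff)
  finally have "cnorm p (\<lambda>t. u t + v t) \<le> Z"
    using p pos by (subst cnorm_le_iff) auto
  then show "cnorm p (\<lambda>t. u t + v t) \<le> cnorm p u + cnorm p v + \<epsilon>"
    by (simp add: Z_def \<alpha>_def \<beta>_def)
qed

section \<open>Shifts and rotations of periodic integrands\<close>

lemma integral_periodic_shift:
  fixes u :: "real \<Rightarrow> 'a::euclidean_space"
  assumes cont: "continuous_on UNIV u" and per: "\<And>t. u (t + T) = u t" and T: "0 \<le> T"
  shows "integral {0..T} (\<lambda>t. u (t + s)) = integral {0..T} u"
proof -
  have *: "integral {0..T} (\<lambda>t. w (t + x)) = integral {0..T} w"
    if w: "continuous_on UNIV w" "\<And>t. w (t + T) = w t" and x: "0 \<le> x" for w :: "real \<Rightarrow> 'a" and x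
  proof -
    have int: "w integrable_on {a..b}" for a b
      using w(1) by (intro integrable_continuous_interval) (rule continuous_on_subset, auto)
    have "integral {0..x} w + integral {x..x + T} w = integral {0..T} w + integral {T..x + T} w"
      using T x int by (simp add: Henstock_Kurzweil_Integration.integral_combine)
    moreover have "integral {T..x + T} w = integral {0..x} (\<lambda>t. w (t + T))"
      using integral_shift_real_ivl[of T T "x + T" w] by simp
    moreover have "integral {x..x + T} w = integral {0..T} (\<lambda>t. w (t + x))"
      using integral_shift_real_ivl[of x x "x + T" w] by simp
    ultimately show ?thesis using w(2) by simp
  qed
  show ?thesis
  proof (cases "0 \<le> s")
    case True
    then show ?thesis using * assms by blast
  next
    case False
    \<comment> \<open>For negative \<open>s\<close> the shift is undone: the function translated by
      \<open>s\<close> is translated back by \<open>- s\<close>.\<close>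
    have "continuous_on UNIV (\<lambda>t. u (t + s))"
      by (intro continuous_on_compose2[OF cont] continuous_intros) auto
    moreover have "u (t + T + s) = u (t + s)" for t
      using per[of "t + s"] by (simp add: algebra_simps)
    ultimately show ?thesis
      using *[of "\<lambda>t. u (t + s)" "- s"] False by simp
  qed
qed

lemma integral_periodic_centered:
  fixes u :: "real \<Rightarrow> 'a::euclidean_space"
  assumes "continuous_on UNIV u" "\<And>t. u (t + 2 * pi) = u t"
  shows "integral {-pi..pi} u = integral {0..2 * pi} u"
  using integral_shift_real_ivl[of "-pi" "-pi" pi u] integral_periodic_shift[OF assms, of "-pi"]
  by simp

lemma cis_add_2pi [simp]: "cis (t + 2 * pi) = cis t"
  by (simp add: cis.ctr)

text \<open>Multiplication by the phase of \<open>c\<close> is a shift of \<open>t\<close>, so only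
  the modulus counts. This permits complex dilation parameters: a point on a tilted segment or on a
  small circle off the centre is treated like a radius.\<close>

lemma cnorm_rotate:
  fixes \<Phi> :: "complex \<Rightarrow> real"
  assumes "continuous_on (ball 0 R) \<Phi>" "cmod c < R" "0 < p" "\<And>z. z \<in> ball 0 R \<Longrightarrow> 0 \<le> \<Phi> z"
  shows "cnorm p (\<lambda>t. \<Phi> (c * cis t)) = cnorm p (\<lambda>t. \<Phi> (of_real (cmod c) * cis t))"
proof -
  define u where "u t = \<Phi> (of_real (cmod c) * cis t) powr p" for t
  have "continuous_on UNIV u"
    unfolding u_def using assms
    by (intro continuous_on_powr_const continuous_on_compose2[OF assms(1)] continuous_intros)
       (auto simp: norm_mult)
  moreover have "u (t + 2 * pi) = u t" for t
    by (simp add: u_def)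
  ultimately have "integral {0..2 * pi} (\<lambda>t. u (t + Arg c)) = integral {0..2 * pi} u"
    by (intro integral_periodic_shift) auto
  moreover have "of_real (cmod c) * cis (t + Arg c) = c * cis t" for t
    using rcis_cmod_Arg[of c] by (metis mult.commute mult.left_commute cis_mult rcis_def add.commute)
  ultimately have "integral {0..2 * pi} (\<lambda>t. \<Phi> (c * cis t) powr p) = integral {0..2 * pi} u"
    by (simp add: u_def)
  then show ?thesis
    by (simp add: cnorm_def u_def[abs_def])
qed

section \<open>The Poisson kernel\<close>

text \<open>The kernel of the circle of radius \<open>\<rho>\<close> at the point \<open>r\<close>
  of the positive axis, with total mass \<open>2 * pi\<close>. A point with argument
  \<open>t\<close> is handled by rotating the function instead, which is why
  \<open>cis (t + s)\<close> appears below.\<close>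

definition poisson_kernel :: "real \<Rightarrow> real \<Rightarrow> real \<Rightarrow> real" where
  "poisson_kernel r \<rho> s = (\<rho>\<^sup>2 - r\<^sup>2) / (cmod (of_real \<rho> * cis s - of_real r))\<^sup>2"

lemma circle_minus_real_nonzero:
  assumes "0 \<le> r" "r < \<rho>"
  shows "complex_of_real \<rho> * cis s - of_real r \<noteq> 0"
proof
  assume "complex_of_real \<rho> * cis s - of_real r = 0"
  then have "cmod (complex_of_real \<rho> * cis s) = cmod (of_real r)" by simp
  then show False using assms by (simp add: norm_mult)
qed

lemma poisson_kernel_pos: "0 \<le> r \<Longrightarrow> r < \<rho> \<Longrightarrow> 0 < poisson_kernel r \<rho> s"
  using circle_minus_real_nonzero[of r \<rho> s]
  by (simp add: poisson_kernel_def power2_eq_square mult_strict_mono')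

lemma continuous_on_poisson_kernel [continuous_intros]:
  assumes "0 \<le> r" "r < \<rho>" "continuous_on A f"
  shows "continuous_on A (\<lambda>x. poisson_kernel r \<rho> (f x))"
  unfolding poisson_kernel_def using assms circle_minus_real_nonzero[OF assms(1,2)]
  by (intro continuous_intros) auto

lemma poisson_kernel_le:
  assumes "0 \<le> r" "r < \<rho>"
  shows "poisson_kernel r \<rho> s \<le> (\<rho> + r) / (\<rho> - r)"
proof -
  have "\<rho> - r \<le> cmod (of_real \<rho> * cis s - of_real r)"
    using norm_triangle_ineq2[of "of_real \<rho> * cis s" "of_real r :: complex"] assms
    by (simp add: norm_mult)
  then have "(\<rho> - r)\<^sup>2 \<le> (cmod (of_real \<rho> * cis s - of_real r))\<^sup>2"
    using assms by (intro power_mono) auto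
  moreover have "0 \<le> \<rho>\<^sup>2 - r\<^sup>2" using assms by (simp add: power_mono)
  ultimately have "poisson_kernel r \<rho> s \<le> (\<rho>\<^sup>2 - r\<^sup>2) / (\<rho> - r)\<^sup>2"
    unfolding poisson_kernel_def using assms by (intro divide_left_mono) (auto intro!: mult_pos_pos)
  also have "\<dots> = (\<rho> + r) / (\<rho> - r)"
    using assms by (simp add: power2_eq_square divide_simps) (simp add: algebra_simps)
  finally show ?thesis .
qed

text \<open>The constant depends on neither \<open>r\<close> nor \<open>\<rho>\<close>. For
  \<open>|s| \<le> pi / 2\<close> the imaginary part suffices, by concavity of the sine; beyond that
  \<open>cos s \<le> 0\<close>, so the distance is at least \<open>\<rho> \<ge> 1 / 2\<close>,
  whereas \<open>|s| / (2 * pi) \<le> 1 / 2\<close>.\<close>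

lemma circle_distance_ge:
  assumes "0 \<le> r" "1 / 2 \<le> \<rho>" "\<bar>s\<bar> \<le> pi"
  shows "\<bar>s\<bar> / (2 * pi) \<le> cmod (of_real \<rho> * cis s - of_real r)"
proof (cases "\<bar>s\<bar> \<le> pi / 2")
  case True
  have sin: "\<bar>s\<bar> * (2 / pi) \<le> sin \<bar>s\<bar>"
  proof -
    have "concave_on {0..pi} sin"
      unfolding concave_on_def
      by (rule f''_ge0_imp_convex[where f' = "\<lambda>x. - cos x" and f'' = sin])
         (auto intro!: derivative_eq_intros sin_ge_zero)
    then have "(1 - 2 * \<bar>s\<bar> / pi) * sin 0 + (2 * \<bar>s\<bar> / pi) * sin (pi / 2)
      \<le> sin ((1 - 2 * \<bar>s\<bar> / pi) *\<^sub>R 0 + (2 * \<bar>s\<bar> / pi) *\<^sub>R (pi / 2))"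
      using True by (intro concave_onD) (auto simp: field_simps)
    then show ?thesis by (simp add: mult.commute)
  qed
  have "\<bar>s\<bar> / (2 * pi) \<le> 1 / 2 * (\<bar>s\<bar> * (2 / pi))"
    using assms by (simp add: field_simps)
  also have "\<dots> \<le> \<rho> * sin \<bar>s\<bar>"
    using sin assms by (intro mult_mono) auto
  also have "\<dots> = \<bar>\<rho> * sin s\<bar>"
    using assms sin_ge_zero[of "\<bar>s\<bar>"] by (cases "0 \<le> s") (auto simp: abs_mult)
  also have "\<dots> = \<bar>Im (of_real \<rho> * cis s - of_real r)\<bar>" by simp
  also have "\<dots> \<le> cmod (of_real \<rho> * cis s - of_real r)" by (rule abs_Im_le_cmod)
  finally show ?thesis .
next
  case False
  have "cos s \<le> 0"
    using False assms cos_ge_zero[of "\<bar>s\<bar> - pi"] by (cases "0 \<le> s") (auto simp: cos_diff)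
  then have "2 * \<rho> * cos s * r \<le> 0"
    using assms by (simp add: mult_nonpos_nonneg mult_nonneg_nonpos)
  moreover have "(cmod (of_real \<rho> * cis s - of_real r))\<^sup>2 = \<rho>\<^sup>2 * ((cos s)\<^sup>2 + (sin s)\<^sup>2) - 2 * \<rho> * cos s * r + r\<^sup>2"
  proof -
    have "(\<rho> * x - r)\<^sup>2 + (\<rho> * y)\<^sup>2 = \<rho>\<^sup>2 * (x\<^sup>2 + y\<^sup>2) - 2 * \<rho> * x * r + r\<^sup>2" for x y
      by (simp add: power2_eq_square algebra_simps)
    from this[of "cos s" "sin s"] show ?thesis unfolding cmod_power2 by simp
  qed
  ultimately have "\<rho>\<^sup>2 \<le> (cmod (of_real \<rho> * cis s - of_real r))\<^sup>2"
    using zero_le_power2[of r] by (smt (verit) sin_cos_squared_add2 mult_cancel_left1)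
  then have "\<rho> \<le> cmod (of_real \<rho> * cis s - of_real r)"
    using power2_le_imp_le norm_ge_zero by blast
  moreover have "\<bar>s\<bar> / (2 * pi) \<le> 1 / 2" using assms by (simp add: field_simps)
  ultimately show ?thesis using assms by linarith
qed

text \<open>The bound is uniform in \<open>\<rho>\<close> and so survives the limit
  \<open>\<rho>\<close> to 1. The numerator of the kernel is at most \<open>2 * (1 - r)\<close>, and
  8 is 2 times the square of the 2 in \<open>2 * pi\<close>.\<close>

lemma poisson_kernel_decay:
  assumes "0 \<le> r" "r < \<rho>" "1 / 2 \<le> \<rho>" "\<rho> \<le> 1" "\<bar>s\<bar> \<le> pi" "0 < x" "x \<le> \<bar>s\<bar>"
  shows "poisson_kernel r \<rho> s \<le> 8 * pi\<^sup>2 * (1 - r) / x\<^sup>2"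
proof -
  have "x / (2 * pi) \<le> \<bar>s\<bar> / (2 * pi)" using assms by (intro divide_right_mono) auto
  with circle_distance_ge[of r \<rho> s] assms
  have "x / (2 * pi) \<le> cmod (of_real \<rho> * cis s - of_real r)" by simp
  then have *: "(x / (2 * pi))\<^sup>2 \<le> (cmod (of_real \<rho> * cis s - of_real r))\<^sup>2"
    using assms by (intro power_mono) auto
  have "(\<rho> - r) * (\<rho> + r) \<le> (1 - r) * 2" using assms by (intro mult_mono) auto
  then have **: "\<rho>\<^sup>2 - r\<^sup>2 \<le> 2 * (1 - r)" "0 \<le> \<rho>\<^sup>2 - r\<^sup>2"
    using assms by (auto simp: power2_eq_square algebra_simps intro: mult_mono)
  have "poisson_kernel r \<rho> s \<le> 2 * (1 - r) / (x / (2 * pi))\<^sup>2"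
    unfolding poisson_kernel_def using * ** assms by (intro frac_le) auto
  also have "\<dots> = 8 * pi\<^sup>2 * (1 - r) / x\<^sup>2"
    by (simp add: power_divide power_mult_distrib)
  finally show ?thesis .
qed

text \<open>Cauchy's formula for \<open>f w (\<rho>\<^sup>2 - r\<^sup>2) / (\<rho>\<^sup>2 - r w)\<close> is the Poisson formula, because
  \<open>\<rho>\<^sup>2 - r w = w (cnj w - r)\<close> on the circle of radius \<open>\<rho>\<close>.\<close>

lemma poisson_formula:
  fixes f :: "complex \<Rightarrow> complex"
  assumes hol: "f holomorphic_on ball 0 R" and r: "0 \<le> r" "r < \<rho>" "\<rho> < R"
  shows "integral {-pi..pi} (\<lambda>s. of_real (poisson_kernel r \<rho> s) * f (of_real \<rho> * cis (t + s)))
    = 2 * pi * f (of_real r * cis t)"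
proof -
  define g where "g w = f (w * cis t) * (of_real (\<rho>\<^sup>2 - r\<^sup>2) / (of_real (\<rho>\<^sup>2) - of_real r * w))" for w :: complex
  have nz: "complex_of_real (\<rho>\<^sup>2) \<noteq> of_real r * w" if "cmod w \<le> \<rho>" for w
  proof
    assume "complex_of_real (\<rho>\<^sup>2) = of_real r * w"
    then have "cmod (complex_of_real (\<rho>\<^sup>2)) = cmod (r * w)" by (rule arg_cong)
    then have "\<rho>\<^sup>2 = r * cmod w" using r by (simp add: norm_mult norm_power)
    also have "\<dots> \<le> r * \<rho>" using that r by (intro mult_left_mono) auto
    also have "\<dots> < \<rho>\<^sup>2" using r by (simp add: power2_eq_square)
    finally show False by simp
  qed
  have holg: "g holomorphic_on cball 0 \<rho>"
    unfolding g_def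
  proof (intro holomorphic_on_mult holomorphic_on_divide)
    show "(\<lambda>w. f (w * cis t)) holomorphic_on cball 0 \<rho>"
      using r by (intro holomorphic_on_compose_gen[OF _ hol, unfolded o_def] holomorphic_intros)
        (auto simp: norm_mult)
    show "complex_of_real (\<rho>\<^sup>2) - of_real r * w \<noteq> 0" if "w \<in> cball 0 \<rho>" for w
      using nz[of w] that by simp
  qed (intro holomorphic_intros)+
  have "((\<lambda>u. g u / (u - r)) has_contour_integral (2 * of_real pi * \<i> * g r)) (circlepath 0 \<rho>)"
    using r holg by (intro Cauchy_integral_circlepath_simple) auto
  then have A: "((\<lambda>s. g (\<rho> * cis s) / (\<rho> * cis s - r) * \<rho> * \<i> * cis s) has_integral (2 * of_real pi * \<i> * g r)) {0..2 * pi}"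
    by (simp add: circlepath_def has_contour_integral_part_circlepath_iff)
  have eq: "g (\<rho> * cis s) / (\<rho> * cis s - r) * \<rho> * \<i> * cis s
      = \<i> * (of_real (poisson_kernel r \<rho> s) * f (of_real \<rho> * cis (t + s)))" for s
  proof -
    define w where "w = \<rho> * cis s"
    have w: "w \<noteq> 0" "w - r \<noteq> 0" "w * cnj w = \<rho>\<^sup>2" "cnj w - r \<noteq> 0"
      using r circle_minus_real_nonzero[of r \<rho> s] circle_minus_real_nonzero[of r \<rho> "-s"]
      by (auto simp: w_def power2_eq_square cis_cnj cis_mult)
    have "g w / (w - r) * \<rho> * \<i> * cis s = \<i> * (f (w * cis t) * (of_real (\<rho>\<^sup>2 - r\<^sup>2) / (w * cnj w - r * w)) / (w - r) * w)"
      unfolding g_def using w(3) by (simp add: w_def)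
    also have "w * cnj w - r * w = w * (cnj w - r)" by (simp add: algebra_simps)
    also have "f (w * cis t) * (of_real (\<rho>\<^sup>2 - r\<^sup>2) / (w * (cnj w - r))) / (w - r) * w
        = f (w * cis t) * (of_real (\<rho>\<^sup>2 - r\<^sup>2) / ((w - r) * (cnj w - r)))"
    proof -
      have "x * (k / (w * d)) / e * w = x * (k / (e * d))" for x k d e
        using w(1) by (simp add: divide_simps)
      then show ?thesis .
    qed
    also have "(w - r) * (cnj w - r) = (cmod (w - r))\<^sup>2"
      using complex_norm_square[of "w - r"] by simp
    also have "of_real (\<rho>\<^sup>2 - r\<^sup>2) / of_real ((cmod (w - r))\<^sup>2) = complex_of_real (poisson_kernel r \<rho> s)"
      by (simp add: poisson_kernel_def w_def)
    also have "w * cis t = of_real \<rho> * cis (t + s)"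
      by (simp add: w_def cis_mult add.commute)
    finally show ?thesis by (simp add: w_def mult.commute)
  qed
  \<comment> \<open>The extra factor is 1 at \<open>w = r\<close>, so Cauchy's formula returns
    \<open>f\<close> itself there.\<close>
  have gr: "g r = f (r * cis t)"
    using r nz[of r] by (simp add: g_def power2_eq_square)
  have e: "- \<i> * (2 * of_real pi * \<i> * g r) = 2 * pi * f (r * cis t)"
    unfolding gr by (simp add: complex_eq_iff)
  have "((\<lambda>s. of_real (poisson_kernel r \<rho> s) * f (of_real \<rho> * cis (t + s)))
      has_integral (2 * pi * f (r * cis t))) {0..2 * pi}"
    using has_integral_mult_right[OF A[unfolded eq], of "- \<i>", unfolded e] by simp
  moreover have "integral {-pi..pi} (\<lambda>s. of_real (poisson_kernel r \<rho> s) * f (of_real \<rho> * cis (t + s)))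
    = integral {0..2 * pi} (\<lambda>s. of_real (poisson_kernel r \<rho> s) * f (of_real \<rho> * cis (t + s)))"
  proof (rule integral_periodic_centered)
    show "continuous_on UNIV (\<lambda>s. of_real (poisson_kernel r \<rho> s) * f (of_real \<rho> * cis (t + s)))"
      using r by (intro continuous_intros continuous_on_compose2[OF holomorphic_on_imp_continuous_on[OF hol]])
        (auto simp: norm_mult)
  qed (simp_all add: poisson_kernel_def flip: add.assoc)
  ultimately show ?thesis by (simp add: integral_unique)
qed

lemma integral_poisson_kernel:
  assumes "0 \<le> r" "r < \<rho>"
  shows "integral {-pi..pi} (poisson_kernel r \<rho>) = 2 * pi"
proof -
  have "(\<lambda>s. complex_of_real (poisson_kernel r \<rho> s)) integrable_on {-pi..pi}"
    using assms by (intro integrable_continuous_interval continuous_intros)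
  moreover have "integral {-pi..pi} (\<lambda>s. complex_of_real (poisson_kernel r \<rho> s)) = of_real (2 * pi)"
    using poisson_formula[of "\<lambda>_. 1" "\<rho> + 1" r \<rho> 0] assms by (simp add: holomorphic_on_const)
  moreover have "integral {-pi..pi} (\<lambda>s. complex_of_real (poisson_kernel r \<rho> s))
      = of_real (integral {-pi..pi} (poisson_kernel r \<rho>))"
    using assms by (intro integral_linear[OF _ bounded_linear_of_real, unfolded o_def]
      integrable_continuous_interval continuous_intros)
  ultimately show ?thesis using of_real_eq_iff by metis
qed

lemma continuous_on_circle_compose:
  assumes "continuous_on (ball 0 R) \<Phi>" "cmod c < R" "continuous_on A h"
  shows "continuous_on A (\<lambda>x. \<Phi> (c * cis (h x)))"
  using assms by (intro continuous_on_compose2[OF assms(1)] continuous_intros) (auto simp: norm_mult)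

section \<open>Subharmonicity and monotonicity of circle norms\<close>

lemma poisson_submean:
  assumes hol: "f holomorphic_on ball 0 R" and r: "0 \<le> r" "r < \<rho>" "\<rho> < R"
  shows "2 * pi * cmod (f (of_real r * cis t))
    \<le> integral {-pi..pi} (\<lambda>s. poisson_kernel r \<rho> s * cmod (f (of_real \<rho> * cis (t + s))))"
proof -
  have c: "continuous_on {-pi..pi} (\<lambda>s. f (of_real \<rho> * cis (t + s)))"
    using r by (intro continuous_on_circle_compose[OF holomorphic_on_imp_continuous_on[OF hol]] continuous_intros) auto
  have "2 * pi * cmod (f (of_real r * cis t))
      = norm (integral {-pi..pi} (\<lambda>s. of_real (poisson_kernel r \<rho> s) * f (of_real \<rho> * cis (t + s))))"
    using poisson_formula[OF assms, of t] by (simp add: norm_mult)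
  also have "\<dots> \<le> integral {-pi..pi} (\<lambda>s. poisson_kernel r \<rho> s * cmod (f (of_real \<rho> * cis (t + s))))"
    using r c by (intro integral_norm_bound_integral integrable_continuous_interval continuous_intros)
      (auto simp: norm_mult less_imp_le[OF poisson_kernel_pos])
  finally show ?thesis .
qed

lemma cnorm_shift:
  assumes "continuous_on (ball 0 R) \<Phi>" "cmod c < R" "0 < p" "\<And>z. z \<in> ball 0 R \<Longrightarrow> 0 \<le> \<Phi> z"
  shows "cnorm p (\<lambda>t. \<Phi> (c * cis (t + s))) = cnorm p (\<lambda>t. \<Phi> (c * cis t))"
proof -
  have "cnorm p (\<lambda>t. \<Phi> ((c * cis s) * cis t)) = cnorm p (\<lambda>t. \<Phi> (of_real (cmod (c * cis s)) * cis t))"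
    using assms by (intro cnorm_rotate[of R]) (auto simp: norm_mult)
  moreover have "cnorm p (\<lambda>t. \<Phi> (c * cis t)) = cnorm p (\<lambda>t. \<Phi> (of_real (cmod c) * cis t))"
    using assms by (intro cnorm_rotate[of R]) auto
  ultimately show ?thesis by (simp add: norm_mult cis_mult mult.assoc add.commute)
qed

text \<open>Hardy's monotonicity of the means. The smaller circle is dominated by a Poisson mean of
  rotations of the larger one; all rotations have the same norm \<open>M\<close>, and Minkowski's
  inequality turns the mean of functions into a mean of norms.\<close>

lemma cnorm_holomorphic_mono:
  assumes hol: "f holomorphic_on ball 0 R" and r: "0 \<le> r" "r \<le> \<rho>" "\<rho> < R" and p: "1 \<le> p"
  shows "cnorm p (\<lambda>t. cmod (f (of_real r * cis t))) \<le> cnorm p (\<lambda>t. cmod (f (of_real \<rho> * cis t)))"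
proof (cases "r = \<rho>")
  case False
  then have r\<rho>: "r < \<rho>" using r by simp
  have cf: "continuous_on (ball 0 R) (\<lambda>z. cmod (f z))"
    by (intro continuous_intros holomorphic_on_imp_continuous_on hol)
  define \<phi> where "\<phi> t s = poisson_kernel r \<rho> s * cmod (f (of_real \<rho> * cis (t + s)))" for t s
  define M where "M = cnorm p (\<lambda>t. cmod (f (of_real \<rho> * cis t)))"
  have c\<phi>: "continuous_on (A \<times> B) (\<lambda>(t, s). \<phi> t s)" for A B
    unfolding \<phi>_def case_prod_unfold using r r\<rho>
    by (intro continuous_intros continuous_on_circle_compose[OF cf]) auto
  have "cnorm p (\<lambda>t. 2 * pi * cmod (f (of_real r * cis t))) \<le> cnorm p (\<lambda>t. integral {-pi..pi} (\<phi> t))"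
  proof (rule cnorm_mono)
    show "continuous_on {0..2 * pi} (\<lambda>t. integral {-pi..pi} (\<phi> t))"
      using integral_continuous_on_param[of "{0..2 * pi}" "-pi" pi \<phi>] c\<phi> by simp
    show "continuous_on {0..2 * pi} (\<lambda>t. 2 * pi * cmod (f (of_real r * cis t)))"
      using r r\<rho> by (intro continuous_intros continuous_on_circle_compose[OF cf]) auto
  qed (use p r r\<rho> poisson_submean[OF hol] in \<open>auto simp: \<phi>_def[abs_def]\<close>)
  also have "\<dots> \<le> integral {-pi..pi} (\<lambda>s. cnorm p (\<lambda>t. \<phi> t s))"
    using p r\<rho> r by (intro cnorm_integral_le c\<phi>) (auto simp: \<phi>_def less_imp_le[OF poisson_kernel_pos])
  also have "\<dots> = integral {-pi..pi} (\<lambda>s. poisson_kernel r \<rho> s * M)"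
  proof (rule integral_cong)
    fix s
    have "cnorm p (\<lambda>t. cmod (f (of_real \<rho> * cis (t + s)))) = M"
      unfolding M_def using r p by (intro cnorm_shift[OF cf]) auto
    then show "cnorm p (\<lambda>t. \<phi> t s) = poisson_kernel r \<rho> s * M"
      unfolding \<phi>_def using p r r\<rho> by (subst cnorm_cmult) (auto simp: less_imp_le[OF poisson_kernel_pos])
  qed
  also have "\<dots> = 2 * pi * M"
    using integral_poisson_kernel[OF r(1) r\<rho>] by simp
  finally show ?thesis
    using p by (subst (asm) cnorm_cmult) (auto simp: M_def)
qed simp

text \<open>Integrate \<open>deriv f\<close> along the segment from \<open>c0 * cis t\<close> to
  \<open>c1 * cis t\<close>. For a fixed position on the segment the points for varying
  \<open>t\<close> lie on one circle of radius at most \<open>\<rho>\<close>, so monotonicity bounds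
  every slice. Complex endpoints serve radial and angular displacements alike.\<close>

lemma cnorm_diff_segment_le:
  assumes hol: "f holomorphic_on ball 0 1" and c: "cmod c0 \<le> \<rho>" "cmod c1 \<le> \<rho>" "\<rho> < 1" and p: "1 \<le> p"
  shows "cnorm p (\<lambda>t. cmod (f (c1 * cis t) - f (c0 * cis t)))
    \<le> cmod (c1 - c0) * cnorm p (\<lambda>t. cmod (deriv f (of_real \<rho> * cis t)))"
proof -
  have hol': "deriv f holomorphic_on ball 0 1" using hol by (intro holomorphic_deriv) auto
  have cf: "continuous_on (ball 0 1) f" and cf': "continuous_on (ball 0 1) (\<lambda>z. cmod (deriv f z))"
    using hol hol' by (auto intro!: continuous_intros holomorphic_on_imp_continuous_on)
  define M where "M = cnorm p (\<lambda>t. cmod (deriv f (of_real \<rho> * cis t)))"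
  have lp: "cmod (linepath c0 c1 x) \<le> \<rho>" if "x \<in> {0..1}" for x
  proof -
    have "linepath c0 c1 x \<in> closed_segment c0 c1" using that by (auto simp: linepath_in_path)
    moreover have "closed_segment c0 c1 \<subseteq> cball 0 \<rho>" using c by (intro closed_segment_subset) auto
    ultimately show ?thesis by auto
  qed
  have cl: "continuous_on A (linepath c0 c1)" for A
    by (auto intro!: continuous_intros simp: linepath_def[abs_def])
  define \<phi> where "\<phi> t x = cmod (c1 - c0) * cmod (deriv f (linepath c0 c1 x * cis t))" for t x
  have c\<phi>: "continuous_on ({0..2 * pi} \<times> {0..1}) (\<lambda>(t, x). \<phi> t x)"
    unfolding \<phi>_def case_prod_unfold using lp c
    by (intro continuous_intros continuous_on_compose2[OF cf'] continuous_on_compose2[OF cl[of UNIV]])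
       (force simp: norm_mult)+
  have "cnorm p (\<lambda>t. cmod (f (c1 * cis t) - f (c0 * cis t))) \<le> cnorm p (\<lambda>t. integral {0..1} (\<phi> t))"
  proof (rule cnorm_mono)
    show "continuous_on {0..2 * pi} (\<lambda>t. cmod (f (c1 * cis t) - f (c0 * cis t)))"
      using c by (intro continuous_intros continuous_on_circle_compose[OF cf]) auto
    show "continuous_on {0..2 * pi} (\<lambda>t. integral {0..1} (\<phi> t))"
      using integral_continuous_on_param[of "{0..2 * pi}" 0 1 \<phi>] c\<phi> by simp
    fix t
    define u where "u x = deriv f (linepath c0 c1 x * cis t) * (c1 * cis t - c0 * cis t)" for x
    have lin: "linepath (c0 * cis t) (c1 * cis t) x = linepath c0 c1 x * cis t" for x
      by (simp add: linepath_def algebra_simps)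
    have "(deriv f has_contour_integral
        (f (pathfinish (linepath (c0 * cis t) (c1 * cis t))) - f (pathstart (linepath (c0 * cis t) (c1 * cis t)))))
        (linepath (c0 * cis t) (c1 * cis t))"
    proof (rule contour_integral_primitive[where S = "ball 0 1"])
      show "(f has_field_derivative deriv f x) (at x within ball 0 1)" if "x \<in> ball 0 1" for x
        using hol that by (meson DERIV_deriv_iff_field_differentiable has_field_derivative_at_within
            holomorphic_on_imp_differentiable_at open_ball)
      show "path_image (linepath (c0 * cis t) (c1 * cis t)) \<subseteq> ball 0 1"
        using c by (simp add: closed_segment_subset norm_mult)
    qed simp
    then have "(u has_integral (f (c1 * cis t) - f (c0 * cis t))) {0..1}"
      by (simp add: has_contour_integral_linepath u_def[abs_def] lin)
    moreover have "cmod (u x) \<le> \<phi> t x" for x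
      by (simp add: u_def \<phi>_def norm_mult flip: left_diff_distrib)
    moreover have "\<phi> t integrable_on {0..1}" if "t \<in> {0..2 * pi}"
      using continuous_on_slice(1)[OF c\<phi> that] by (rule integrable_continuous_interval)
    ultimately show "cmod (f (c1 * cis t) - f (c0 * cis t)) \<le> integral {0..1} (\<phi> t)" if "t \<in> {0..2 * pi}"
      using that integral_norm_bound_integral[of u "{0..1}" "\<phi> t"]
      by (simp add: has_integral_integrable_integral has_integral_iff)
  qed (use p in auto)
  also have "\<dots> \<le> integral {0..1} (\<lambda>x. cnorm p (\<lambda>t. \<phi> t x))"
    using p c\<phi> by (intro cnorm_integral_le) (auto simp: \<phi>_def)
  also have "\<dots> \<le> integral {0..1} (\<lambda>x::real. cmod (c1 - c0) * M)"
  proof (rule integral_le)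
    show "(\<lambda>x. cnorm p (\<lambda>t. \<phi> t x)) integrable_on {0..1}"
      using p c\<phi> by (intro integrable_continuous_interval continuous_on_cnorm) (auto simp: \<phi>_def)
    fix x :: real assume x: "x \<in> {0..1}"
    have "cnorm p (\<lambda>t. cmod (deriv f (linepath c0 c1 x * cis t)))
        = cnorm p (\<lambda>t. cmod (deriv f (of_real (cmod (linepath c0 c1 x)) * cis t)))"
      using lp[OF x] c p by (intro cnorm_rotate[OF cf']) auto
    also have "\<dots> \<le> M"
      unfolding M_def using lp[OF x] c p by (intro cnorm_holomorphic_mono[OF hol']) auto
    finally show "cnorm p (\<lambda>t. \<phi> t x) \<le> cmod (c1 - c0) * M"
      unfolding \<phi>_def using p by (subst cnorm_cmult) (auto intro: mult_left_mono)
  qed (auto intro: integrable_continuous_interval)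
  finally show ?thesis by (simp add: M_def)
qed

section \<open>The Schwarz-Pick inequality\<close>

lemma cmod_mobius_identity:
  "(cmod (1 - cnj a * z))\<^sup>2 - (cmod (z - a))\<^sup>2 = (1 - (cmod a)\<^sup>2) * (1 - (cmod z)\<^sup>2)"
  unfolding cmod_power2 by (simp add: power2_eq_square algebra_simps)

lemma cmod_diff_le_mobius:
  assumes "cmod a \<le> 1" "cmod z \<le> 1"
  shows "cmod (z - a) \<le> cmod (1 - cnj a * z)"
proof -
  have "0 \<le> (1 - (cmod a)\<^sup>2) * (1 - (cmod z)\<^sup>2)"
    using assms by (intro mult_nonneg_nonneg) (auto simp: power_le_one)
  then have "(cmod (z - a))\<^sup>2 \<le> (cmod (1 - cnj a * z))\<^sup>2"
    using cmod_mobius_identity[of a z] by linarith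
  then show ?thesis by (rule power2_le_imp_le) simp
qed

lemma one_minus_cnj_mult_nonzero:
  assumes "cmod a < 1" "cmod z \<le> 1"
  shows "1 - cnj a * z \<noteq> 0"
proof
  assume "1 - cnj a * z = 0"
  then have "cmod (cnj a * z) = 1" by simp
  moreover have "cmod (cnj a * z) \<le> cmod a * 1"
    using assms by (simp add: norm_mult mult_left_le)
  ultimately show False using assms by simp
qed

text \<open>The Schwarz lemma for \<open>G\<close>, which is \<open>f\<close> between two Moebius
  maps matching \<open>z\<close> and \<open>f z\<close> with 0. The form without denominators is the
  one that passes to limits.\<close>

lemma schwarz_pick_strict:
  assumes hol: "f holomorphic_on ball 0 1" and bd: "\<And>z. cmod z < 1 \<Longrightarrow> cmod (f z) < 1"
    and zw: "cmod z < 1" "cmod w < 1"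
  shows "cmod (f w - f z) * cmod (1 - cnj z * w) \<le> cmod (w - z) * cmod (1 - cnj (f z) * f w)"
proof -
  define G where "G \<zeta> = Moebius_function 0 (f z) (f (Moebius_function 0 (-z) \<zeta>))" for \<zeta>
  have hm: "Moebius_function 0 a holomorphic_on ball 0 1" if "cmod a < 1" for a
    using that by (rule Moebius_function_holomorphic)
  have "(Moebius_function 0 (f z) \<circ> (f \<circ> Moebius_function 0 (-z))) holomorphic_on ball 0 1"
    using zw by (intro holomorphic_on_compose_gen[where t = "ball 0 1"] hol hm bd)
      (auto intro!: Moebius_function_norm_lt_1 bd)
  then have "G holomorphic_on ball 0 1" by (simp add: G_def[abs_def] o_def)
  moreover have "G 0 = 0" by (simp add: G_def Moebius_function_simple)
  moreover have "cmod (G \<zeta>) < 1" if "cmod \<zeta> < 1" for \<zeta>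
    unfolding G_def by (intro Moebius_function_norm_lt_1 bd) (use that zw in auto)
  moreover have "cmod (Moebius_function 0 z w) < 1"
    using zw by (intro Moebius_function_norm_lt_1) auto
  ultimately have "cmod (G (Moebius_function 0 z w)) \<le> cmod (Moebius_function 0 z w)"
    by (intro Schwarz_Lemma(1)) auto
  moreover have "Moebius_function 0 (-z) (Moebius_function 0 z w) = w"
    using zw by (intro Moebius_function_compose) auto
  ultimately have "cmod (f w - f z) / cmod (1 - cnj (f z) * f w) \<le> cmod (w - z) / cmod (1 - cnj z * w)"
    by (simp add: G_def Moebius_function_simple norm_divide)
  moreover have "0 < cmod (1 - cnj (f z) * f w)" "0 < cmod (1 - cnj z * w)"
    using one_minus_cnj_mult_nonzero[of "f z" "f w"] one_minus_cnj_mult_nonzero[of z w] zw bd[of z] bd[of w]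
    by auto
  ultimately show ?thesis by (simp add: field_simps)
qed

text \<open>The Moebius maps require values strictly inside the disc; \<open>c n * f\<close> has
  them, and the inequality passes to the limit. The closed bound covers unimodular constants, which
  are inner functions too.\<close>

lemma schwarz_pick:
  assumes hol: "f holomorphic_on ball 0 1" and bd: "\<And>z. cmod z < 1 \<Longrightarrow> cmod (f z) \<le> 1"
    and zw: "cmod z < 1" "cmod w < 1"
  shows "cmod (f w - f z) * cmod (1 - cnj z * w) \<le> cmod (w - z) * cmod (1 - cnj (f z) * f w)"
proof -
  define c where "c n = complex_of_real (1 - 1 / real (Suc (Suc n)))" for n
  have c: "c \<longlonglongrightarrow> 1"
  proof -
    have "(\<lambda>n. complex_of_real (1 - 1 / real (Suc (Suc n)))) \<longlonglongrightarrow> of_real (1 - 0)"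
      by (intro tendsto_of_real tendsto_diff tendsto_const LIMSEQ_Suc[OF LIMSEQ_Suc[OF lim_1_over_n]])
    then show ?thesis by (simp add: c_def[abs_def])
  qed
  have cn: "cmod (c n) < 1" for n
    unfolding c_def norm_of_real by simp
  have "cmod (c n * f w - c n * f z) * cmod (1 - cnj z * w)
      \<le> cmod (w - z) * cmod (1 - cnj (c n * f z) * (c n * f w))" for n
  proof (rule schwarz_pick_strict[of "\<lambda>z. c n * f z"])
    show "cmod (c n * f z) < 1" if "cmod z < 1" for z
      using mult_left_mono[OF bd[OF that], of "cmod (c n)"] cn[of n] by (simp add: norm_mult)
  qed (use hol zw in \<open>auto intro!: holomorphic_intros\<close>)
  moreover have "(\<lambda>n. cmod (c n * f w - c n * f z) * cmod (1 - cnj z * w))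
      \<longlonglongrightarrow> cmod (1 * f w - 1 * f z) * cmod (1 - cnj z * w)"
    by (intro tendsto_intros c)
  moreover have "(\<lambda>n. cmod (w - z) * cmod (1 - cnj (c n * f z) * (c n * f w)))
      \<longlonglongrightarrow> cmod (w - z) * cmod (1 - cnj (1 * f z) * (1 * f w))"
    by (intro tendsto_intros c)
  ultimately have "cmod (1 * f w - 1 * f z) * cmod (1 - cnj z * w)
      \<le> cmod (w - z) * cmod (1 - cnj (1 * f z) * (1 * f w))"
    by (intro LIMSEQ_le) auto
  then show ?thesis by simp
qed

lemma schwarz_pick_deriv:
  assumes hol: "f holomorphic_on ball 0 1" and bd: "\<And>z. cmod z < 1 \<Longrightarrow> cmod (f z) \<le> 1"
    and z: "cmod z < 1"
  shows "cmod (deriv f z) * (1 - (cmod z)\<^sup>2) \<le> 1 - (cmod (f z))\<^sup>2"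
proof -
  have df: "(f has_field_derivative deriv f z) (at z)"
    using hol z by (intro holomorphic_derivI[of f "ball 0 1"]) auto
  have lim: "((\<lambda>w. cmod ((f w - f z) / (w - z)) * cmod (1 - cnj z * w))
      \<longlongrightarrow> cmod (deriv f z) * cmod (1 - cnj z * z)) (at z)"
    using df unfolding has_field_derivative_iff by (intro tendsto_intros)
  have lim2: "((\<lambda>w. cmod (1 - cnj (f z) * f w)) \<longlongrightarrow> cmod (1 - cnj (f z) * f z)) (at z)"
    using DERIV_isCont[OF df] by (intro tendsto_intros) (simp add: isCont_def)
  have "\<forall>\<^sub>F w in at z. w \<in> ball 0 1 - {z}"
    using z by (intro eventually_at_in_open) auto
  then have "\<forall>\<^sub>F w in at z. cmod ((f w - f z) / (w - z)) * cmod (1 - cnj z * w) \<le> cmod (1 - cnj (f z) * f w)"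
  proof eventually_elim
    case (elim w)
    then show ?case
      using schwarz_pick[OF hol bd z, of w] by (simp add: norm_divide field_simps)
  qed
  then have "cmod (deriv f z) * cmod (1 - cnj z * z) \<le> cmod (1 - cnj (f z) * f z)"
    by (rule tendsto_le[OF trivial_limit_at lim2 lim])
  moreover have "cmod (1 - cnj u * u) = 1 - (cmod u)\<^sup>2" if "cmod u \<le> 1" for u
  proof -
    have "1 - cnj u * u = of_real (1 - (cmod u)\<^sup>2)"
      using complex_norm_square[of u] by (simp add: mult.commute)
    then show ?thesis using that by (simp add: power_le_one del: of_real_diff)
  qed
  ultimately show ?thesis using z bd[OF z] by simp
qed

text \<open>\<open>N\<close> is at most \<open>1 - |I w|^2\<close> plus \<open>|I w - I z|\<close>.
  Within distance \<open>(1 - cmod z) / 2\<close> of \<open>z\<close>, Schwarz-Pick bounds the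
  second term by \<open>N / 2\<close>, which is absorbed on the left;
  \<open>1 - |I w|^2 \<le> 2 * (1 - |I w|)\<close> then gives the constant 4. The defect on the
  right is taken at the moving point \<open>w\<close>, so it can be integrated over a circle around
  \<open>z\<close>.\<close>

lemma one_minus_cnj_mult_le:
  assumes hol: "I holomorphic_on ball 0 1" and bd: "\<And>z. cmod z < 1 \<Longrightarrow> cmod (I z) \<le> 1"
    and z: "cmod z < 1" and w: "cmod (w - z) \<le> (1 - cmod z) / 2"
  shows "cmod (1 - cnj (I z) * I w) \<le> 4 * (1 - cmod (I w))"
proof -
  have w1: "cmod w < 1"
    using z w norm_triangle_sub[of w z] by (simp add: field_simps)
  define N where "N = cmod (1 - cnj (I z) * I w)"
  have "cmod (cnj z * (w - z)) \<le> cmod z * ((1 - cmod z) / 2)"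
    using z w unfolding norm_mult by (intro mult_mono) auto
  moreover have eq: "1 - cnj z * w = of_real (1 - (cmod z)\<^sup>2) - cnj z * (w - z)"
    using complex_norm_square[of z] by (simp add: algebra_simps)
  have "cmod (of_real (1 - (cmod z)\<^sup>2)) - cmod (cnj z * (w - z)) \<le> cmod (1 - cnj z * w)"
    unfolding eq by (rule norm_triangle_ineq2)
  moreover have "cmod (of_real (1 - (cmod z)\<^sup>2)) = 1 - (cmod z)\<^sup>2"
    using z by (simp add: power_le_one del: of_real_diff)
  ultimately have "1 - (cmod z)\<^sup>2 - cmod z * ((1 - cmod z) / 2) \<le> cmod (1 - cnj z * w)"
    by linarith
  moreover have "1 - (cmod z)\<^sup>2 - cmod z * ((1 - cmod z) / 2) = (1 - cmod z) * (1 + cmod z / 2)"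
    by (simp add: power2_eq_square field_simps)
  moreover have "(1 - cmod z) * 1 \<le> (1 - cmod z) * (1 + cmod z / 2)"
    using z by (intro mult_left_mono) auto
  ultimately have h: "1 - cmod z \<le> cmod (1 - cnj z * w)" by simp
  have "cmod (I w - I z) * (1 - cmod z) \<le> cmod (I w - I z) * cmod (1 - cnj z * w)"
    using h by (intro mult_left_mono) auto
  also have "\<dots> \<le> cmod (w - z) * N"
    unfolding N_def by (intro schwarz_pick hol bd z w1)
  also have "\<dots> \<le> (1 - cmod z) / 2 * N"
    using w by (intro mult_right_mono) (auto simp: N_def)
  finally have "(1 - cmod z) * cmod (I w - I z) \<le> (1 - cmod z) * (N / 2)"
    by (simp add: mult.commute)
  then have d: "cmod (I w - I z) \<le> N / 2" using z by simp
  have bw: "cmod (I w) \<le> 1" using bd w1 by blast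
  have sq: "cmod (of_real (1 - (cmod (I w))\<^sup>2)) = 1 - (cmod (I w))\<^sup>2"
    using bw by (simp add: power_le_one del: of_real_diff)
  have "1 - cnj (I z) * I w = of_real (1 - (cmod (I w))\<^sup>2) + I w * cnj (I w - I z)"
    using complex_norm_square[of "I w"] by (simp add: algebra_simps)
  then have "N \<le> (1 - (cmod (I w))\<^sup>2) + cmod (I w) * cmod (I w - I z)"
    unfolding N_def using norm_triangle_ineq[of "of_real (1 - (cmod (I w))\<^sup>2)" "I w * cnj (I w - I z)"] sq
    by (simp add: norm_mult del: of_real_diff complex_cnj_diff)
  also have "\<dots> \<le> 2 * (1 - cmod (I w)) + 1 * (N / 2)"
  proof (intro add_mono mult_mono d bw)
    have "0 \<le> (1 - cmod (I w))\<^sup>2" by simp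
    then show "1 - (cmod (I w))\<^sup>2 \<le> 2 * (1 - cmod (I w))"
      by (simp add: power2_eq_square algebra_simps)
  qed auto
  finally show ?thesis by (simp add: N_def)
qed

text \<open>The derivative of \<open>w \<mapsto> f w (1 - cnj (I z) I w)\<close> yields \<open>deriv f z\<close> without a division by \<open>I\<close>.\<close>

lemma deriv_factor_le:
  assumes hf: "f holomorphic_on ball 0 1" and hI: "I holomorphic_on ball 0 1"
    and bd: "\<And>z. cmod z < 1 \<Longrightarrow> cmod (I z) \<le> 1"
    and r: "0 \<le> r" "r < 1"
  defines "R \<equiv> (1 - r) / 2"
  defines "c \<equiv> \<lambda>\<theta>. of_real r + of_real R * cis \<theta>"
  shows "cmod (deriv f (of_real r * cis t)) \<le> cmod (deriv (\<lambda>z. f z * I z) (of_real r * cis t))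
    + integral {0..2 * pi} (\<lambda>\<theta>. 2 / (pi * R) * (cmod (f (c \<theta> * cis t)) * (1 - cmod (I (c \<theta> * cis t)))))"
proof -
  define z where "z = of_real r * cis t"
  have R: "0 < R" "r + R < 1" using r by (auto simp: R_def field_simps)
  have z: "cmod z = r" using r by (simp add: z_def norm_mult)
  define g where "g w = f w * (1 - cnj (I z) * I w)" for w
  have hg: "g holomorphic_on ball 0 1"
    unfolding g_def by (intro holomorphic_intros hf hI)
  have dfz: "(f has_field_derivative deriv f z) (at z)" and dIz: "(I has_field_derivative deriv I z) (at z)"
    using z r by (auto intro!: holomorphic_derivI[of _ "ball 0 1"] hf hI)
  have "(g has_field_derivative deriv f z * (1 - cnj (I z) * I z) - f z * (cnj (I z) * deriv I z)) (at z)"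
    unfolding g_def by (auto intro!: derivative_eq_intros dfz dIz simp: algebra_simps)
  then have dg: "deriv g z = deriv f z * (1 - cnj (I z) * I z) - f z * (cnj (I z) * deriv I z)"
    by (rule DERIV_imp_deriv)
  have "((\<lambda>z. f z * I z) has_field_derivative deriv f z * I z + f z * deriv I z) (at z)"
    by (auto intro!: derivative_eq_intros dfz dIz)
  then have dF: "deriv (\<lambda>z. f z * I z) z = deriv f z * I z + f z * deriv I z"
    by (rule DERIV_imp_deriv)
  \<comment> \<open>The terms containing \<open>deriv I z\<close> cancel, and
    \<open>deriv f z\<close> is left with coefficient 1.\<close>
  have "deriv f z = deriv g z + cnj (I z) * deriv (\<lambda>z. f z * I z) z"
    unfolding dg dF by (simp add: algebra_simps)
  then have "cmod (deriv f z) \<le> cmod (deriv g z) + cmod (I z) * cmod (deriv (\<lambda>z. f z * I z) z)"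
    using norm_triangle_ineq[of "deriv g z" "cnj (I z) * deriv (\<lambda>z. f z * I z) z"]
    by (simp only: norm_mult complex_mod_cnj)
  also have "cmod (I z) * cmod (deriv (\<lambda>z. f z * I z) z) \<le> 1 * cmod (deriv (\<lambda>z. f z * I z) z)"
    using bd z r by (intro mult_right_mono) auto
  finally have A: "cmod (deriv f z) \<le> cmod (deriv g z) + cmod (deriv (\<lambda>z. f z * I z) z)" by simp
  have cb: "cball z R \<subseteq> ball 0 1"
  proof
    fix w assume "w \<in> cball z R"
    then have "cmod (w - z) \<le> R" by (simp add: dist_norm norm_minus_commute)
    then show "w \<in> ball 0 1" using norm_triangle_sub[of w z] z R by simp
  qed
  have cg: "continuous_on (cball z R) g"
    using hg cb by (meson continuous_on_subset holomorphic_on_imp_continuous_on)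
  have "((\<lambda>u. g u / (u - z) ^ Suc 1) has_contour_integral (2 * pi * \<i> / fact 1 * (deriv ^^ 1) g z)) (circlepath z R)"
    using R cb by (intro Cauchy_has_contour_integral_higher_derivative_circlepath cg holomorphic_on_subset[OF hg])
      (auto simp: subset_iff)
  then have B: "((\<lambda>s. g (z + R * cis s) / (R * cis s)\<^sup>2 * R * \<i> * cis s) has_integral (2 * pi * \<i> * deriv g z)) {0..2 * pi}"
    by (simp add: circlepath_def has_contour_integral_part_circlepath_iff power2_eq_square)
  \<comment> \<open>\<open>k\<close> measures the angle relative to \<open>z\<close>: for fixed
    \<open>\<theta>\<close> its argument is the constant \<open>c \<theta>\<close> times
    \<open>cis t\<close>, the form suited to \<open>cnorm\<close>. The contour integral produces the
    absolute angle of \<open>k0\<close>; periodicity converts one into the other. The constant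
    \<open>2 / (pi * R)\<close> is \<open>4 / R\<close> divided by \<open>2 * pi\<close>.\<close>
  define k where "k \<theta> = 2 / (pi * R) * (cmod (f (c \<theta> * cis t)) * (1 - cmod (I (c \<theta> * cis t))))" for \<theta>
  have cz: "c \<theta> * cis t = z + R * cis (\<theta> + t)" for \<theta>
    by (simp add: c_def z_def algebra_simps flip: cis_mult)
  define k0 where "k0 s = 2 / (pi * R) * (cmod (f (z + R * cis s)) * (1 - cmod (I (z + R * cis s))))" for s
  have inb0: "cmod (z + R * cis s) < 1" for s
    using norm_triangle_ineq[of z "of_real R * cis s"] z R by (simp add: norm_mult)
  have ck0: "continuous_on UNIV k0"
    unfolding k0_def
    by (intro continuous_intros continuous_on_compose2[OF holomorphic_on_imp_continuous_on[OF hf]]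
        continuous_on_compose2[OF holomorphic_on_imp_continuous_on[OF hI]]) (use inb0 in auto)
  have "cmod (2 * pi * \<i> * deriv g z) \<le> integral {0..2 * pi} (\<lambda>s. 2 * pi * k0 s)"
    unfolding integral_unique[OF B, symmetric]
  proof (rule integral_norm_bound_integral)
    show "(\<lambda>s. 2 * pi * k0 s) integrable_on {0..2 * pi}"
      by (intro integrable_continuous_interval continuous_intros continuous_on_subset[OF ck0]) auto
    fix s
    define w where "w = z + R * cis s"
    have "cmod (w - z) = R" using R by (simp add: w_def norm_mult)
    then have "cmod (1 - cnj (I z) * I w) \<le> 4 * (1 - cmod (I w))"
      using z r by (intro one_minus_cnj_mult_le hI bd) (auto simp: R_def)
    then have "cmod (g w) \<le> cmod (f w) * (4 * (1 - cmod (I w)))"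
      unfolding g_def norm_mult by (intro mult_left_mono) auto
    then have "cmod (g w) / R \<le> cmod (f w) * (4 * (1 - cmod (I w))) / R"
      using R by (intro divide_right_mono) auto
    moreover have "cmod (g w / (R * cis s)\<^sup>2 * R * \<i> * cis s) = cmod (g w) / R"
      using R by (simp add: norm_mult norm_divide norm_power power2_eq_square)
    moreover have "2 * pi * k0 s = cmod (f w) * (4 * (1 - cmod (I w))) / R"
      using R by (simp add: k0_def w_def)
    ultimately show "cmod (g (z + R * cis s) / (R * cis s)\<^sup>2 * R * \<i> * cis s) \<le> 2 * pi * k0 s"
      unfolding w_def[symmetric] by linarith
  qed (use B in \<open>auto simp: has_integral_iff\<close>)
  then have "cmod (deriv g z) \<le> integral {0..2 * pi} k0"
    by (simp add: norm_mult)
  also have "\<dots> = integral {0..2 * pi} (\<lambda>\<theta>. k0 (\<theta> + t))"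
    by (intro integral_periodic_shift[symmetric] ck0) (auto simp: k0_def)
  also have "\<dots> = integral {0..2 * pi} k"
    by (simp add: k_def[abs_def] k0_def cz)
  finally show ?thesis using A by (simp add: z_def k_def[abs_def])
qed

section \<open>Inner functions and the Hardy space\<close>

text \<open>Starts at \<open>1 / 2\<close>, so no radius is 0. Dominated convergence and Montel's
  theorem are about sequences, hence a sequence instead of the filter
  \<open>at_left 1\<close>.\<close>

definition unit_seq :: "nat \<Rightarrow> real" where
  "unit_seq k = 1 - 1 / real (Suc (Suc k))"

lemma unit_seq_bounds: "0 < unit_seq k" "unit_seq k < 1"
  by (simp_all add: unit_seq_def field_simps)

lemma unit_seq_lim: "unit_seq \<longlonglongrightarrow> 1"
proof -
  have "(\<lambda>k. 1 - 1 / real (Suc (Suc k))) \<longlonglongrightarrow> 1 - 0"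
    by (intro tendsto_diff tendsto_const LIMSEQ_Suc[OF LIMSEQ_Suc[OF lim_1_over_n]])
  then show ?thesis by (simp add: unit_seq_def[abs_def])
qed

lemma unit_seq_at_left: "filterlim unit_seq (at_left 1) sequentially"
  by (auto simp: filterlim_at unit_seq_lim unit_seq_bounds less_imp_neq intro!: eventuallyI)

lemma inner_function_holomorphic: "inner_function I \<Longrightarrow> I holomorphic_on ball 0 1"
  by (simp add: inner_function_def hardy_infinity_def)

text \<open>Dominated convergence. The absolute value is there because \<open>I\<close> is so far
  only known to be bounded. The weight \<open>w\<close> will be the constant 1 or the square of a
  modulus on a fixed circle.\<close>

lemma inner_function_defect_lim:
  assumes I: "inner_function I" and w: "continuous_on {0..2 * pi} w"
  shows "(\<lambda>k. integral {0..2 * pi} (\<lambda>t. w t * \<bar>1 - cmod (I (of_real (unit_seq k) * cis t))\<bar>)) \<longlonglongrightarrow> 0"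
proof -
  define M where "M = lebesgue_on {0..2 * pi}"
  define F where "F k t = w t * \<bar>1 - cmod (I (of_real (unit_seq k) * cis t))\<bar>" for k t
  have cI: "continuous_on (ball 0 1) I"
    using inner_function_holomorphic[OF I] by (rule holomorphic_on_imp_continuous_on)
  have cF: "continuous_on {0..2 * pi} (F k)" for k
    unfolding F_def using unit_seq_bounds[of k]
    by (intro continuous_intros w continuous_on_circle_compose[OF cI]) auto
  obtain B where B: "\<And>z. z \<in> ball 0 1 \<Longrightarrow> cmod (I z) \<le> B"
    using I unfolding inner_function_def hardy_infinity_def bounded_iff by blast
  obtain W where W: "\<And>t. t \<in> {0..2 * pi} \<Longrightarrow> \<bar>w t\<bar> \<le> W"
    using compact_imp_bounded[OF compact_continuous_image[OF w compact_Icc]]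
    unfolding bounded_iff real_norm_def by blast
  have meas: "F k \<in> borel_measurable M" for k
    unfolding M_def by (intro continuous_imp_measurable_on_sets_lebesgue cF) auto
  have bound: "norm (F k t) \<le> W * (1 + B)" if "t \<in> {0..2 * pi}" for k t
  proof -
    have "cmod (I (of_real (unit_seq k) * cis t)) \<le> B"
      using unit_seq_bounds[of k] by (intro B) (simp add: norm_mult)
    then have "\<bar>1 - cmod (I (of_real (unit_seq k) * cis t))\<bar> \<le> 1 + B"
      using norm_ge_zero[of "I (of_real (unit_seq k) * cis t)"] by linarith
    then show ?thesis
      using W[OF that] unfolding F_def norm_mult by (intro mult_mono) (auto intro: order_trans[OF abs_ge_zero])
  qed
  have intconst: "integrable M (\<lambda>t. W * (1 + B))"
    unfolding M_def by simp
  have lim: "AE t in M. (\<lambda>k. F k t) \<longlonglongrightarrow> 0"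
  proof -
    have "AE t in lebesgue. t \<in> {0..2 * pi} \<longrightarrow>
        (\<exists>l. cmod l = 1 \<and> ((\<lambda>r. I (of_real r * cis t)) \<longlongrightarrow> l) (at_left 1))"
      using I by (simp add: inner_function_def)
    then have "AE t in M. \<exists>l. cmod l = 1 \<and> ((\<lambda>r. I (of_real r * cis t)) \<longlongrightarrow> l) (at_left 1)"
      unfolding M_def by (subst AE_restrict_space_iff) auto
    then show ?thesis
    proof eventually_elim
      case (elim t)
      then obtain l where l: "cmod l = 1" "((\<lambda>r. I (of_real r * cis t)) \<longlongrightarrow> l) (at_left 1)" by blast
      have "(\<lambda>k. I (of_real (unit_seq k) * cis t)) \<longlonglongrightarrow> l"
        using filterlim_compose[OF l(2) unit_seq_at_left] .
      then have "(\<lambda>k. F k t) \<longlonglongrightarrow> w t * \<bar>1 - cmod l\<bar>"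
        unfolding F_def by (intro tendsto_intros)
      then show ?case using l(1) by simp
    qed
  qed
  have "(\<lambda>k. integral\<^sup>L M (F k)) \<longlonglongrightarrow> integral\<^sup>L M (\<lambda>t. 0)"
    using bound
    by (intro integral_dominated_convergence[OF _ meas intconst lim]) (auto simp: M_def)
  moreover have "integral\<^sup>L M (F k) = integral {0..2 * pi} (F k)" for k
    unfolding M_def
    by (intro lebesgue_integral_eq_integral continuous_imp_integrable_real cF) auto
  ultimately show ?thesis by (simp add: F_def[abs_def])
qed

lemma circle_integral_shift:
  fixes \<Phi> :: "complex \<Rightarrow> real"
  assumes "continuous_on (ball 0 R) \<Phi>" "cmod c < R"
  shows "integral {-pi..pi} (\<lambda>s. \<Phi> (c * cis (t + s))) = integral {0..2 * pi} (\<lambda>s. \<Phi> (c * cis s))"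
proof -
  have c: "continuous_on UNIV (\<lambda>s. \<Phi> (c * cis s))" "continuous_on UNIV (\<lambda>s. \<Phi> (c * cis (t + s)))"
    by (intro continuous_on_circle_compose[OF assms] continuous_intros)+
  have "integral {-pi..pi} (\<lambda>s. \<Phi> (c * cis (t + s))) = integral {0..2 * pi} (\<lambda>s. \<Phi> (c * cis (t + s)))"
    by (rule integral_periodic_centered) (auto simp: c simp flip: add.assoc)
  also have "\<dots> = integral {0..2 * pi} (\<lambda>s. \<Phi> (c * cis s))"
    using integral_periodic_shift[of "\<lambda>s. \<Phi> (c * cis s)" "2 * pi" t] c by (simp add: add.commute)
  finally show ?thesis .
qed

text \<open>The definition provides only some bound for \<open>I\<close>. The Poisson mean of
  \<open>|I|\<close> over the circle of radius \<open>\<rho>\<close> is at most 1 plus a fixed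
  multiple of the mean deviation of \<open>|I|\<close> from 1, and this deviation tends to
  0.\<close>

lemma inner_function_le_1:
  assumes I: "inner_function I" and z: "cmod z < 1"
  shows "cmod (I z) \<le> 1"
proof -
  define r t where "r = cmod z" and "t = Arg z"
  have zrt: "z = of_real r * cis t"
    using rcis_cmod_Arg[of z] by (simp add: r_def t_def rcis_def)
  have r: "0 \<le> r" "r < 1" using z by (auto simp: r_def)
  have hI: "I holomorphic_on ball 0 1" by (rule inner_function_holomorphic[OF I])
  then have cI: "continuous_on (ball 0 1) (\<lambda>z. cmod (I z))"
    by (intro continuous_intros holomorphic_on_imp_continuous_on)
  define d where "d k = integral {0..2 * pi} (\<lambda>t. \<bar>1 - cmod (I (of_real (unit_seq k) * cis t))\<bar>)" for k
  have d: "d \<longlonglongrightarrow> 0"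
    using inner_function_defect_lim[OF I, of "\<lambda>_. 1"] by (simp add: d_def[abs_def])
  \<comment> \<open>Beyond the radius \<open>(1 + r) / 2\<close> the kernel at \<open>r\<close> is
    bounded by \<open>4 / (1 - r)\<close>, independently of \<open>\<rho>\<close>.\<close>
  have "\<forall>\<^sub>F k in sequentially. (1 + r) / 2 < unit_seq k"
    using r by (intro order_tendstoD(1)[OF unit_seq_lim]) simp
  then have "\<forall>\<^sub>F k in sequentially. 2 * pi * cmod (I z) \<le> 2 * pi + 4 / (1 - r) * d k"
  proof eventually_elim
    case (elim k)
    define \<rho> where "\<rho> = unit_seq k"
    have \<rho>: "r < \<rho>" "\<rho> < 1" "(1 - r) / 2 < \<rho> - r"
      using elim r unit_seq_bounds[of k] by (auto simp: \<rho>_def field_simps)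
    have int: "h integrable_on {-pi..pi}" if "continuous_on UNIV h" for h :: "real \<Rightarrow> real"
      using that by (intro integrable_continuous_interval) (rule continuous_on_subset, auto)
    have c: "continuous_on UNIV (\<lambda>s. I (of_real \<rho> * cis (t + s)))"
      using \<rho> r by (intro continuous_on_circle_compose[OF holomorphic_on_imp_continuous_on[OF hI]] continuous_intros) auto
    have "2 * pi * cmod (I z) \<le> integral {-pi..pi} (\<lambda>s. poisson_kernel r \<rho> s * cmod (I (of_real \<rho> * cis (t + s))))"
      unfolding zrt using r \<rho> by (intro poisson_submean[OF hI]) auto
    also have "\<dots> \<le> integral {-pi..pi} (\<lambda>s. poisson_kernel r \<rho> s
        + 4 / (1 - r) * \<bar>1 - cmod (I (of_real \<rho> * cis (t + s)))\<bar>)"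
    proof (intro integral_le int continuous_intros c r \<rho>)
      fix s
      have "poisson_kernel r \<rho> s \<le> (\<rho> + r) / (\<rho> - r)"
        using r \<rho> by (intro poisson_kernel_le)
      also have "\<dots> \<le> 2 / ((1 - r) / 2)"
        using r \<rho> by (intro frac_le) auto
      finally have P: "0 \<le> poisson_kernel r \<rho> s" "poisson_kernel r \<rho> s \<le> 4 / (1 - r)"
        using poisson_kernel_pos[of r \<rho> s] r \<rho> by auto
      define x where "x = cmod (I (of_real \<rho> * cis (t + s)))"
      have "poisson_kernel r \<rho> s * x \<le> poisson_kernel r \<rho> s * (1 + \<bar>1 - x\<bar>)"
        using P by (intro mult_left_mono) auto
      also have "\<dots> \<le> poisson_kernel r \<rho> s + 4 / (1 - r) * \<bar>1 - x\<bar>"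
        using mult_right_mono[OF P(2), of "\<bar>1 - x\<bar>"] by (simp add: algebra_simps)
      finally show "poisson_kernel r \<rho> s * cmod (I (of_real \<rho> * cis (t + s)))
         \<le> poisson_kernel r \<rho> s + 4 / (1 - r) * \<bar>1 - cmod (I (of_real \<rho> * cis (t + s)))\<bar>"
        by (simp add: x_def)
    qed
    also have "\<dots> = integral {-pi..pi} (poisson_kernel r \<rho>)
        + integral {-pi..pi} (\<lambda>s. 4 / (1 - r) * \<bar>1 - cmod (I (of_real \<rho> * cis (t + s)))\<bar>)"
      by (intro integral_add int continuous_intros c r \<rho>)
    also have "integral {-pi..pi} (\<lambda>s. 4 / (1 - r) * \<bar>1 - cmod (I (of_real \<rho> * cis (t + s)))\<bar>)
        = 4 / (1 - r) * integral {-pi..pi} (\<lambda>s. \<bar>1 - cmod (I (of_real \<rho> * cis (t + s)))\<bar>)"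
      by simp
    also have "integral {-pi..pi} (\<lambda>s. \<bar>1 - cmod (I (of_real \<rho> * cis (t + s)))\<bar>) = d k"
      unfolding d_def \<rho>_def[symmetric] using r \<rho>
      by (intro circle_integral_shift[where R = 1] continuous_intros cI) auto
    finally show ?case using integral_poisson_kernel[OF r(1) \<rho>(1)] by simp
  qed
  moreover have "(\<lambda>k. 2 * pi + 4 / (1 - r) * d k) \<longlonglongrightarrow> 2 * pi + 4 / (1 - r) * 0"
    by (intro tendsto_intros d)
  ultimately have "2 * pi * cmod (I z) \<le> 2 * pi + 4 / (1 - r) * 0"
    by (intro tendsto_lowerbound[where F = sequentially]) auto
  then show ?thesis by simp
qed

text \<open>Division by a finite Blaschke product: for a zero \<open>a\<close> of order
  \<open>n\<close>, the factor \<open>(z - a) ^ n\<close> is traded for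
  \<open>(1 - cnj a * z) ^ n\<close>, which has no zero in the disc, the same modulus on the unit
  circle and no smaller modulus inside. Holomorphy beyond the closed disc makes the zeros finite in
  number. Each step of the induction removes one zero with its full order, so the count of distinct
  zeros drops.\<close>

lemma zero_free_majorant:
  assumes "\<phi> holomorphic_on ball 0 R" "1 < R" "\<exists>z\<in>ball 0 R. \<phi> z \<noteq> 0"
  shows "\<exists>\<psi>. \<psi> holomorphic_on ball 0 R \<and> (\<forall>z\<in>ball 0 1. \<psi> z \<noteq> 0)
    \<and> (\<forall>z\<in>ball 0 1. cmod (\<phi> z) \<le> cmod (\<psi> z)) \<and> (\<forall>z\<in>sphere 0 1. cmod (\<phi> z) = cmod (\<psi> z))"
  using assms
proof (induction "card {z \<in> ball 0 1. \<phi> z = 0}" arbitrary: \<phi> rule: less_induct)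
  case less
  have fin: "finite {z \<in> ball 0 1. h z = 0}"
    if "h holomorphic_on ball 0 R" "\<exists>z\<in>ball 0 R. h z \<noteq> 0" for h :: "complex \<Rightarrow> complex"
  proof (cases "h constant_on ball 0 R")
    case True
    then obtain c where "\<And>z. z \<in> ball 0 R \<Longrightarrow> h z = c" by (auto simp: constant_on_def)
    then have "{z \<in> ball 0 1. h z = 0} = {}" using that(2) less.prems(2) by auto
    then show ?thesis by (simp only: finite.emptyI)
  next
    case False
    have "finite {z \<in> cball 0 1. h z = 0}"
      using that(1) False less.prems(2) by (intro holomorphic_compact_finite_zeros[of h "ball 0 R"]) auto
    then show ?thesis by (rule rev_finite_subset) auto
  qed
  show ?case
  proof (cases "\<exists>a\<in>ball 0 1. \<phi> a = 0")
    case False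
    then show ?thesis using less.prems(1) by blast
  next
    case True
    then obtain a where a: "cmod a < 1" "\<phi> a = 0" by auto
    have nc: "\<not> \<phi> constant_on ball 0 R"
    proof
      assume "\<phi> constant_on ball 0 R"
      then obtain c where "\<And>z. z \<in> ball 0 R \<Longrightarrow> \<phi> z = c" by (auto simp: constant_on_def)
      then show False using a less.prems(2,3) by (metis dist_0_norm mem_ball less_trans)
    qed
    obtain g r n where g: "0 < n" "0 < r" "ball a r \<subseteq> ball 0 R" "g holomorphic_on ball a r"
      "\<And>w. w \<in> ball a r \<Longrightarrow> \<phi> w = (w - a) ^ n * g w" "\<And>w. w \<in> ball a r \<Longrightarrow> g w \<noteq> 0"
    proof (rule holomorphic_factor_zero_nonconstant[of \<phi> "ball 0 R" a])
      show "a \<in> ball 0 R" using a less.prems(2) by simp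
    qed (use less.prems(1) a nc in auto)
    \<comment> \<open>The quotient by \<open>(z - a) ^ n\<close>, with its removable singularity
      filled in by the local factor \<open>g\<close>.\<close>
    define h where "h z = (if z = a then g a else \<phi> z / (z - a) ^ n)" for z
    have hg: "h z = g z" if "z \<in> ball a r" for z
      using that g(5)[OF that] by (simp add: h_def)
    have "h holomorphic_on ball a r"
      using g(4) by (rule holomorphic_transform) (simp add: hg)
    moreover have "h holomorphic_on ball 0 R - {a}"
    proof (rule holomorphic_transform)
      show "(\<lambda>z. \<phi> z / (z - a) ^ n) holomorphic_on ball 0 R - {a}"
        using less.prems(1) by (intro holomorphic_intros) (auto intro: holomorphic_on_subset)
    qed (auto simp: h_def)
    ultimately have "h holomorphic_on ball a r \<union> (ball 0 R - {a})"
      by (intro holomorphic_on_Un) auto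
    moreover have "ball a r \<union> (ball 0 R - {a}) = ball 0 R" using g(2,3) by auto
    ultimately have hh: "h holomorphic_on ball 0 R" by simp
    have \<phi>h: "\<phi> z = (z - a) ^ n * h z" for z
      using a g(1) by (simp add: h_def)
    define \<phi>' where "\<phi>' z = (1 - cnj a * z) ^ n * h z" for z
    have h': "\<phi>' holomorphic_on ball 0 R"
      unfolding \<phi>'_def by (intro holomorphic_intros hh)
    have ha: "h a \<noteq> 0" using g(2,6) by (simp add: h_def)
    have nz: "\<phi>' a \<noteq> 0" unfolding \<phi>'_def using ha one_minus_cnj_mult_nonzero[of a a] a by auto
    then have ex: "\<exists>z\<in>ball 0 R. \<phi>' z \<noteq> 0" using a less.prems(2) by (intro bexI[of _ a]) auto
    have "{z \<in> ball 0 1. \<phi>' z = 0} \<subset> {z \<in> ball 0 1. \<phi> z = 0}"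
    proof (rule psubsetI)
      show "{z \<in> ball 0 1. \<phi>' z = 0} \<subseteq> {z \<in> ball 0 1. \<phi> z = 0}"
        using one_minus_cnj_mult_nonzero[of a] a by (auto simp: \<phi>'_def \<phi>h)
      show "{z \<in> ball 0 1. \<phi>' z = 0} \<noteq> {z \<in> ball 0 1. \<phi> z = 0}"
        using nz a by auto
    qed
    then have "card {z \<in> ball 0 1. \<phi>' z = 0} < card {z \<in> ball 0 1. \<phi> z = 0}"
      by (intro psubset_card_mono fin less.prems)
    then obtain \<psi> where \<psi>: "\<psi> holomorphic_on ball 0 R" "\<forall>z\<in>ball 0 1. \<psi> z \<noteq> 0"
      "\<forall>z\<in>ball 0 1. cmod (\<phi>' z) \<le> cmod (\<psi> z)" "\<forall>z\<in>sphere 0 1. cmod (\<phi>' z) = cmod (\<psi> z)"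
      using less.hyps h' less.prems(2) ex by blast
    have "cmod (\<phi> z) \<le> cmod (\<phi>' z)" if "cmod z < 1" for z
      unfolding \<phi>h \<phi>'_def norm_mult norm_power using a that
      by (intro mult_right_mono power_mono cmod_diff_le_mobius) auto
    moreover have "cmod (\<phi> z) = cmod (\<phi>' z)" if "cmod z = 1" for z
    proof -
      have "(cmod (z - a))\<^sup>2 = (cmod (1 - cnj a * z))\<^sup>2"
        using cmod_mobius_identity[of a z] that by simp
      then have "cmod (z - a) = cmod (1 - cnj a * z)" by simp
      then show ?thesis by (simp add: \<phi>h \<phi>'_def norm_mult norm_power)
    qed
    ultimately show ?thesis using \<psi> by (intro exI[of _ \<psi>]) (force intro: order_trans)
  qed
qed


section \<open>Majorising H^1 functions by squares of H^2 functions\<close>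

lemma cnorm_1: "(\<And>t. 0 \<le> u t) \<Longrightarrow> cnorm 1 u = integral {0..2 * pi} u"
  using integral_powr_nonneg[of 0 "2 * pi" u 1] by (simp add: cnorm_def)

lemma circle_integrable:
  fixes \<Phi> :: "complex \<Rightarrow> 'a::euclidean_space"
  assumes "continuous_on (ball 0 R) \<Phi>" "cmod c < R"
  shows "(\<lambda>t. \<Phi> (c * cis t)) integrable_on {a..b}"
  using assms by (intro integrable_continuous_interval continuous_on_circle_compose continuous_intros)

lemma integral_circle_mono:
  assumes "f holomorphic_on ball 0 R" "0 \<le> r" "r \<le> \<rho>" "\<rho> < R"
  shows "integral {0..2 * pi} (\<lambda>t. cmod (f (of_real r * cis t)))
    \<le> integral {0..2 * pi} (\<lambda>t. cmod (f (of_real \<rho> * cis t)))"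
  using cnorm_holomorphic_mono[OF assms, of 1] by (simp add: cnorm_1)

text \<open>Supplies the local bounds for Montel's theorem from a bound on means alone. The kernel
  is at most \<open>2 / (\<rho> - r)\<close>; a surplus factor \<open>pi\<close> is dropped.\<close>

lemma locally_bounded_of_mean:
  assumes hol: "g holomorphic_on ball 0 1" and r: "0 \<le> r" "r < \<rho>" "\<rho> < 1" and z: "cmod z \<le> r"
    and L: "integral {0..2 * pi} (\<lambda>t. cmod (g (of_real \<rho> * cis t))) \<le> L"
  shows "cmod (g z) \<le> L / (\<rho> - r)"
proof -
  define x t where "x = cmod z" and "t = Arg z"
  have zrt: "z = of_real x * cis t"
    using rcis_cmod_Arg[of z] by (simp add: x_def t_def rcis_def)
  have x: "0 \<le> x" "x \<le> r" using z by (auto simp: x_def)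
  have cg: "continuous_on (ball 0 1) (\<lambda>z. cmod (g z))"
    by (intro continuous_intros holomorphic_on_imp_continuous_on hol)
  have c: "continuous_on {-pi..pi} (\<lambda>s. cmod (g (of_real \<rho> * cis (t + s))))"
    using r by (intro continuous_on_circle_compose[OF cg] continuous_intros) auto
  have "2 * pi * cmod (g z) \<le> integral {-pi..pi} (\<lambda>s. poisson_kernel x \<rho> s * cmod (g (of_real \<rho> * cis (t + s))))"
    unfolding zrt using x r by (intro poisson_submean[OF hol]) auto
  also have "\<dots> \<le> integral {-pi..pi} (\<lambda>s. 2 / (\<rho> - r) * cmod (g (of_real \<rho> * cis (t + s))))"
  proof (intro integral_le integrable_continuous_interval continuous_on_mult continuous_on_const c mult_right_mono)
    show "continuous_on {-pi..pi} (poisson_kernel x \<rho>)"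
      using x r by (intro continuous_intros) auto
    fix s
    have "poisson_kernel x \<rho> s \<le> (\<rho> + x) / (\<rho> - x)"
      using r x by (intro poisson_kernel_le) auto
    also have "\<dots> \<le> 2 / (\<rho> - r)" using r x by (intro frac_le) auto
    finally show "poisson_kernel x \<rho> s \<le> 2 / (\<rho> - r)" .
  qed auto
  also have "\<dots> = 2 / (\<rho> - r) * integral {0..2 * pi} (\<lambda>t. cmod (g (of_real \<rho> * cis t)))"
    using circle_integral_shift[OF cg, of "of_real \<rho>" t] r by simp
  also have "\<dots> \<le> 2 / (\<rho> - r) * L" using L r by (intro mult_left_mono) auto
  finally have "pi * cmod (g z) \<le> L / (\<rho> - r)" by simp
  moreover have "1 * cmod (g z) \<le> pi * cmod (g z)" using pi_gt3 by (intro mult_right_mono) auto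
  ultimately show ?thesis by simp
qed

text \<open>A weak form of the Riesz factorisation. The zero-free majorant \<open>\<psi>\<close> of
  the dilate of \<open>f\<close> by \<open>\<rho>\<close> has a square root; its square means are at
  most the integral of \<open>|\<psi>|\<close> over the unit circle, where \<open>|\<psi>|\<close>
  agrees with the dilate, hence at most \<open>L\<close>. Montel's theorem supplies a limit as
  \<open>\<rho>\<close> tends to 1. Asking only for an inequality between \<open>|f|\<close> and
  \<open>|g|^2\<close> spares infinite Blaschke products.\<close>

lemma hardy_square_majorant:
  assumes hol: "f holomorphic_on ball 0 1"
    and L: "\<And>r. 0 \<le> r \<Longrightarrow> r < 1 \<Longrightarrow> integral {0..2 * pi} (\<lambda>t. cmod (f (of_real r * cis t))) \<le> L"
  shows "\<exists>g. g holomorphic_on ball 0 1 \<and> (\<forall>z\<in>ball 0 1. cmod (f z) \<le> (cmod (g z))\<^sup>2)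
    \<and> (\<forall>r. 0 \<le> r \<longrightarrow> r < 1 \<longrightarrow> integral {0..2 * pi} (\<lambda>t. (cmod (g (of_real r * cis t)))\<^sup>2) \<le> L)"
proof (cases "\<forall>z\<in>ball 0 1. f z = 0")
  case True
  have "0 \<le> L" using L[of 0] True by (simp add: mult_nonneg_nonneg)
  then show ?thesis using True by (intro exI[of _ "\<lambda>_. 0"]) auto
next
  case False
  then obtain z0 where z0: "cmod z0 < 1" "f z0 \<noteq> 0" by auto
  define H where "H = {g. g holomorphic_on ball 0 1
    \<and> (\<forall>r. 0 \<le> r \<longrightarrow> r < 1 \<longrightarrow> integral {0..2 * pi} (\<lambda>t. (cmod (g (of_real r * cis t)))\<^sup>2) \<le> L)}"
  have ex: "\<exists>g\<in>H. \<forall>z\<in>ball 0 1. cmod (f (of_real \<rho> * z)) \<le> (cmod (g z))\<^sup>2"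
    if \<rho>: "0 < \<rho>" "\<rho> < 1" for \<rho>
  proof -
    define \<phi> where "\<phi> z = f (of_real \<rho> * z)" for z
    have R: "1 < 1 / \<rho>" using \<rho> by simp
    show ?thesis
    proof (cases "\<forall>z\<in>ball 0 (1 / \<rho>). \<phi> z = 0")
      case True
      have "z0 / of_real \<rho> \<in> ball 0 (1 / \<rho>)" using z0 \<rho> by (simp add: norm_divide divide_strict_right_mono)
      then have "\<phi> (z0 / of_real \<rho>) = 0" using True by blast
      then show ?thesis using z0 \<rho> by (simp add: \<phi>_def)
    next
      case False
      have "\<phi> holomorphic_on ball 0 (1 / \<rho>)"
        unfolding \<phi>_def using \<rho>
        by (intro holomorphic_on_compose_gen[OF _ hol, unfolded o_def] holomorphic_intros)
           (auto simp: norm_mult field_simps)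
      then obtain \<psi> where \<psi>: "\<psi> holomorphic_on ball 0 (1 / \<rho>)" "\<forall>z\<in>ball 0 1. \<psi> z \<noteq> 0"
        "\<forall>z\<in>ball 0 1. cmod (\<phi> z) \<le> cmod (\<psi> z)" "\<forall>z\<in>sphere 0 1. cmod (\<phi> z) = cmod (\<psi> z)"
        using zero_free_majorant[of \<phi> "1 / \<rho>"] R False by blast
      obtain g where g: "g holomorphic_on ball 0 1" "\<And>z. z \<in> ball 0 1 \<Longrightarrow> \<psi> z = g z ^ 2"
      proof (rule contractible_imp_holomorphic_sqrt[of \<psi> "ball 0 1"])
        show "\<psi> holomorphic_on ball 0 1"
          using \<psi>(1) R by (auto intro!: holomorphic_on_subset[OF \<psi>(1)] subset_ball)
      qed (use \<psi>(2) in \<open>auto intro: convex_imp_contractible\<close>)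
      have "integral {0..2 * pi} (\<lambda>t. (cmod (g (of_real r * cis t)))\<^sup>2) \<le> L" if r: "0 \<le> r" "r < 1" for r
      proof -
        have "integral {0..2 * pi} (\<lambda>t. (cmod (g (of_real r * cis t)))\<^sup>2)
            = integral {0..2 * pi} (\<lambda>t. cmod (\<psi> (of_real r * cis t)))"
          using r by (intro integral_cong) (simp add: g(2) norm_mult norm_power)
        also have "\<dots> \<le> integral {0..2 * pi} (\<lambda>t. cmod (\<psi> (of_real 1 * cis t)))"
          using r R by (intro integral_circle_mono[OF \<psi>(1)]) auto
        also have "\<dots> = integral {0..2 * pi} (\<lambda>t. cmod (f (of_real \<rho> * cis t)))"
          using \<psi>(4) by (intro integral_cong) (auto simp: \<phi>_def)
        also have "\<dots> \<le> L" using L \<rho> by simp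
        finally show ?thesis .
      qed
      then show ?thesis using g \<psi>(3) by (intro bexI[of _ g]) (auto simp: H_def \<phi>_def norm_power)
    qed
  qed
  have "\<forall>k. \<exists>g\<in>H. \<forall>z\<in>ball 0 1. cmod (f (of_real (unit_seq k) * z)) \<le> (cmod (g z))\<^sup>2"
    using ex unit_seq_bounds by blast
  then obtain G where G: "\<And>k. G k \<in> H"
    "\<And>k z. z \<in> ball 0 1 \<Longrightarrow> cmod (f (of_real (unit_seq k) * z)) \<le> (cmod (G k z))\<^sup>2"
    by metis
  \<comment> \<open>The mean bound concerns the holomorphic function \<open>h^2\<close>, and
    \<open>|h| \<le> 1 + |h|^2\<close> returns to \<open>h\<close>.\<close>
  have bdd: "\<exists>B. \<forall>h\<in>H. \<forall>z\<in>K. cmod (h z) \<le> B" if K: "compact K" "K \<subseteq> ball 0 1" for K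
  proof -
    obtain r where r: "0 \<le> r" "r < 1" "\<And>z. z \<in> K \<Longrightarrow> cmod z \<le> r"
    proof (cases "K = {}")
      case False
      obtain z1 where "z1 \<in> K" "\<And>z. z \<in> K \<Longrightarrow> cmod z \<le> cmod z1"
        using continuous_attains_sup[OF K(1) False, of cmod] by (auto intro: continuous_intros)
      then show ?thesis using that[of "cmod z1"] K(2) by auto
    qed (use that[of 0] in auto)
    define \<rho> where "\<rho> = (1 + r) / 2"
    have \<rho>: "r < \<rho>" "\<rho> < 1" using r by (auto simp: \<rho>_def)
    have "cmod (h z) \<le> 1 + L / (\<rho> - r)" if "h \<in> H" "z \<in> K" for h z
    proof -
      have "cmod ((h z)\<^sup>2) \<le> L / (\<rho> - r)"
        using that r \<rho> by (intro locally_bounded_of_mean[of "\<lambda>z. (h z)\<^sup>2"])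
          (auto simp: H_def norm_power intro!: holomorphic_intros)
      moreover have "cmod (h z) \<le> 1 + (cmod (h z))\<^sup>2"
        using zero_le_power2[of "cmod (h z) - 1", unfolded power2_diff power_one] norm_ge_zero[of "h z"]
        by linarith
      ultimately show ?thesis by (simp add: norm_power)
    qed
    then show ?thesis by blast
  qed
  have rG: "range G \<subseteq> H" using G by auto
  obtain g \<sigma> where g: "g holomorphic_on ball 0 1" "strict_mono \<sigma>"
    "\<And>z. z \<in> ball 0 1 \<Longrightarrow> (\<lambda>n. G (\<sigma> n) z) \<longlonglongrightarrow> g z"
  proof (rule Montel[of "ball 0 1" H G])
    show "h holomorphic_on ball 0 1" if "h \<in> H" for h
      using that by (simp add: H_def)
  qed (use bdd rG in auto)
  have "cmod (f z) \<le> (cmod (g z))\<^sup>2" if z: "z \<in> ball 0 1" for z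
  proof -
    have "(\<lambda>n. of_real (unit_seq (\<sigma> n)) * z) \<longlonglongrightarrow> of_real 1 * z"
      by (intro tendsto_intros LIMSEQ_subseq_LIMSEQ[OF unit_seq_lim g(2), unfolded o_def])
    moreover have "isCont f z"
      using holomorphic_on_imp_continuous_on[OF hol] z by (simp add: continuous_on_eq_continuous_at)
    ultimately have "(\<lambda>n. f (of_real (unit_seq (\<sigma> n)) * z)) \<longlonglongrightarrow> f z"
      using isCont_tendsto_compose[of z f] by simp
    then have "(\<lambda>n. cmod (f (of_real (unit_seq (\<sigma> n)) * z))) \<longlonglongrightarrow> cmod (f z)"
      by (intro tendsto_intros)
    moreover have "(\<lambda>n. (cmod (G (\<sigma> n) z))\<^sup>2) \<longlonglongrightarrow> (cmod (g z))\<^sup>2"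
      by (intro tendsto_intros g(3) z)
    ultimately show ?thesis
      by (rule LIMSEQ_le) (use G(2) z in auto)
  qed
  moreover have "integral {0..2 * pi} (\<lambda>t. (cmod (g (of_real r * cis t)))\<^sup>2) \<le> L" if r: "0 \<le> r" "r < 1" for r
  proof -
    obtain B where B: "\<And>h z. h \<in> H \<Longrightarrow> z \<in> cball 0 r \<Longrightarrow> cmod (h z) \<le> B"
    proof -
      have "cball 0 r \<subseteq> ball (0::complex) 1" using r by auto
      then show ?thesis using bdd[OF compact_cball] that by blast
    qed
    have hG: "G n holomorphic_on ball 0 1" for n using G(1)[of n] by (simp add: H_def)
    \<comment> \<open>On a fixed circle the members of \<open>H\<close> are uniformly bounded, so
      the limit inherits the mean bound by dominated convergence.\<close>
    have "(\<lambda>n. integral {0..2 * pi} (\<lambda>t. (cmod (G (\<sigma> n) (of_real r * cis t)))\<^sup>2))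
        \<longlonglongrightarrow> integral {0..2 * pi} (\<lambda>t. (cmod (g (of_real r * cis t)))\<^sup>2)"
    proof (rule dominated_convergence(2)[where h = "\<lambda>_. B\<^sup>2"])
      show "(\<lambda>t. (cmod (G (\<sigma> n) (of_real r * cis t)))\<^sup>2) integrable_on {0..2 * pi}" for n
        using r by (intro circle_integrable[of 1 "\<lambda>z. (cmod (G (\<sigma> n) z))\<^sup>2"] continuous_intros
          holomorphic_on_imp_continuous_on hG) auto
      show "(\<lambda>n. (cmod (G (\<sigma> n) (of_real r * cis t)))\<^sup>2) \<longlonglongrightarrow> (cmod (g (of_real r * cis t)))\<^sup>2" for t
        using r by (intro tendsto_intros g(3)) (simp add: norm_mult)
      show "norm ((cmod (G (\<sigma> n) (of_real r * cis t)))\<^sup>2) \<le> B\<^sup>2" for n t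
        using B[OF G(1), of "of_real r * cis t" "\<sigma> n"] r by (simp add: norm_mult power_mono)
    qed auto
    then show ?thesis
      by (rule LIMSEQ_le_const2) (use G(1) r in \<open>auto simp: H_def\<close>)
  qed
  ultimately show ?thesis using g(1) by blast
qed

text \<open>Parseval's formula on two circles at once. The value depends only on the product
  \<open>\<rho> * \<sigma>\<close> and increases with it, which is what the next lemma exploits. One
  factor is expanded in its Taylor series while the other enters through Cauchy's coefficient
  formula, so only one series has to be integrated termwise.\<close>

lemma circle_inner_product_sums:
  assumes hol: "g holomorphic_on ball 0 1" and \<rho>: "0 \<le> \<rho>" "\<rho> < 1" and \<sigma>: "0 < \<sigma>" "\<sigma> < 1"
  shows "(\<lambda>n. 2 * pi * (cmod ((deriv ^^ n) g 0 / fact n))\<^sup>2 * (\<rho> * \<sigma>) ^ n) sums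
    integral {0..2 * pi} (\<lambda>t. Re (g (of_real \<rho> * cis t) * cnj (g (of_real \<sigma> * cis t))))"
proof -
  define a where "a n = (deriv ^^ n) g 0 / fact n" for n
  have cg: "continuous_on (ball 0 1) g" using hol by (rule holomorphic_on_imp_continuous_on)
  have ser: "(\<lambda>n. a n * z ^ n) sums g z" if "cmod z < 1" for z
    using holomorphic_power_series[OF hol, of z] that by (simp add: a_def)
  have cgs: "continuous_on A (\<lambda>t. g (of_real \<sigma> * cis t))" for A
    using \<sigma> by (intro continuous_on_circle_compose[OF cg] continuous_intros) auto
  \<comment> \<open>On the unit circle \<open>cnj (cis t ^ n)\<close> is
    \<open>1 / cis t ^ n\<close>, so the conjugate of this integral is Cauchy's formula for the
    coefficient \<open>a n\<close>; \<open>0 < \<sigma>\<close> permits cancelling the power of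
    \<open>\<sigma>\<close>.\<close>
  have coef: "integral {0..2 * pi} (\<lambda>t. cis (of_nat n * t) * cnj (g (of_real \<sigma> * cis t)))
      = cnj (2 * pi * a n * of_real \<sigma> ^ n)" for n
  proof -
    have "((\<lambda>u. g u / (u - 0) ^ Suc n) has_contour_integral (2 * pi * \<i> / fact n * (deriv ^^ n) g 0)) (circlepath 0 \<sigma>)"
      using \<sigma> by (intro Cauchy_has_contour_integral_higher_derivative_circlepath continuous_on_subset[OF cg]
        holomorphic_on_subset[OF hol]) auto
    then have "((\<lambda>t. g (\<sigma> * cis t) / (\<sigma> * cis t) ^ Suc n * \<sigma> * \<i> * cis t) has_integral (2 * pi * \<i> * a n)) {0..2 * pi}"
      by (simp add: circlepath_def has_contour_integral_part_circlepath_iff a_def)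
    moreover have "g (\<sigma> * cis t) / (\<sigma> * cis t) ^ Suc n * \<sigma> * \<i> * cis t
        = \<i> / of_real \<sigma> ^ n * cnj (cis (of_nat n * t) * cnj (g (of_real \<sigma> * cis t)))" for t
    proof -
      have "cis (of_nat n * t) = cis t ^ n" by (simp only: Complex.DeMoivre)
      moreover have "cnj (cis t ^ n) = 1 / cis t ^ n"
        by (simp add: cis_cnj Complex.DeMoivre divide_inverse)
      ultimately show ?thesis using \<sigma> by (simp add: power_mult_distrib field_simps)
    qed
    ultimately have "((\<lambda>t. \<i> / of_real \<sigma> ^ n * cnj (cis (of_nat n * t) * cnj (g (of_real \<sigma> * cis t))))
        has_integral (2 * pi * \<i> * a n)) {0..2 * pi}"
      by simp
    from has_integral_mult_right[OF this, of "of_real \<sigma> ^ n / \<i>"]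
    have "((\<lambda>t. cnj (cis (of_nat n * t) * cnj (g (of_real \<sigma> * cis t)))) has_integral
        (of_real \<sigma> ^ n / \<i> * (2 * pi * \<i> * a n))) {0..2 * pi}"
      using \<sigma> by simp
    then have "((cnj \<circ> (\<lambda>t. cnj (cis (of_nat n * t) * cnj (g (of_real \<sigma> * cis t))))) has_integral
        cnj (of_real \<sigma> ^ n / \<i> * (2 * pi * \<i> * a n))) {0..2 * pi}"
      by (rule has_integral_linear) (rule bounded_linear_cnj)
    moreover have "of_real \<sigma> ^ n / \<i> * (2 * pi * \<i> * a n) = 2 * pi * a n * of_real \<sigma> ^ n"
    proof -
      have "x / \<i> * (c * \<i> * y) = c * y * x * (\<i> / \<i>)" for c x y :: complex
        by (simp only: times_divide_eq_left times_divide_eq_right mult_ac)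
      then have "x / \<i> * (c * \<i> * y) = c * y * x" for c x y :: complex
        by simp
      then show ?thesis .
    qed
    ultimately have "((\<lambda>t. cis (of_nat n * t) * cnj (g (of_real \<sigma> * cis t))) has_integral
        cnj (2 * pi * a n * of_real \<sigma> ^ n)) {0..2 * pi}"
      by (simp only: o_def complex_cnj_cnj)
    then show ?thesis by (rule integral_unique)
  qed
  obtain B where B: "\<And>t. t \<in> {0..2 * pi} \<Longrightarrow> cmod (g (of_real \<sigma> * cis t)) \<le> B"
    using compact_imp_bounded[OF compact_continuous_image[OF cgs compact_Icc]]
    unfolding bounded_iff by blast
  \<comment> \<open>Absolute convergence at \<open>\<rho>\<close> follows from convergence at the
    larger radius \<open>(1 + \<rho>) / 2\<close>. The sum later dominates all partial sums.\<close>
  have sum\<rho>: "summable (\<lambda>n. cmod (a n) * \<rho> ^ n)"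
  proof -
    have "summable (\<lambda>n. a n * of_real ((1 + \<rho>) / 2) ^ n)"
      using ser[of "of_real ((1 + \<rho>) / 2)"] \<rho> by (intro sums_summable) (auto simp del: of_real_divide of_real_add)
    then have "summable (\<lambda>n. norm (a n * of_real \<rho> ^ n))"
      by (rule powser_insidea) (use \<rho> in \<open>simp del: of_real_divide of_real_add\<close>)
    then show ?thesis using \<rho> by (simp add: norm_mult norm_power)
  qed
  define F where "F k t = Re ((\<Sum>n<k. a n * (of_real \<rho> * cis t) ^ n) * cnj (g (of_real \<sigma> * cis t)))" for k t
  have int: "(\<lambda>t. a n * of_real \<rho> ^ n * (cis (of_nat n * t) * cnj (g (of_real \<sigma> * cis t)))) integrable_on {0..2 * pi}" for n
    by (intro integrable_continuous_interval continuous_intros cgs)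
  have F_eq: "F k t = Re (\<Sum>n<k. a n * of_real \<rho> ^ n * (cis (of_nat n * t) * cnj (g (of_real \<sigma> * cis t))))" for k t
    unfolding F_def sum_distrib_right
    by (intro arg_cong[where f = Re] sum.cong) (simp_all add: power_mult_distrib Complex.DeMoivre mult.assoc)
  have intF: "integral {0..2 * pi} (F k) = (\<Sum>n<k. 2 * pi * (cmod (a n))\<^sup>2 * (\<rho> * \<sigma>) ^ n)" for k
  proof -
    have "integral {0..2 * pi} (F k) = integral {0..2 * pi}
        (Re \<circ> (\<lambda>t. \<Sum>n<k. a n * of_real \<rho> ^ n * (cis (of_nat n * t) * cnj (g (of_real \<sigma> * cis t)))))"
      unfolding o_def by (intro integral_cong) (rule F_eq)
    also have "\<dots> = Re (integral {0..2 * pi} (\<lambda>t. \<Sum>n<k. a n * of_real \<rho> ^ n * (cis (of_nat n * t) * cnj (g (of_real \<sigma> * cis t)))))"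
      by (intro integral_linear integrable_sum int bounded_linear_Re) auto
    also have "\<dots> = Re (\<Sum>n<k. a n * of_real \<rho> ^ n * cnj (2 * pi * a n * of_real \<sigma> ^ n))"
      by (subst integral_sum) (auto intro!: int simp: coef)
    also have "\<dots> = (\<Sum>n<k. 2 * pi * (cmod (a n))\<^sup>2 * (\<rho> * \<sigma>) ^ n)"
    proof -
      have "a n * of_real \<rho> ^ n * cnj (2 * pi * a n * of_real \<sigma> ^ n)
          = of_real (2 * pi * (cmod (a n))\<^sup>2 * (\<rho> * \<sigma>) ^ n)" for n
        using complex_norm_square[of "a n"] by (simp add: power_mult_distrib mult_ac)
      then show ?thesis by (simp only: Re_sum Re_complex_of_real)
    qed
    finally show ?thesis .
  qed
  have "(\<lambda>k. integral {0..2 * pi} (F k)) \<longlonglongrightarrow>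
      integral {0..2 * pi} (\<lambda>t. Re (g (of_real \<rho> * cis t) * cnj (g (of_real \<sigma> * cis t))))"
  proof (rule dominated_convergence(2)[where h = "\<lambda>_. (\<Sum>n. cmod (a n) * \<rho> ^ n) * B"])
    show "F k integrable_on {0..2 * pi}" for k
      unfolding F_def by (intro integrable_continuous_interval continuous_intros cgs)
    show "norm (F k t) \<le> (\<Sum>n. cmod (a n) * \<rho> ^ n) * B" if "t \<in> {0..2 * pi}" for k t
    proof -
      have "cmod (\<Sum>n<k. a n * (of_real \<rho> * cis t) ^ n) \<le> (\<Sum>n<k. cmod (a n) * \<rho> ^ n)"
        using \<rho> by (intro order_trans[OF norm_sum]) (simp add: norm_mult norm_power)
      also have "\<dots> \<le> (\<Sum>n. cmod (a n) * \<rho> ^ n)"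
        using \<rho> by (intro sum_le_suminf sum\<rho>) auto
      finally have "cmod ((\<Sum>n<k. a n * (of_real \<rho> * cis t) ^ n) * cnj (g (of_real \<sigma> * cis t))) \<le> (\<Sum>n. cmod (a n) * \<rho> ^ n) * B"
        unfolding norm_mult using B[OF that] \<rho> by (intro mult_mono) (auto intro: suminf_nonneg sum\<rho>)
      then show ?thesis
        unfolding F_def real_norm_def using abs_Re_le_cmod order_trans by blast
    qed
    show "(\<lambda>k. F k t) \<longlonglongrightarrow> Re (g (of_real \<rho> * cis t) * cnj (g (of_real \<sigma> * cis t)))" for t
      unfolding F_def using ser[of "of_real \<rho> * cis t"] \<rho>
      by (intro tendsto_intros) (simp add: sums_def norm_mult)
  qed auto
  then show ?thesis by (simp add: sums_def intF a_def)
qed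

text \<open>A substitute for L^2 boundary values. The squared distance of the two restrictions is
  \<open>B \<rho> \<rho> + B \<sigma> \<sigma> - 2 * B \<rho> \<sigma>\<close>, which is at most
  \<open>B \<rho> \<rho> - B \<sigma> \<sigma>\<close> since \<open>B\<close> increases with the
  product of the radii. The diagonal values are bounded, so \<open>\<sigma>\<close> only has to
  bring \<open>B \<sigma> \<sigma>\<close> within \<open>\<epsilon>\<close> of their supremum
  \<open>S\<close>.\<close>

lemma hardy2_radial_cauchy:
  assumes hol: "g holomorphic_on ball 0 1"
    and L: "\<And>r. 0 \<le> r \<Longrightarrow> r < 1 \<Longrightarrow> integral {0..2 * pi} (\<lambda>t. (cmod (g (of_real r * cis t)))\<^sup>2) \<le> L"
    and \<epsilon>: "0 < \<epsilon>"
  shows "\<exists>\<sigma>>0. \<sigma> < 1 \<and> (\<forall>\<rho>. \<sigma> \<le> \<rho> \<longrightarrow> \<rho> < 1 \<longrightarrow>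
    integral {0..2 * pi} (\<lambda>t. (cmod (g (of_real \<rho> * cis t) - g (of_real \<sigma> * cis t)))\<^sup>2) \<le> \<epsilon>)"
proof -
  define B where "B \<rho> \<sigma> = integral {0..2 * pi} (\<lambda>t. Re (g (of_real \<rho> * cis t) * cnj (g (of_real \<sigma> * cis t))))" for \<rho> \<sigma>
  have cg: "continuous_on (ball 0 1) g" using hol by (rule holomorphic_on_imp_continuous_on)
  have sq: "Re (z * cnj z) = (cmod z)\<^sup>2" for z
    unfolding cmod_power2 by (simp add: power2_eq_square)
  have BL: "B \<rho> \<rho> \<le> L" if "0 < \<rho>" "\<rho> < 1" for \<rho>
    using L[of \<rho>] that unfolding B_def sq by simp
  have mono: "B \<rho> \<sigma> \<le> B \<rho>' \<sigma>'"
    if "0 < \<rho>" "\<rho> < 1" "0 < \<sigma>" "\<sigma> < 1" "0 < \<rho>'" "\<rho>' < 1" "0 < \<sigma>'" "\<sigma>' < 1" "\<rho> * \<sigma> \<le> \<rho>' * \<sigma>'" for \<rho> \<sigma> \<rho>' \<sigma>'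
    unfolding B_def using that
    by (intro sums_le[OF _ circle_inner_product_sums[OF hol] circle_inner_product_sums[OF hol]]
        mult_left_mono power_mono) auto
  define S where "S = (SUP \<rho>\<in>{0<..<1}. B \<rho> \<rho>)"
  have bdd: "bdd_above ((\<lambda>\<rho>. B \<rho> \<rho>) ` {0<..<1})" using BL by (auto intro!: bdd_aboveI)
  obtain \<sigma> where \<sigma>: "0 < \<sigma>" "\<sigma> < 1" "S - \<epsilon> < B \<sigma> \<sigma>"
    using less_cSUP_iff[OF _ bdd, of "S - \<epsilon>"] \<epsilon> by (auto simp: S_def)
  have "integral {0..2 * pi} (\<lambda>t. (cmod (g (of_real \<rho> * cis t) - g (of_real \<sigma> * cis t)))\<^sup>2) \<le> \<epsilon>"
    if \<rho>: "\<sigma> \<le> \<rho>" "\<rho> < 1" for \<rho>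
  proof -
    have \<rho>0: "0 < \<rho>" using \<rho> \<sigma> by simp
    have int: "(\<lambda>t. Re (g (of_real x * cis t) * cnj (g (of_real y * cis t)))) integrable_on {0..2 * pi}"
      if "0 < x" "x < 1" "0 < y" "y < 1" for x y
      using that by (intro integrable_continuous_interval continuous_intros continuous_on_circle_compose[OF cg]) auto
    have "(cmod (z - w))\<^sup>2 = Re (z * cnj z) + Re (w * cnj w) - 2 * Re (z * cnj w)" for z w
      unfolding cmod_power2 by (simp add: power2_eq_square algebra_simps)
    then have "integral {0..2 * pi} (\<lambda>t. (cmod (g (of_real \<rho> * cis t) - g (of_real \<sigma> * cis t)))\<^sup>2)
        = integral {0..2 * pi} (\<lambda>t. Re (g (of_real \<rho> * cis t) * cnj (g (of_real \<rho> * cis t)))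
          + Re (g (of_real \<sigma> * cis t) * cnj (g (of_real \<sigma> * cis t)))
          - 2 * Re (g (of_real \<rho> * cis t) * cnj (g (of_real \<sigma> * cis t))))"
      by (simp only:)
    also have "\<dots> = B \<rho> \<rho> + B \<sigma> \<sigma> - 2 * B \<rho> \<sigma>"
      unfolding B_def using \<rho> \<rho>0 \<sigma>
      by (simp only: integral_diff integral_add integral_mult_right int integrable_add integrable_on_mult_right)
    also have "\<dots> \<le> B \<rho> \<rho> - B \<sigma> \<sigma>"
      using mono[of \<sigma> \<sigma> \<rho> \<sigma>] \<rho> \<rho>0 \<sigma> by (simp add: mult_right_mono)
    also have "B \<rho> \<rho> \<le> S" unfolding S_def using \<rho> \<rho>0 by (intro cSUP_upper bdd) auto
    finally show ?thesis using \<sigma>(3) by simp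
  qed
  then show ?thesis using \<sigma> by blast
qed

text \<open>The majorant \<open>g\<^sup>2\<close> with \<open>g\<close> in \<open>H\<^sup>2\<close> makes the circle restrictions of \<open>f\<close> uniformly integrable.
  For \<open>p > 1\<close> Hoelder's inequality would do, but not for \<open>p = 1\<close>.\<close>

lemma hardy1_inner_defect_lim:
  assumes hol: "f holomorphic_on ball 0 1" and I: "inner_function I"
    and L: "\<And>r. 0 \<le> r \<Longrightarrow> r < 1 \<Longrightarrow> integral {0..2 * pi} (\<lambda>t. cmod (f (of_real r * cis t))) \<le> L"
  shows "(\<lambda>k. integral {0..2 * pi} (\<lambda>t. cmod (f (of_real (unit_seq k) * cis t))
    * (1 - cmod (I (of_real (unit_seq k) * cis t))))) \<longlonglongrightarrow> 0"
proof -
  obtain g where g: "g holomorphic_on ball 0 1" "\<And>z. z \<in> ball 0 1 \<Longrightarrow> cmod (f z) \<le> (cmod (g z))\<^sup>2"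
    "\<And>r. 0 \<le> r \<Longrightarrow> r < 1 \<Longrightarrow> integral {0..2 * pi} (\<lambda>t. (cmod (g (of_real r * cis t)))\<^sup>2) \<le> L"
    using hardy_square_majorant[OF hol L] by blast
  have cf: "continuous_on (ball 0 1) f" and cg: "continuous_on (ball 0 1) g" and cI: "continuous_on (ball 0 1) I"
    using hol g(1) inner_function_holomorphic[OF I] by (auto intro: holomorphic_on_imp_continuous_on)
  define D where "D k = integral {0..2 * pi} (\<lambda>t. cmod (f (of_real (unit_seq k) * cis t))
    * (1 - cmod (I (of_real (unit_seq k) * cis t))))" for k
  have I1: "cmod (I (of_real (unit_seq k) * cis t)) \<le> 1" for k t
    using unit_seq_bounds[of k] by (intro inner_function_le_1 I) (simp add: norm_mult)
  have D0: "0 \<le> D k" for k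
    unfolding D_def using I1 unit_seq_bounds[of k]
    by (intro integral_nonneg integrable_continuous_interval continuous_intros
        continuous_on_circle_compose[OF cf] continuous_on_circle_compose[OF cI]) auto
  have "D \<longlonglongrightarrow> 0"
  proof (rule LIMSEQ_I)
    fix \<epsilon> :: real assume \<epsilon>: "0 < \<epsilon>"
    obtain \<sigma> where \<sigma>: "0 < \<sigma>" "\<sigma> < 1" and \<sigma>g: "\<And>\<rho>. \<sigma> \<le> \<rho> \<Longrightarrow> \<rho> < 1 \<Longrightarrow>
        integral {0..2 * pi} (\<lambda>t. (cmod (g (of_real \<rho> * cis t) - g (of_real \<sigma> * cis t)))\<^sup>2) \<le> \<epsilon> / 8"
      using hardy2_radial_cauchy[OF g(1) g(3), of "\<epsilon> / 8"] \<epsilon> by auto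
    \<comment> \<open>On the fixed circle of radius \<open>\<sigma>\<close> the weight
      \<open>|g|^2\<close> is continuous, so \<open>J k\<close> tends to 0; the squared distance
      from radius \<open>\<rho>\<close> to \<open>\<sigma>\<close> integrates to at most
      \<open>\<epsilon> / 8\<close>. Both terms get doubled, which still leaves less than
      \<open>\<epsilon>\<close>.\<close>
    define J where "J k = integral {0..2 * pi} (\<lambda>t. (cmod (g (of_real \<sigma> * cis t)))\<^sup>2
      * \<bar>1 - cmod (I (of_real (unit_seq k) * cis t))\<bar>)" for k
    have "J \<longlonglongrightarrow> 0"
      unfolding J_def using \<sigma> by (intro inner_function_defect_lim I continuous_intros continuous_on_circle_compose[OF cg]) auto
    then have "\<forall>\<^sub>F k in sequentially. J k < \<epsilon> / 8"
      using \<epsilon> by (intro order_tendstoD(2)) auto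
    moreover have "\<forall>\<^sub>F k in sequentially. \<sigma> < unit_seq k"
      using \<sigma> by (intro order_tendstoD(1)[OF unit_seq_lim])
    ultimately have "\<forall>\<^sub>F k in sequentially. norm (D k - 0) < \<epsilon>"
    proof eventually_elim
      case (elim k)
      define \<rho> where "\<rho> = unit_seq k"
      have \<rho>: "\<sigma> \<le> \<rho>" "0 < \<rho>" "\<rho> < 1" using elim unit_seq_bounds[of k] by (auto simp: \<rho>_def)
      have c: "continuous_on {0..2 * pi} (\<lambda>t. f (of_real \<rho> * cis t))"
        "continuous_on {0..2 * pi} (\<lambda>t. g (of_real \<rho> * cis t))"
        "continuous_on {0..2 * pi} (\<lambda>t. I (of_real \<rho> * cis t))"
        "continuous_on {0..2 * pi} (\<lambda>t. g (of_real \<sigma> * cis t))"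
        using \<rho> \<sigma> by (auto intro!: continuous_on_circle_compose[OF cf] continuous_on_circle_compose[OF cg]
            continuous_on_circle_compose[OF cI] continuous_intros)
      have "D k \<le> integral {0..2 * pi} (\<lambda>t. 2 * ((cmod (g (of_real \<sigma> * cis t)))\<^sup>2 * \<bar>1 - cmod (I (of_real \<rho> * cis t))\<bar>)
          + 2 * (cmod (g (of_real \<rho> * cis t) - g (of_real \<sigma> * cis t)))\<^sup>2)"
        unfolding D_def \<rho>_def[symmetric]
      proof (intro integral_le integrable_continuous_interval continuous_intros c)
        fix t
        define x y i where "x = g (of_real \<rho> * cis t)" and "y = g (of_real \<sigma> * cis t)"
          and "i = 1 - cmod (I (of_real \<rho> * cis t))"
        have i: "0 \<le> i" "i \<le> 1" using I1[of k t] by (auto simp: i_def \<rho>_def)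
        have "cmod (f (of_real \<rho> * cis t)) * i \<le> (cmod x)\<^sup>2 * i"
          unfolding x_def using \<rho> i by (intro mult_right_mono g(2)) (auto simp: norm_mult)
        also have "(cmod x)\<^sup>2 \<le> (cmod y + cmod (x - y))\<^sup>2"
          by (intro power_mono norm_triangle_sub) auto
        also have "\<dots> \<le> 2 * (cmod y)\<^sup>2 + 2 * (cmod (x - y))\<^sup>2"
          using zero_le_power2[of "cmod y - cmod (x - y)"] unfolding power2_diff power2_sum by linarith
        also have "(2 * (cmod y)\<^sup>2 + 2 * (cmod (x - y))\<^sup>2) * i \<le> 2 * ((cmod y)\<^sup>2 * i) + 2 * (cmod (x - y))\<^sup>2"
          using i mult_left_mono[of i 1 "2 * (cmod (x - y))\<^sup>2"] by (simp add: algebra_simps)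
        finally have "cmod (f (of_real \<rho> * cis t)) * i \<le> 2 * ((cmod y)\<^sup>2 * i) + 2 * (cmod (x - y))\<^sup>2"
          using i by (simp add: mult_right_mono)
        then show "cmod (f (of_real \<rho> * cis t)) * (1 - cmod (I (of_real \<rho> * cis t)))
          \<le> 2 * ((cmod (g (of_real \<sigma> * cis t)))\<^sup>2 * \<bar>1 - cmod (I (of_real \<rho> * cis t))\<bar>)
          + 2 * (cmod (g (of_real \<rho> * cis t) - g (of_real \<sigma> * cis t)))\<^sup>2"
          using i(1) by (simp add: x_def y_def i_def)
      qed
      also have "\<dots> = 2 * J k + 2 * integral {0..2 * pi} (\<lambda>t. (cmod (g (of_real \<rho> * cis t) - g (of_real \<sigma> * cis t)))\<^sup>2)"
        unfolding J_def \<rho>_def[symmetric]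
        by (subst integral_add) (auto intro!: integrable_continuous_interval continuous_intros c)
      also have "\<dots> < \<epsilon>" using elim \<sigma>g[OF \<rho>(1,3)] \<epsilon> by simp
      finally show ?case using D0[of k] by simp
    qed
    then show "\<exists>no. \<forall>k\<ge>no. norm (D k - 0) < \<epsilon>" by (simp add: eventually_sequentially)
  qed
  then show ?thesis by (simp add: D_def[abs_def])
qed

section \<open>Discrete Hardy inequalities\<close>

lemma powr_powr_inverse: "0 < q \<Longrightarrow> 0 \<le> x \<Longrightarrow> (x powr q) powr (1 / q) = (x::real)"
  by (simp add: powr_powr)

text \<open>A substitute for Hoelder's inequality with geometric weights that treats all exponents \<open>q > 0\<close> at once.\<close>

lemma suminf_powr_le_geometric:
  fixes y :: "nat \<Rightarrow> real"
  assumes \<mu>: "0 < \<mu>" "\<mu> < 1" and q: "0 < q" and y: "\<And>i. 0 \<le> y i"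
    and sm: "summable (\<lambda>i. (y i / \<mu> ^ i) powr q)"
  shows "summable y" "(\<Sum>i. y i) powr q \<le> (1 / (1 - \<mu>)) powr q * (\<Sum>i. (y i / \<mu> ^ i) powr q)"
proof -
  define Q where "Q = (\<Sum>i. (y i / \<mu> ^ i) powr q)"
  have Q: "0 \<le> Q" unfolding Q_def by (intro suminf_nonneg sm) auto
  \<comment> \<open>A single term is at most the whole sum \<open>Q\<close>; this crude bound
    already decays like \<open>\<mu> ^ i\<close>.\<close>
  have le: "y i \<le> \<mu> ^ i * Q powr (1 / q)" for i
  proof -
    have "(y i / \<mu> ^ i) powr q \<le> Q"
      unfolding Q_def using sum_le_suminf[OF sm, of "{i}"] by auto
    then have "((y i / \<mu> ^ i) powr q) powr (1 / q) \<le> Q powr (1 / q)"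
      using q by (intro powr_mono2) auto
    then have "y i / \<mu> ^ i \<le> Q powr (1 / q)"
      using powr_powr_inverse[OF q, of "y i / \<mu> ^ i"] y[of i] \<mu> by simp
    then show ?thesis using \<mu> by (simp add: field_simps)
  qed
  have geo: "summable (\<lambda>i. \<mu> ^ i * Q powr (1 / q))"
    using \<mu> by (intro summable_mult2 summable_geometric) auto
  show sy: "summable y"
    by (rule summable_comparison_test'[OF geo]) (use y le in auto)
  have "(\<Sum>i. y i) \<le> (\<Sum>i. \<mu> ^ i * Q powr (1 / q))"
    by (intro suminf_le le sy geo)
  also have "\<dots> = 1 / (1 - \<mu>) * Q powr (1 / q)"
    using \<mu> by (simp add: suminf_geometric flip: suminf_mult2[OF summable_geometric])
  finally have "(\<Sum>i. y i) powr q \<le> (1 / (1 - \<mu>) * Q powr (1 / q)) powr q"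
    using q by (intro powr_mono2 suminf_nonneg sy y) auto
  also have "\<dots> = (1 / (1 - \<mu>)) powr q * Q"
    using q Q \<mu> by (subst powr_mult) (simp_all add: powr_powr)
  finally show "(\<Sum>i. y i) powr q \<le> (1 / (1 - \<mu>)) powr q * (\<Sum>i. (y i / \<mu> ^ i) powr q)"
    by (simp add: Q_def)
qed

text \<open>For the partial sums the hypothesis reads
  \<open>S m \<le> B * (S (Suc m) - S m)\<close>, that is,
  \<open>S m \<le> \<theta> * S (Suc m)\<close> with \<open>\<theta> = B / (B + 1)\<close>. A
  summation condition thus improves itself to geometric growth.\<close>

lemma geometric_growth_of_sums:
  fixes a :: "nat \<Rightarrow> real"
  assumes a: "\<And>n. 0 < a n" and B: "0 < B" "\<And>m. (\<Sum>n<m. a n) \<le> B * a m"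
  shows "a n \<le> (B + 1) * (B / (B + 1)) ^ i * a (n + i)"
proof -
  define \<theta> where "\<theta> = B / (B + 1)"
  define S where "S m = (\<Sum>n<m. a n)" for m
  have step: "S m \<le> \<theta> * S (Suc m)" for m
    using B(2)[of m] B(1) by (simp add: S_def \<theta>_def field_simps)
  have it: "S m \<le> \<theta> ^ i * S (m + i)" for m i
  proof (induction i)
    case (Suc i)
    have "\<theta> ^ i * S (m + i) \<le> \<theta> ^ i * (\<theta> * S (Suc (m + i)))"
      using B(1) by (intro mult_left_mono step) (auto simp: \<theta>_def)
    with Suc show ?case by (simp add: mult_ac)
  qed simp
  have "a n \<le> S (Suc n)"
    using a by (simp add: S_def sum_nonneg less_imp_le)
  also have "\<dots> \<le> \<theta> ^ i * S (Suc n + i)" by (rule it)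
  also have "\<dots> \<le> \<theta> ^ i * ((B + 1) * a (n + i))"
    using B(2)[of "n + i"] B(1) by (intro mult_left_mono) (auto simp: S_def \<theta>_def algebra_simps)
  finally show ?thesis by (simp add: \<theta>_def mult_ac)
qed

lemma summable_geometric_convolution:
  fixes X :: "nat \<Rightarrow> real"
  assumes \<kappa>: "0 \<le> \<kappa>" "\<kappa> < 1" and X: "\<And>n. 0 \<le> X n" "summable X"
  shows "summable (\<lambda>n. \<Sum>i. \<kappa> ^ i * X (n + i))" "summable (\<lambda>i. \<kappa> ^ i * X (n + i))"
proof -
  have sX: "summable (\<lambda>i. \<kappa> ^ i * X (n + i))" for n
  proof (rule summable_comparison_test')
    show "summable (\<lambda>i. X (n + i))" using X(2) by (simp add: summable_iff_shift add.commute)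
    show "norm (\<kappa> ^ i * X (n + i)) \<le> X (n + i)" for i
      using \<kappa> X(1) by (simp add: mult_left_le_one_le power_le_one)
  qed
  show "summable (\<lambda>i. \<kappa> ^ i * X (n + i))" by (rule sX)
  show "summable (\<lambda>n. \<Sum>i. \<kappa> ^ i * X (n + i))"
  proof (rule summableI_nonneg_bounded)
    show "0 \<le> (\<Sum>i. \<kappa> ^ i * X (n + i))" for n
      using \<kappa> X by (intro suminf_nonneg sX) auto
    fix M
    have "(\<Sum>n<M. \<Sum>i. \<kappa> ^ i * X (n + i)) = (\<Sum>i. \<Sum>n<M. \<kappa> ^ i * X (n + i))"
      by (intro suminf_sum[symmetric] sX)
    also have "\<dots> \<le> (\<Sum>i. \<kappa> ^ i * suminf X)"
    proof (intro suminf_le summable_sum sX summable_mult2 summable_geometric)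
      fix i
      have "(\<Sum>n<M. X (n + i)) = (\<Sum>n\<in>{i..<M + i}. X n)"
        using sum.shift_bounds_nat_ivl[of X 0 i M] by (simp add: atLeast0LessThan)
      also have "\<dots> \<le> suminf X" using X by (intro sum_le_suminf) auto
      finally show "(\<Sum>n<M. \<kappa> ^ i * X (n + i)) \<le> \<kappa> ^ i * suminf X"
        using \<kappa> by (simp add: mult_left_mono flip: sum_distrib_left)
    qed (use \<kappa> in auto)
    finally show "(\<Sum>n<M. \<Sum>i. \<kappa> ^ i * X (n + i)) \<le> (\<Sum>i. \<kappa> ^ i * suminf X)" .
  qed
qed

text \<open>The discrete form of \<open>1 / (1 - r)\<close> times the integral of \<open>h\<close>
  from \<open>r\<close> to 1, at \<open>r = 1 - 1 / K ^ n\<close>: annulus \<open>n + i\<close> has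
  width of order \<open>1 / K ^ (n + i)\<close>. The index \<open>n + i + 1\<close> belongs to its
  outer end, where an increasing function is largest.\<close>

definition tail_mean :: "real \<Rightarrow> (nat \<Rightarrow> real) \<Rightarrow> nat \<Rightarrow> real" where
  "tail_mean K h n = (\<Sum>i. h (n + i + 1) / K ^ i)"

text \<open>The weight conditions in abstract form. \<open>N n\<close> stands for the tail of the
  weight at radius \<open>1 - 1 / K ^ n\<close>: \<open>doubling\<close> will come from
  \<open>D_hat\<close>, \<open>halving\<close> from \<open>D_check\<close> and \<open>growth\<close>
  from \<open>D_hat_q\<close>, with \<open>(K powr q) ^ n\<close> in the role of
  \<open>(1 - r) powr (- q)\<close>.\<close>

context
  fixes N h :: "nat \<Rightarrow> real" and K q B C :: real
  assumes N: "\<And>n. 0 < N n" and K: "1 < K" and q: "0 < q" and B: "0 < B" and C: "0 < C"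
    and doubling: "\<And>n. N n \<le> C * N (Suc n)" and halving: "\<And>n. 2 * N (Suc n) \<le> N n"
    and growth: "\<And>m. (\<Sum>n<m. N n * (K powr q) ^ n) \<le> B * (N m * (K powr q) ^ m)"
    and h: "\<And>n. 0 \<le> h n" and sm: "summable (\<lambda>n. N n * h n powr q)"
begin

text \<open>By \<open>growth\<close> the products \<open>N n * (K powr q) ^ n\<close> grow
  geometrically. Since the factor \<open>1 / K ^ i\<close> in the tail mean compensates
  \<open>(K powr q) ^ i\<close>, passing from \<open>N n\<close> to \<open>N (n + i + 1)\<close>
  gains \<open>\<theta> ^ i\<close>.\<close>

lemma discrete_hardy_tail:
  shows "summable (\<lambda>i. h (n + i + 1) / K ^ i)" "summable (\<lambda>n. N n * tail_mean K h n powr q)"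
proof -
  \<comment> \<open>The gain \<open>\<theta> = \<kappa> * \<kappa>\<close> is split: one
    \<open>\<kappa>\<close>, as \<open>\<mu> powr q\<close>, pays for moving the power
    \<open>q\<close> inside the sum, the other makes the remaining convolution summable.
    \<open>D\<close> absorbs the factor \<open>K powr q\<close> left over from the index shift by
    1.\<close>
  define \<theta> \<kappa> \<mu> D where "\<theta> = B / (B + 1)" and "\<kappa> = \<theta> powr (1 / 2)" and "\<mu> = \<kappa> powr (1 / q)"
    and "D = (B + 1) * K powr q"
  define X where "X n = N (n + 1) * h (n + 1) powr q" for n
  have \<theta>: "0 < \<theta>" "\<theta> < 1" using B by (auto simp: \<theta>_def)
  have \<kappa>: "0 < \<kappa>" "\<kappa> < 1" "\<theta> = \<kappa> * \<kappa>" using \<theta> by (auto simp: \<kappa>_def powr01_less_one simp flip: powr_add)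
  have \<mu>: "0 < \<mu>" "\<mu> < 1" "\<mu> powr q = \<kappa>" using \<kappa> q by (auto simp: \<mu>_def powr_powr powr01_less_one)
  have D: "0 < D" using B K by (simp add: D_def)
  have X: "0 \<le> X n" for n unfolding X_def using N[of "n + 1"] by simp
  have sX: "summable X" unfolding X_def using sm by (subst summable_iff_shift[of _ 1])
  have conv: "summable (\<lambda>n. \<Sum>i. \<kappa> ^ i * X (n + i))" "\<And>n. summable (\<lambda>i. \<kappa> ^ i * X (n + i))"
    using summable_geometric_convolution[of \<kappa> X] \<kappa> X sX by auto
  have Kp: "(x / K ^ i) powr q = x powr q / (K powr q) ^ i" if "0 \<le> x" for x i
    using that K by (simp add: powr_divide powr_realpow[symmetric] powr_powr mult.commute)
  have \<mu>p: "(x / \<mu> ^ i) powr q = x powr q / \<kappa> ^ i" if "0 \<le> x" for x i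
  proof -
    have "(\<mu> ^ i) powr q = (\<mu> powr q) ^ i"
      using \<mu>(1) by (simp add: powr_realpow[symmetric] powr_powr mult.commute)
    then show ?thesis using that \<mu> by (simp add: powr_divide)
  qed
  have key: "N n * ((h (n + i + 1) / K ^ i / \<mu> ^ i) powr q) \<le> D * (\<kappa> ^ i * X (n + i))" for n i
  proof -
    define k where "k = K powr q"
    have k: "0 < k" using K by (simp add: k_def)
    have "N n * k ^ n \<le> (B + 1) * \<theta> ^ (i + 1) * (N (n + (i + 1)) * k ^ (n + (i + 1)))"
      using geometric_growth_of_sums[of "\<lambda>n. N n * k ^ n" B n "i + 1"] growth N k B
      by (auto simp: k_def \<theta>_def)
    also have "\<dots> = ((B + 1) * \<theta> ^ (i + 1) * N (n + i + 1) * k ^ (i + 1)) * k ^ n"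
      by (simp add: power_add)
    finally have "N n \<le> (B + 1) * \<theta> ^ (i + 1) * N (n + i + 1) * k ^ (i + 1)"
      using k by simp
    also have "\<dots> \<le> (B + 1) * \<theta> ^ i * N (n + i + 1) * k ^ (i + 1)"
      using k \<theta> B N[of "n + i + 1"] by (intro mult_right_mono mult_left_mono power_decreasing) auto
    finally have *: "N n \<le> D * \<theta> ^ i * N (n + i + 1) * k ^ i"
      by (simp add: D_def k_def mult_ac)
    have "N n * ((h (n + i + 1) / K ^ i / \<mu> ^ i) powr q) = N n * (h (n + i + 1) powr q / (k ^ i * \<kappa> ^ i))"
    proof -
      have "(h (n + i + 1) / K ^ i / \<mu> ^ i) powr q = h (n + i + 1) powr q / k ^ i / \<kappa> ^ i"
        using \<mu>p[of "h (n + i + 1) / K ^ i" i] Kp[of "h (n + i + 1)" i] h[of "n + i + 1"] K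
        by (simp del: divide_divide_eq_left add: k_def)
      then show ?thesis by simp
    qed
    also have "\<dots> \<le> (D * \<theta> ^ i * N (n + i + 1) * k ^ i) * (h (n + i + 1) powr q / (k ^ i * \<kappa> ^ i))"
      using * k \<kappa> by (intro mult_right_mono) auto
    also have "\<dots> = D * (\<kappa> ^ i * X (n + i))"
      using k \<kappa>(1,2) by (simp add: X_def \<kappa>(3) power_mult_distrib)
    finally show ?thesis .
  qed
  have sy: "summable (\<lambda>i. (h (n + i + 1) / K ^ i / \<mu> ^ i) powr q)" for n
  proof (rule summable_comparison_test')
    show "summable (\<lambda>i. D * (\<kappa> ^ i * X (n + i)) / N n)"
      by (intro summable_divide summable_mult conv)
    show "norm ((h (n + i + 1) / K ^ i / \<mu> ^ i) powr q) \<le> D * (\<kappa> ^ i * X (n + i)) / N n" for i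
      using key[of n i] N[of n] by (simp add: field_simps)
  qed
  have nn: "0 \<le> h (n + i + 1) / K ^ i" for n i using h K by simp
  show "summable (\<lambda>i. h (n + i + 1) / K ^ i)"
    using suminf_powr_le_geometric(1)[OF \<mu>(1,2) q nn sy] .
  show "summable (\<lambda>n. N n * tail_mean K h n powr q)"
  proof (rule summable_comparison_test')
    show "summable (\<lambda>n. (1 / (1 - \<mu>)) powr q * (D * (\<Sum>i. \<kappa> ^ i * X (n + i))))"
      by (intro summable_mult conv)
    fix n
    have "N n * tail_mean K h n powr q \<le> N n * ((1 / (1 - \<mu>)) powr q * (\<Sum>i. (h (n + i + 1) / K ^ i / \<mu> ^ i) powr q))"
      unfolding tail_mean_def using N[of n]
      by (intro mult_left_mono suminf_powr_le_geometric(2)[OF \<mu>(1,2) q nn sy]) auto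
    also have "\<dots> = (1 / (1 - \<mu>)) powr q * (\<Sum>i. N n * (h (n + i + 1) / K ^ i / \<mu> ^ i) powr q)"
      by (subst suminf_mult[OF sy]) simp
    also have "\<dots> \<le> (1 / (1 - \<mu>)) powr q * (\<Sum>i. D * (\<kappa> ^ i * X (n + i)))"
      by (intro mult_left_mono suminf_le key summable_mult conv sy) auto
    also have "\<dots> = (1 / (1 - \<mu>)) powr q * (D * (\<Sum>i. \<kappa> ^ i * X (n + i)))"
      by (subst suminf_mult[OF conv(2)]) simp
    finally show "norm (N n * tail_mean K h n powr q) \<le> (1 / (1 - \<mu>)) powr q * (D * (\<Sum>i. \<kappa> ^ i * X (n + i)))"
      using N[of n] by simp
  qed
qed

lemma tail_mean_nonneg: "0 \<le> tail_mean K h n"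
  unfolding tail_mean_def using h K by (intro suminf_nonneg discrete_hardy_tail(1)) auto

text \<open>The opposite direction: by \<open>halving\<close>, each step back from \<open>n\<close>
  gains a factor \<open>1 / 2\<close>, again split into two square roots. The sum reaches one index
  beyond \<open>n\<close> because the estimates on annulus \<open>n\<close> will involve the next
  one; \<open>doubling\<close> pays for that shift.\<close>

lemma discrete_hardy:
  "summable (\<lambda>n. N n * (\<Sum>j\<le>Suc n. tail_mean K h j) powr q)"
proof -
  define e where "e = tail_mean K h"
  define \<kappa> \<mu> :: real where "\<kappa> = (1 / 2) powr (1 / 2)" and "\<mu> = \<kappa> powr (1 / q)"
  have \<kappa>: "0 < \<kappa>" "\<kappa> < 1" "1 / 2 = \<kappa> * \<kappa>" by (auto simp: \<kappa>_def powr01_less_one simp flip: powr_add)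
  have \<mu>: "0 < \<mu>" "\<mu> < 1" "\<mu> powr q = \<kappa>" using \<kappa> q by (auto simp: \<mu>_def powr_powr powr01_less_one)
  have e: "0 \<le> e n" for n unfolding e_def by (rule tail_mean_nonneg)
  have Ni: "N (n + i) \<le> (1 / 2) ^ i * N n" for n i
  proof (induction i)
    case (Suc i)
    then show ?case using halving[of "n + i"] by simp
  qed simp
  define X where "X n = N n * e n powr q" for n
  have sX: "summable X" unfolding X_def e_def by (rule discrete_hardy_tail(2))
  have X: "0 \<le> X n" for n unfolding X_def using N[of n] by simp
  have conv: "summable (\<lambda>n. \<Sum>i\<le>n. \<kappa> ^ i * X (n - i))"
    using \<kappa> X sX by (intro summable_Cauchy_product) (auto simp: summable_geometric)
  have main: "N n * (\<Sum>j\<le>n. e j) powr q \<le> (1 / (1 - \<mu>)) powr q * (\<Sum>i\<le>n. \<kappa> ^ i * X (n - i))" for n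
  proof -
    \<comment> \<open>The finite sum read backwards from \<open>n\<close> and padded with zeros, so
      that the estimate for series applies.\<close>
    define y where "y i = (if i \<le> n then e (n - i) else 0)" for i
    have fin: "(\<lambda>i. (y i / \<mu> ^ i) powr q) sums (\<Sum>i\<le>n. (y i / \<mu> ^ i) powr q)"
      by (rule sums_finite) (auto simp: y_def)
    have "(\<Sum>j\<le>n. e j) = (\<Sum>i\<le>n. e (n - i))"
      by (rule sum.reindex_bij_witness[of _ "\<lambda>i. n - i" "\<lambda>i. n - i"]) auto
    also have "\<dots> = suminf y"
      by (subst suminf_finite[of "{..n}"]) (auto simp: y_def)
    finally have "(\<Sum>j\<le>n. e j) = suminf y" .
    moreover have "0 \<le> y i" for i using e by (simp add: y_def)
    ultimately have "(\<Sum>j\<le>n. e j) powr q \<le> (1 / (1 - \<mu>)) powr q * (\<Sum>i. (y i / \<mu> ^ i) powr q)"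
      using suminf_powr_le_geometric(2)[OF \<mu>(1,2) q, of y] sums_summable[OF fin] by simp
    also have "(\<Sum>i. (y i / \<mu> ^ i) powr q) = (\<Sum>i\<le>n. (y i / \<mu> ^ i) powr q)"
      using fin by (simp add: sums_iff)
    also have "\<dots> = (\<Sum>i\<le>n. e (n - i) powr q / \<kappa> ^ i)"
    proof (intro sum.cong refl)
      fix i assume "i \<in> {..n}"
      have "(\<mu> ^ i) powr q = (\<mu> powr q) ^ i"
        using \<mu>(1) by (simp add: powr_realpow[symmetric] powr_powr mult.commute)
      then show "(y i / \<mu> ^ i) powr q = e (n - i) powr q / \<kappa> ^ i"
        using \<open>i \<in> {..n}\<close> \<mu> e by (simp add: y_def powr_divide)
    qed
    finally have "N n * (\<Sum>j\<le>n. e j) powr q \<le> N n * ((1 / (1 - \<mu>)) powr q * (\<Sum>i\<le>n. e (n - i) powr q / \<kappa> ^ i))"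
      using N[of n] by (intro mult_left_mono) auto
    also have "\<dots> = (1 / (1 - \<mu>)) powr q * (\<Sum>i\<le>n. N n * (e (n - i) powr q / \<kappa> ^ i))"
      by (simp add: sum_distrib_left mult_ac)
    also have "\<dots> \<le> (1 / (1 - \<mu>)) powr q * (\<Sum>i\<le>n. \<kappa> ^ i * X (n - i))"
    proof (intro mult_left_mono sum_mono)
      fix i assume i: "i \<in> {..n}"
      have "N n * (e (n - i) powr q / \<kappa> ^ i) \<le> ((1 / 2) ^ i * N (n - i)) * (e (n - i) powr q / \<kappa> ^ i)"
        using Ni[of "n - i" i] i \<kappa>(1) by (intro mult_right_mono) auto
      also have "\<dots> = \<kappa> ^ i * X (n - i)"
        unfolding \<kappa>(3) using \<kappa>(1) by (simp add: X_def power_mult_distrib)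
      finally show "N n * (e (n - i) powr q / \<kappa> ^ i) \<le> \<kappa> ^ i * X (n - i)" .
    qed auto
    finally show ?thesis .
  qed
  have "summable (\<lambda>n. N n * (\<Sum>j\<le>n. e j) powr q)"
  proof (rule summable_comparison_test')
    show "summable (\<lambda>n. (1 / (1 - \<mu>)) powr q * (\<Sum>i\<le>n. \<kappa> ^ i * X (n - i)))"
      by (intro summable_mult conv)
    show "norm (N n * (\<Sum>j\<le>n. e j) powr q) \<le> (1 / (1 - \<mu>)) powr q * (\<Sum>i\<le>n. \<kappa> ^ i * X (n - i))" for n
      using main[of n] N[of n] by simp
  qed
  then have "summable (\<lambda>n. N (Suc n) * (\<Sum>j\<le>Suc n. e j) powr q)"
    by (subst summable_Suc_iff)
  then have s: "summable (\<lambda>n. C * (N (Suc n) * (\<Sum>j\<le>Suc n. e j) powr q))"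
    by (rule summable_mult)
  show ?thesis unfolding e_def[symmetric]
  proof (rule summable_comparison_test'[OF s])
    fix n
    have "N n * (\<Sum>j\<le>Suc n. e j) powr q \<le> C * N (Suc n) * (\<Sum>j\<le>Suc n. e j) powr q"
      by (intro mult_right_mono doubling) auto
    then show "norm (N n * (\<Sum>j\<le>Suc n. e j) powr q) \<le> C * (N (Suc n) * (\<Sum>j\<le>Suc n. e j) powr q)"
      using N[of n] by (simp add: mult.assoc)
  qed
qed

end

section \<open>Weights\<close>

text \<open>The integral is a supremum over simple minorants whether or not \<open>u\<close> is
  measurable. Countably many of them reach it, and their pointwise supremum is measurable and still
  below \<open>u\<close>.\<close>

lemma nn_integral_attained:
  "\<exists>v\<in>borel_measurable M. (\<forall>x. v x \<le> u x) \<and> integral\<^sup>N M v = integral\<^sup>N M u"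
proof -
  define G where "G = {g. simple_function M g \<and> g \<le> u}"
  have ne: "integral\<^sup>S M ` G \<noteq> {}"
    unfolding G_def by (auto intro!: exI[of _ "\<lambda>_. 0"] simp: le_fun_def)
  obtain I where I: "range I \<subseteq> integral\<^sup>S M ` G" "integral\<^sup>N M u = (SUP i::nat. I i)"
    using ennreal_Sup_countable_SUP[OF ne] unfolding nn_integral_def G_def[symmetric] by auto
  have "\<forall>i. \<exists>g\<in>G. I i = integral\<^sup>S M g" using I(1) by auto
  then obtain g where g: "\<And>i. g i \<in> G" "\<And>i. I i = integral\<^sup>S M (g i)" by metis
  have gm: "g i \<in> borel_measurable M" and gu: "g i x \<le> u x" and gI: "I i = integral\<^sup>N M (g i)" for i x
    using g[of i] by (auto simp: G_def le_fun_def borel_measurable_simple_function nn_integral_eq_simple_integral)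
  define v where "v x = (SUP i. g i x)" for x
  have v: "v \<in> borel_measurable M" unfolding v_def by (intro borel_measurable_SUP gm) auto
  have vu: "v x \<le> u x" for x unfolding v_def by (intro SUP_least gu)
  have "integral\<^sup>N M u \<le> integral\<^sup>N M v"
    unfolding I(2) gI by (intro SUP_least nn_integral_mono) (auto simp: v_def intro: SUP_upper)
  moreover have "integral\<^sup>N M v \<le> integral\<^sup>N M u" by (intro nn_integral_mono vu)
  ultimately show ?thesis using v vu by (intro bexI[of _ v]) auto
qed

text \<open>Nonnegative integrals of non-measurable functions are lower integrals. Replacing the weight by a
  maximal measurable minorant does not change any of them and makes the integral additive.\<close>

lemma (in sigma_finite_measure) maximal_measurable_minorant:
  assumes fin: "\<And>x. u x < (\<infinity>::ennreal)"
  shows "\<exists>v\<in>borel_measurable M. \<forall>a\<in>borel_measurable M. (\<forall>x. a x < \<infinity>) \<longrightarrow>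
    (\<integral>\<^sup>+ x. a x * u x \<partial>M) = (\<integral>\<^sup>+ x. v x * a x \<partial>M)"
proof -
  obtain w :: "'a \<Rightarrow> real" where w: "w \<in> borel_measurable M" "\<And>x. 0 < w x" "\<And>x. w x \<le> 1" "integrable M w"
    using obtain_positive_integrable_function by blast
  \<comment> \<open>Truncation at \<open>k\<close> and the integrable factor \<open>w\<close> make
    the integrals finite. The comparison below rests on this: of two ordered functions with the same
    finite integral, neither is larger on a set of positive measure.\<close>
  define U where "U k x = ennreal (w x) * min (u x) (of_nat k)" for k :: nat and x
  have "\<forall>k. \<exists>v\<in>borel_measurable M. (\<forall>x. v x \<le> U k x) \<and> integral\<^sup>N M v = integral\<^sup>N M (U k)"
    using nn_integral_attained by blast
  then obtain V where V: "\<And>k. V k \<in> borel_measurable M" "\<And>k x. V k x \<le> U k x"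
    "\<And>k. integral\<^sup>N M (V k) = integral\<^sup>N M (U k)"
    by metis
  have Ufin: "integral\<^sup>N M (U k) < \<infinity>" for k
  proof -
    have "integral\<^sup>N M (U k) \<le> (\<integral>\<^sup>+ x. ennreal (w x) * of_nat k \<partial>M)"
      unfolding U_def by (intro nn_integral_mono mult_left_mono) auto
    also have "\<dots> = (\<integral>\<^sup>+ x. ennreal (w x) \<partial>M) * of_nat k"
      using w(1) by (intro nn_integral_multc) auto
    also have "\<dots> < \<infinity>"
      using w(4) by (auto simp: ennreal_mult_less_top integrable_iff_bounded less_imp_le[OF w(2)] ennreal_of_nat_eq_real_of_nat)
    finally show ?thesis .
  qed
  have ww: "ennreal (1 / w x) * ennreal (w x) = 1" for x
    using w(2)[of x] by (simp flip: ennreal_mult')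
  define v where "v x = (SUP k. ennreal (1 / w x) * V k x)" for x
  have vm: "v \<in> borel_measurable M"
    unfolding v_def using V(1) w(1) by (intro borel_measurable_SUP) auto
  have vu: "v x \<le> u x" for x
  proof (unfold v_def, rule SUP_least)
    fix k
    have "ennreal (1 / w x) * V k x \<le> ennreal (1 / w x) * U k x" by (intro mult_left_mono V(2)) auto
    also have "\<dots> = min (u x) (of_nat k)" unfolding U_def by (simp add: ww flip: mult.assoc)
    finally show "ennreal (1 / w x) * V k x \<le> u x" by simp
  qed
  \<comment> \<open>If \<open>b\<close> exceeded \<open>v\<close> on a set of positive measure, then
    for some \<open>k\<close> the maximum \<open>m\<close> would be a minorant of \<open>U k\<close>
    with a larger integral than the optimal \<open>V k\<close>.\<close>
  have max: "AE x in M. b x \<le> v x" if b: "b \<in> borel_measurable M" "\<And>x. b x \<le> u x" for b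
  proof -
    have AEk: "AE x in M. ennreal (w x) * min (b x) (of_nat k) \<le> V k x" for k
    proof -
      define m where "m x = max (V k x) (ennreal (w x) * min (b x) (of_nat k))" for x
      have mm: "m \<in> borel_measurable M" unfolding m_def using V(1) w(1) b(1) by auto
      have "m x \<le> U k x" for x
        unfolding m_def using V(2) b(2) by (auto simp: U_def intro!: mult_left_mono min.mono)
      then have "integral\<^sup>N M m \<le> integral\<^sup>N M (V k)"
        unfolding V(3) by (intro nn_integral_mono)
      then have "\<not> integral\<^sup>N M (V k) < integral\<^sup>N M m" by simp
      moreover have "integral\<^sup>N M (V k) \<noteq> \<infinity>" using Ufin[of k] by (simp add: V(3))
      moreover have "AE x in M. V k x \<le> m x" by (simp add: m_def)
      ultimately have "AE x in M. m x \<le> V k x"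
        using nn_integral_less[OF V(1) mm] by blast
      then show ?thesis by eventually_elim (simp add: m_def)
    qed
    have "AE x in M. \<forall>k. ennreal (w x) * min (b x) (of_nat k) \<le> V k x"
      using AEk by (simp add: AE_all_countable)
    then show ?thesis
    proof eventually_elim
      case (elim x)
      have "b x < \<infinity>" using b(2)[of x] fin[of x] by (rule le_less_trans)
      then obtain k where k: "b x < of_nat k" using ennreal_Ex_less_of_nat by auto
      then have "b x = ennreal (1 / w x) * (ennreal (w x) * min (b x) (of_nat k))"
        by (simp add: ww flip: mult.assoc)
      also have "\<dots> \<le> ennreal (1 / w x) * V k x" using elim by (intro mult_left_mono) auto
      also have "\<dots> \<le> v x" unfolding v_def by (rule SUP_upper) simp
      finally show ?case .
    qed
  qed
  have "(\<integral>\<^sup>+ x. a x * u x \<partial>M) = (\<integral>\<^sup>+ x. v x * a x \<partial>M)" if a: "a \<in> borel_measurable M" "\<And>x. a x < \<infinity>" for a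
  proof (rule antisym)
    obtain g where g: "g \<in> borel_measurable M" "\<And>x. g x \<le> a x * u x"
      "integral\<^sup>N M g = (\<integral>\<^sup>+ x. a x * u x \<partial>M)"
      using nn_integral_attained[of M "\<lambda>x. a x * u x"] by auto
    \<comment> \<open>Dividing the optimal minorant of \<open>a * u\<close> by \<open>a\<close>
      gives a measurable minorant of \<open>u\<close>, to which maximality applies.\<close>
    define b where "b x = (if a x = 0 then 0 else g x / a x)" for x
    have bm: "b \<in> borel_measurable M" unfolding b_def using g(1) a(1) by measurable
    have bu: "b x \<le> u x" for x
      using g(2)[of x] a(2)[of x] by (auto simp: b_def divide_le_posI_ennreal mult.commute zero_less_iff_neq_zero)
    have gb: "g x = a x * b x" for x
    proof (cases "a x = 0")
      case True
      then show ?thesis using g(2)[of x] by (simp add: b_def)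
    next
      case False
      have "a x * (g x / a x) = g x * a x / a x" by (simp add: ennreal_times_divide mult.commute)
      also have "\<dots> = g x" using False a(2)[of x] by (intro mult_divide_eq_ennreal) auto
      finally show ?thesis using False by (simp add: b_def)
    qed
    have "AE x in M. g x \<le> v x * a x"
      using max[OF bm bu] by eventually_elim (simp add: gb mult.commute mult_left_mono)
    then show "(\<integral>\<^sup>+ x. a x * u x \<partial>M) \<le> (\<integral>\<^sup>+ x. v x * a x \<partial>M)"
      unfolding g(3)[symmetric] by (rule nn_integral_mono_AE)
    show "(\<integral>\<^sup>+ x. v x * a x \<partial>M) \<le> (\<integral>\<^sup>+ x. a x * u x \<partial>M)"
      by (intro nn_integral_mono) (simp add: mult.commute mult_left_mono vu)
  qed
  then show ?thesis using vm by blast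
qed

text \<open>Absorbs the minorant into a measure, so that additivity and masses of sets are at hand.
  One measure serves all \<open>a\<close>, which allows several weighted integrals to be
  compared.\<close>

lemma lebesgue_minorant_measure:
  assumes fin: "\<And>x. u x < (\<infinity>::ennreal)"
  shows "\<exists>\<mu>. sets \<mu> = sets lebesgue \<and> (\<forall>a\<in>borel_measurable lebesgue. (\<forall>x::real. a x < \<infinity>) \<longrightarrow>
    (\<integral>\<^sup>+ x. a x * u x \<partial>lebesgue) = (\<integral>\<^sup>+ x. a x \<partial>\<mu>))"
proof -
  interpret sigma_finite_measure "lebesgue :: real measure"
  proof
    show "\<exists>A::real set set. countable A \<and> A \<subseteq> sets lebesgue \<and> \<Union> A = space lebesgue \<and> (\<forall>a\<in>A. emeasure lebesgue a \<noteq> \<infinity>)"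
    proof (intro exI[of _ "range (\<lambda>n::nat. {- real n..real n})"] conjI)
      show "\<Union> (range (\<lambda>n::nat. {- real n..real n})) = space lebesgue"
      proof (rule set_eqI)
        fix x :: real
        obtain n :: nat where "\<bar>x\<bar> \<le> real n" using real_arch_simple by blast
        then show "x \<in> \<Union> (range (\<lambda>n::nat. {- real n..real n})) \<longleftrightarrow> x \<in> space lebesgue"
          by (simp add: abs_le_iff minus_le_iff) (use \<open>\<bar>x\<bar> \<le> real n\<close> in \<open>intro exI[of _ n], linarith\<close>)
      qed
    qed auto
  qed
  from maximal_measurable_minorant[of u, OF fin]
  obtain v where v: "v \<in> borel_measurable lebesgue" "\<forall>a\<in>borel_measurable lebesgue. (\<forall>x. a x < \<infinity>) \<longrightarrow>
    (\<integral>\<^sup>+ x. a x * u x \<partial>lebesgue) = (\<integral>\<^sup>+ x. v x * a x \<partial>lebesgue)"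
    by (elim bexE) (rule that)
  show ?thesis
  proof (intro exI[of _ "density lebesgue v"] conjI ballI impI)
    fix a :: "real \<Rightarrow> ennreal" assume a: "a \<in> borel_measurable lebesgue" "\<forall>x. a x < \<infinity>"
    have "(\<integral>\<^sup>+ x. a x * u x \<partial>lebesgue) = (\<integral>\<^sup>+ x. v x * a x \<partial>lebesgue)"
      by (rule v(2)[rule_format, OF a(1)]) (rule a(2)[rule_format])
    also have "\<dots> = (\<integral>\<^sup>+ x. a x \<partial>density lebesgue v)"
      by (rule nn_integral_density[symmetric]) (rule v(1), rule a(1))
    finally show "(\<integral>\<^sup>+ x. a x * u x \<partial>lebesgue) = (\<integral>\<^sup>+ x. a x \<partial>density lebesgue v)" .
  qed simp
qed

section \<open>Geometric annuli and step functions\<close>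

definition level :: "real \<Rightarrow> nat \<Rightarrow> real set" where
  "level K n = {1 - 1 / K ^ n..<1 - 1 / K ^ Suc n}"

lemma level_disjoint: "1 < K \<Longrightarrow> disjoint_family (level K)"
proof (unfold disjoint_family_on_def, safe)
  fix m n s assume K: "1 < K" "m \<noteq> n" and s: "s \<in> level K m" "s \<in> level K n"
  have *: False if "i < j" "s \<in> level K i" "s \<in> level K j" for i j
  proof -
    have "K ^ Suc i \<le> K ^ j" using that K by (intro power_increasing) auto
    then have "1 / K ^ j \<le> 1 / K ^ Suc i" using K by (intro divide_left_mono) auto
    then show False using that by (simp add: level_def)
  qed
  show "s \<in> {}" using * K(2) s by (metis linorder_neqE_nat)
qed

lemma level_bounds: "1 < K \<Longrightarrow> s \<in> level K n \<Longrightarrow> 0 \<le> s \<and> s < 1"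
  using power_increasing[of 0 n K] by (auto simp: level_def intro: order_trans[rotated] less_trans)

lemma level_cover:
  assumes K: "1 < K" and s: "0 \<le> s" "s < 1"
  shows "\<exists>n. s \<in> level K n"
proof -
  obtain n where "1 / (1 - s) < K ^ n" using real_arch_pow[OF K] by blast
  then have ex: "\<exists>n. s < 1 - 1 / K ^ n" using s K by (intro exI[of _ n]) (simp add: field_simps)
  define n where "n = (LEAST n. s < 1 - 1 / K ^ n)"
  have n: "s < 1 - 1 / K ^ n" unfolding n_def by (rule LeastI_ex[OF ex])
  then have "n \<noteq> 0" using s by (intro notI) simp
  then obtain m where m: "n = Suc m" by (cases n) auto
  have "\<not> s < 1 - 1 / K ^ m" using not_less_Least[of m "\<lambda>n. s < 1 - 1 / K ^ n"] m by (simp add: n_def)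
  then show ?thesis using n m by (intro exI[of _ m]) (simp add: level_def)
qed

text \<open>Comparison functions that are measurable whatever is compared with them; their integrals
  against a measure are sums over annuli.\<close>

definition level_step :: "real \<Rightarrow> (nat \<Rightarrow> ennreal) \<Rightarrow> real \<Rightarrow> ennreal" where
  "level_step K c s = (\<Sum>n. c n * indicator (level K n) s)"

lemma level_step_eq: "1 < K \<Longrightarrow> s \<in> level K n \<Longrightarrow> level_step K c s = c n"
  unfolding level_step_def by (rule suminf_cmult_indicator[OF level_disjoint])

lemma level_step_outside: "(\<And>n. s \<notin> level K n) \<Longrightarrow> level_step K c s = 0"
  by (simp add: level_step_def)

lemma level_step_measurable: "level_step K c \<in> borel_measurable lebesgue"
proof -
  have [measurable]: "level K n \<in> sets lebesgue" for n by (simp add: level_def)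
  show ?thesis unfolding level_step_def by measurable
qed

lemma level_step_finite:
  assumes "1 < K" "\<And>n. c n < \<infinity>"
  shows "level_step K c s < \<infinity>"
  using assms level_step_eq[of K s _ c] level_step_outside[of s K c]
  by (cases "\<exists>n. s \<in> level K n") auto

lemma level_step_integral:
  assumes "sets \<mu> = sets lebesgue"
  shows "(\<integral>\<^sup>+ s. level_step K c s \<partial>\<mu>) = (\<Sum>n. c n * emeasure \<mu> (level K n))"
proof -
  have l: "level K n \<in> sets \<mu>" for n unfolding assms level_def by simp
  have "(\<integral>\<^sup>+ s. level_step K c s \<partial>\<mu>) = (\<Sum>n. \<integral>\<^sup>+ s. c n * indicator (level K n) s \<partial>\<mu>)"
    unfolding level_step_def using l by (intro nn_integral_suminf) auto
  also have "\<dots> = (\<Sum>n. c n * emeasure \<mu> (level K n))"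
    using l by (simp add: nn_integral_cmult_indicator)
  finally show ?thesis .
qed

text \<open>An infinite tail is not excluded by the definitions. By doubling all tails are then infinite, so an increasing
  \<open>h\<close> with a finite weighted integral vanishes and the estimate is trivial.\<close>

lemma weighted_hardy:
  assumes \<nu>: "\<nu> \<in> D_class \<inter> D_hat_q q" and q: "0 < q"
  shows "\<exists>K\<ge>2. \<forall>h. (\<forall>r s. 0 \<le> r \<longrightarrow> r \<le> s \<longrightarrow> s < 1 \<longrightarrow> h r \<le> h s) \<longrightarrow> (\<forall>r\<in>{0..<1}. 0 \<le> h r)
    \<longrightarrow> (\<integral>\<^sup>+ s\<in>{0..<1}. ennreal (h s powr q * \<nu> (of_real s)) \<partial>lebesgue) < \<infinity> \<longrightarrow>
    (\<forall>n. summable (\<lambda>i. h (1 - 1 / K ^ (n + i + 1)) / K ^ i)) \<and>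
    (\<forall>G C. (\<forall>n. \<forall>s\<in>level K n. 0 \<le> G s \<and> G s \<le> C * (\<Sum>j\<le>Suc n. tail_mean K (\<lambda>n. h (1 - 1 / K ^ n)) j))
      \<longrightarrow> (\<integral>\<^sup>+ s\<in>{0..<1}. ennreal (G s powr q * \<nu> (of_real s)) \<partial>lebesgue) < \<infinity>)"
proof -
  define T where "T = weight_tail \<nu>"
  have hat: "\<nu> \<in> D_hat" and chk: "\<nu> \<in> D_check" and hatq: "\<nu> \<in> D_hat_q q"
    using \<nu> by (auto simp: D_class_def)
  have w: "weight \<nu>" using hat unfolding D_hat_def by blast
  have nn: "0 \<le> \<nu> (of_real s)" if "0 \<le> s" "s < 1" for s
  proof -
    have "complex_of_real s \<in> ball 0 1" using that by simp
    then show ?thesis using w unfolding weight_def by blast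
  qed
  have Tpos: "0 < T r" if "0 \<le> r" "r < 1" for r
    using w that unfolding weight_def T_def by (meson atLeastLessThan_iff)
  obtain C1 where C1: "0 < C1" "\<And>r. 0 \<le> r \<Longrightarrow> r < 1 \<Longrightarrow> T r \<le> ennreal C1 * T ((1 + r) / 2)"
  proof -
    from hat have "\<exists>C>0. \<forall>r\<in>{0..<1}. T r \<le> ennreal C * T ((1 + r) / 2)"
      unfolding D_hat_def T_def by blast
    then show ?thesis using that by (meson atLeastLessThan_iff)
  qed
  obtain K0 C0 where K0: "1 < K0" "1 < C0"
    "\<And>r. 0 \<le> r \<Longrightarrow> r < 1 \<Longrightarrow> ennreal C0 * T (1 - (1 - r) / K0) \<le> T r"
  proof -
    from chk have "\<exists>K>1. \<exists>C>1. \<forall>r\<in>{0..<1}. T r \<ge> ennreal C * T (1 - (1 - r) / K)"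
      unfolding D_check_def T_def by blast
    then show ?thesis using that by (meson atLeastLessThan_iff)
  qed
  have Sfin: "(SUP r\<in>{0..<1}. ennreal ((1 - r) powr q) / T r *
        (\<integral>\<^sup>+ s\<in>{0..<r}. ennreal (\<nu> (of_real s) / (1 - s) powr q) \<partial>lebesgue)) < \<infinity>"
    using hatq unfolding D_hat_q_def T_def by blast
  obtain B0 where B0: "\<And>r. 0 \<le> r \<Longrightarrow> r < 1 \<Longrightarrow> ennreal ((1 - r) powr q) / T r *
        (\<integral>\<^sup>+ s\<in>{0..<r}. ennreal (\<nu> (of_real s) / (1 - s) powr q) \<partial>lebesgue) \<le> ennreal B0" "0 \<le> B0"
  proof -
    define X where "X = (SUP r\<in>{0..<1}. ennreal ((1 - r) powr q) / T r *
        (\<integral>\<^sup>+ s\<in>{0..<r}. ennreal (\<nu> (of_real s) / (1 - s) powr q) \<partial>lebesgue))"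
    have "ennreal (enn2real X) = X" using Sfin by (simp add: X_def)
    then show ?thesis
      by (intro that[of "enn2real X"]) (auto simp: X_def intro: SUP_upper)
  qed
  define u where "u s = ennreal (\<nu> (of_real s)) * indicator {0..<1} s" for s :: real
  have "u s < \<infinity>" for s by (simp add: u_def ennreal_mult_less_top indicator_def)
  then obtain \<mu> where \<mu>: "sets \<mu> = sets lebesgue" "\<And>a. a \<in> borel_measurable lebesgue \<Longrightarrow> (\<And>x. a x < \<infinity>) \<Longrightarrow>
      (\<integral>\<^sup>+ x. a x * u x \<partial>lebesgue) = (\<integral>\<^sup>+ x. a x \<partial>\<mu>)"
    using lebesgue_minorant_measure[of u] by blast
  have T\<mu>: "T r = emeasure \<mu> {r..<1}" if "0 \<le> r" for r
  proof -
    have "T r = (\<integral>\<^sup>+ s. indicator {r..<1} s * u s \<partial>lebesgue)"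
      unfolding T_def weight_tail_def u_def using that
      by (intro nn_integral_cong) (auto simp: indicator_def)
    also have "\<dots> = (\<integral>\<^sup>+ s. indicator {r..<1} s \<partial>\<mu>)" by (intro \<mu>(2) borel_measurable_indicator) (auto simp: indicator_def)
    also have "\<dots> = emeasure \<mu> {r..<1}" by (intro nn_integral_indicator) (simp add: \<mu>(1))
    finally show ?thesis .
  qed
  have Tanti: "T s \<le> T r" if "0 \<le> r" "r \<le> s" for r s
    using that by (simp add: T\<mu>) (intro emeasure_mono, auto simp: \<mu>(1))
  have step: "(\<integral>\<^sup>+ s. level_step K c s * u s \<partial>lebesgue) = (\<Sum>n. c n * emeasure \<mu> (level K n))"
    if "1 < K" "\<And>n. c n < \<infinity>" for K c
    using \<mu>(2)[OF level_step_measurable level_step_finite[OF that]] level_step_integral[OF \<mu>(1)] by simp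
  \<comment> \<open>The nonnegative integral is monotone for arbitrary functions, so only the step
    function has to be integrated exactly.\<close>
  have lower: "(\<Sum>n. c n * emeasure \<mu> (level K n)) \<le> (\<integral>\<^sup>+ s. F s \<partial>lebesgue)"
    if K: "1 < K" "\<And>n. c n < \<infinity>" and F: "\<And>n s. s \<in> level K n \<Longrightarrow> c n * ennreal (\<nu> (of_real s)) \<le> F s" for K c F
    unfolding step[OF K, symmetric]
  proof (intro nn_integral_mono)
    fix s
    show "level_step K c s * u s \<le> F s"
    proof (cases "\<exists>n. s \<in> level K n")
      case True
      then obtain n where n: "s \<in> level K n" by blast
      then show ?thesis
        using F[OF n] level_bounds[OF K(1) n] by (simp add: level_step_eq[OF K(1) n] u_def)
    qed (simp add: level_step_outside)
  qed
  have double: "T r \<le> ennreal C1 ^ k * T (1 - (1 - r) / 2 ^ k)" if r: "0 \<le> r" "r < 1" for r k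
  proof (induction k)
    case (Suc k)
    have 1: "(1 - r) / 2 ^ k \<le> 1" "0 < (1 - r) / 2 ^ k"
      using r one_le_power[of "2::real" k] by (auto simp: divide_le_eq intro: order_trans[of _ 1])
    have "T (1 - (1 - r) / 2 ^ k) \<le> ennreal C1 * T (1 - (1 - r) / 2 ^ Suc k)"
      using C1(2)[of "1 - (1 - r) / 2 ^ k"] 1 by (simp add: field_simps)
    from mult_left_mono[OF this, of "ennreal C1 ^ k"] Suc show ?case
      by (simp add: mult_ac order_trans)
  qed simp
  have halve: "ennreal C0 ^ k * T (1 - (1 - r) / K0 ^ k) \<le> T r" if r: "0 \<le> r" "r < 1" for r k
  proof (induction k)
    case (Suc k)
    have 1: "(1 - r) / K0 ^ k \<le> 1" "0 < (1 - r) / K0 ^ k"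
      using r one_le_power[of K0 k] K0(1) by (auto simp: divide_le_eq intro: order_trans[of _ 1])
    have "ennreal C0 * T (1 - (1 - r) / K0 ^ Suc k) \<le> T (1 - (1 - r) / K0 ^ k)"
      using K0(3)[of "1 - (1 - r) / K0 ^ k"] 1 by (simp add: mult.commute)
    from mult_left_mono[OF this, of "ennreal C0 ^ k"] Suc show ?case
      by (simp add: mult_ac order_trans)
  qed simp
  \<comment> \<open>From one radius \<open>x n\<close> to the next the tail should at least halve,
    yet change by at most a constant factor. Iterating \<open>D_check\<close> gives
    \<open>C0 ^ k0 > 2\<close>, whence \<open>K0 ^ k0 \<le> K\<close>; iterating
    \<open>D_hat\<close> as often as \<open>K < 2 ^ k1\<close> demands bounds the change.
    \<open>2 \<le> K\<close> serves later geometric estimates.\<close>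
  obtain k0 where k0: "2 < C0 ^ k0" using real_arch_pow[OF K0(2)] by blast
  define K where "K = max 2 (K0 ^ k0)"
  have K: "2 \<le> K" "K0 ^ k0 \<le> K" "1 < K" by (auto simp: K_def)
  obtain k1 where k1: "K < 2 ^ k1" using real_arch_pow[of 2 K] by auto
  define x where "x n = 1 - 1 / K ^ n" for n
  have x: "0 \<le> x n" "x n < 1" for n
    using K one_le_power[of K n] by (auto simp: x_def divide_le_eq)
  have mono_x: "x m \<le> x n" if "m \<le> n" for m n
    unfolding x_def using K that by (intro diff_left_mono divide_left_mono power_increasing) auto
  have x_Suc: "x (Suc n) = 1 - (1 - x n) / K" for n using K by (simp add: x_def)
  have TC: "T (x n) \<le> ennreal (C1 ^ k1) * T (x (Suc n))" for n
  proof -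
    have "T (x n) \<le> ennreal C1 ^ k1 * T (1 - (1 - x n) / 2 ^ k1)" by (rule double[OF x])
    also have "\<dots> \<le> ennreal C1 ^ k1 * T (x (Suc n))"
    proof (intro mult_left_mono Tanti x)
      have "(1 - x n) / 2 ^ k1 \<le> (1 - x n) / K" using k1 K x(2)[of n] by (intro divide_left_mono) auto
      then show "x (Suc n) \<le> 1 - (1 - x n) / 2 ^ k1" by (simp add: x_Suc)
    qed auto
    finally show ?thesis using C1 by (simp add: ennreal_power)
  qed
  have T2: "2 * T (x (Suc n)) \<le> T (x n)" for n
  proof -
    have "(1 - x n) / K0 ^ k0 \<le> 1"
      using x[of n] one_le_power[of K0 k0] K0(1) by (auto simp: divide_le_eq intro: order_trans[of _ 1])
    moreover have "(1 - x n) / K \<le> (1 - x n) / K0 ^ k0" using K K0(1) x(2)[of n] by (intro divide_left_mono) auto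
    ultimately have "T (x (Suc n)) \<le> T (1 - (1 - x n) / K0 ^ k0)" by (intro Tanti) (auto simp: x_Suc)
    moreover have "2 \<le> ennreal C0 ^ k0" using k0 K0(2) by (simp add: ennreal_power flip: ennreal_numeral)
    ultimately have "2 * T (x (Suc n)) \<le> ennreal C0 ^ k0 * T (1 - (1 - x n) / K0 ^ k0)" by (intro mult_mono) auto
    also have "\<dots> \<le> T (x n)" by (rule halve[OF x])
    finally show ?thesis .
  qed
  have lev: "level K n = {x n..<x (Suc n)}" for n by (simp add: level_def x_def)
  have split: "T (x n) = emeasure \<mu> (level K n) + T (x (Suc n))" for n
  proof -
    have "{x n..<1} = level K n \<union> {x (Suc n)..<1}"
      unfolding lev using mono_x[of n "Suc n"] x(2)[of "Suc n"] by auto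
    then show ?thesis
      using x by (simp add: T\<mu>) (subst plus_emeasure, auto simp: \<mu>(1) lev)
  qed
  have claim: "(\<forall>n. summable (\<lambda>i. h (x (n + i + 1)) / K ^ i)) \<and>
      (\<forall>G C. (\<forall>n. \<forall>s\<in>level K n. 0 \<le> G s \<and> G s \<le> C * (\<Sum>j\<le>Suc n. tail_mean K (\<lambda>n. h (x n)) j))
      \<longrightarrow> (\<integral>\<^sup>+ s\<in>{0..<1}. ennreal (G s powr q * \<nu> (of_real s)) \<partial>lebesgue) < \<infinity>)"
    if mono: "\<And>r s. 0 \<le> r \<Longrightarrow> r \<le> s \<Longrightarrow> s < 1 \<Longrightarrow> h r \<le> h s" and h0: "\<And>r. 0 \<le> r \<Longrightarrow> r < 1 \<Longrightarrow> 0 \<le> h r"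
      and fin: "(\<integral>\<^sup>+ s\<in>{0..<1}. ennreal (h s powr q * \<nu> (of_real s)) \<partial>lebesgue) < \<infinity>" for h
  proof -
    define H where "H n = h (x n)" for n
    have H: "0 \<le> H n" for n unfolding H_def by (intro h0 x)
    \<comment> \<open>As \<open>h\<close> is increasing, on annulus \<open>n\<close> it is at least
      its value at the inner radius \<open>x n\<close>.\<close>
    have low: "(\<Sum>n. ennreal (H n powr q) * emeasure \<mu> (level K n)) < \<infinity>"
    proof -
      have "(\<Sum>n. ennreal (H n powr q) * emeasure \<mu> (level K n))
          \<le> (\<integral>\<^sup>+ s\<in>{0..<1}. ennreal (h s powr q * \<nu> (of_real s)) \<partial>lebesgue)"
      proof (rule lower[OF K(3)])
        fix n s assume s: "s \<in> level K n"
        have s01: "0 \<le> s" "s < 1" using level_bounds[OF K(3) s] by auto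
        have "H n \<le> h s" unfolding H_def using s s01 x by (intro mono) (auto simp: lev)
        then have "H n powr q * \<nu> (of_real s) \<le> h s powr q * \<nu> (of_real s)"
          using H q nn[OF s01] by (intro mult_right_mono powr_mono2) auto
        then show "ennreal (H n powr q) * ennreal (\<nu> (of_real s))
            \<le> ennreal (h s powr q * \<nu> (of_real s)) * indicator {0..<1} s"
          using s01 by (simp add: ennreal_leI flip: ennreal_mult')
      qed simp
      then show ?thesis using fin by (rule le_less_trans)
    qed
    have up: "(\<integral>\<^sup>+ s\<in>{0..<1}. ennreal (G s powr q * \<nu> (of_real s)) \<partial>lebesgue)
        \<le> (\<Sum>n. ennreal (Z n powr q) * emeasure \<mu> (level K n))"
      if G: "\<And>n s. s \<in> level K n \<Longrightarrow> 0 \<le> G s \<and> G s \<le> Z n" for G Z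
    proof -
      have "(\<integral>\<^sup>+ s\<in>{0..<1}. ennreal (G s powr q * \<nu> (of_real s)) \<partial>lebesgue)
          \<le> (\<integral>\<^sup>+ s. level_step K (\<lambda>n. ennreal (Z n powr q)) s * u s \<partial>lebesgue)"
      proof (rule nn_integral_mono)
        fix s
        show "ennreal (G s powr q * \<nu> (of_real s)) * indicator {0..<1} s
            \<le> level_step K (\<lambda>n. ennreal (Z n powr q)) s * u s"
        proof (cases "0 \<le> s \<and> s < 1")
          case True
          then obtain n where n: "s \<in> level K n" using level_cover[OF K(3)] by blast
          have "G s powr q \<le> Z n powr q" using G[OF n] q by (intro powr_mono2) auto
          then have "G s powr q * \<nu> (of_real s) \<le> Z n powr q * \<nu> (of_real s)"
            using nn True by (intro mult_right_mono) auto
          then show ?thesis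
            using True by (simp add: level_step_eq[OF K(3) n] u_def ennreal_leI flip: ennreal_mult')
        qed (auto simp: indicator_def)
      qed
      also have "\<dots> = (\<Sum>n. ennreal (Z n powr q) * emeasure \<mu> (level K n))"
        by (rule step[OF K(3)]) simp
      finally show ?thesis .
    qed
    show ?thesis
    proof (cases "T 0 = \<infinity>")
      case True
      have Tinf: "T r = \<infinity>" if r: "0 \<le> r" "r < 1" for r
      proof -
        obtain k where "1 / (1 - r) < 2 ^ k" using real_arch_pow[of 2 "1 / (1 - r)"] by auto
        then have "r \<le> 1 - (1 - 0) / 2 ^ k" using r by (simp add: field_simps)
        then have "T (1 - (1 - 0) / 2 ^ k) \<le> T r" using r by (intro Tanti)
        moreover have "\<infinity> \<le> ennreal C1 ^ k * T (1 - (1 - 0) / 2 ^ k)" using double[of 0 k] True by simp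
        then have "T (1 - (1 - 0) / 2 ^ k) = \<infinity>"
          using C1(1) by (auto simp: ennreal_power less_imp_le top_unique ennreal_mult_eq_top_iff)
        ultimately show ?thesis by (simp add: top_unique)
      qed
      have hz: "h r = 0" if r: "0 \<le> r" "r < 1" for r
      proof (rule ccontr)
        assume "h r \<noteq> 0"
        then have pos: "0 < h r" using h0[OF r] by simp
        have "\<infinity> = ennreal (h r powr q) * T r" using pos Tinf[OF r] by (simp add: ennreal_mult_top)
        also have "\<dots> = (\<integral>\<^sup>+ s. ennreal (h r powr q) * indicator {r..<1} s \<partial>\<mu>)"
          using r by (simp add: T\<mu> nn_integral_cmult_indicator \<mu>(1))
        also have "\<dots> = (\<integral>\<^sup>+ s. (ennreal (h r powr q) * indicator {r..<1} s) * u s \<partial>lebesgue)"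
        proof (rule \<mu>(2)[symmetric])
          show "(\<lambda>s. ennreal (h r powr q) * indicator {r..<1} s) \<in> borel_measurable lebesgue"
            by (intro borel_measurable_times_ennreal borel_measurable_const borel_measurable_indicator) auto
          show "ennreal (h r powr q) * indicator {r..<1} s < \<infinity>" for s
            by (simp add: indicator_def)
        qed
        also have "\<dots> \<le> (\<integral>\<^sup>+ s\<in>{0..<1}. ennreal (h s powr q * \<nu> (of_real s)) \<partial>lebesgue)"
        proof (rule nn_integral_mono)
          fix s
          show "(ennreal (h r powr q) * indicator {r..<1} s) * u s
              \<le> ennreal (h s powr q * \<nu> (of_real s)) * indicator {0..<1} s"
          proof (cases "r \<le> s \<and> s < 1")
            case True
            then have "h r powr q * \<nu> (of_real s) \<le> h s powr q * \<nu> (of_real s)"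
              using r pos q nn[of s] mono[of r s] by (intro mult_right_mono powr_mono2) auto
            then show ?thesis using True r by (simp add: u_def ennreal_leI flip: ennreal_mult')
          qed (auto simp: indicator_def)
        qed
        finally show False using fin by (simp add: top_unique)
      qed
      have z: "h (x n) = 0" for n by (rule hz[OF x])
      have "(\<integral>\<^sup>+ s\<in>{0..<1}. ennreal (G s powr q * \<nu> (of_real s)) \<partial>lebesgue) < \<infinity>"
        if "\<forall>n. \<forall>s\<in>level K n. 0 \<le> G s \<and> G s \<le> C * (\<Sum>j\<le>Suc n. tail_mean K (\<lambda>n. h (x n)) j)" for G C
      proof -
        have "tail_mean K (\<lambda>n. h (x n)) j = 0" for j by (simp add: tail_mean_def z)
        then have "0 \<le> G s \<and> G s \<le> 0" if "s \<in> level K n" for n s using \<open>\<forall>n. _\<close> that by fastforce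
        then have "(\<integral>\<^sup>+ s\<in>{0..<1}. ennreal (G s powr q * \<nu> (of_real s)) \<partial>lebesgue)
            \<le> (\<Sum>n. ennreal (0 powr q) * emeasure \<mu> (level K n))" by (rule up)
        then show ?thesis by (simp add: le_less_trans)
      qed
      moreover have "summable (\<lambda>i. h (x (n + i + 1)) / K ^ i)" for n by (simp only: z) simp
      ultimately show ?thesis by blast
    next
      case False
      have Tfin: "T r < \<infinity>" if "0 \<le> r" for r
        using Tanti[of 0 r] that False by (simp add: less_top le_less_trans)
      define N where "N n = enn2real (T (x n))" for n
      have TN: "T (x n) = ennreal (N n)" for n unfolding N_def using Tfin[OF x(1)] by simp
      have N: "0 < N n" for n unfolding N_def using Tpos[OF x] Tfin[OF x(1)] by (simp add: enn2real_positive_iff)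
      have halving: "2 * N (Suc n) \<le> N n" for n
        using T2[of n] N[of n] N[of "Suc n"] unfolding TN
        by (simp add: ennreal_le_iff flip: ennreal_numeral ennreal_mult')
      have doubling: "N n \<le> C1 ^ k1 * N (Suc n)" for n
        using TC[of n] N[of n] N[of "Suc n"] C1(1) unfolding TN
        by (simp add: ennreal_le_iff flip: ennreal_mult')
      have mass: "emeasure \<mu> (level K n) = ennreal (N n - N (Suc n))" for n
      proof -
        have "emeasure \<mu> (level K n) = emeasure \<mu> (level K n) + ennreal (N (Suc n)) - ennreal (N (Suc n))"
          by (rule ennreal_add_diff_cancel[symmetric]) simp
        also have "emeasure \<mu> (level K n) + ennreal (N (Suc n)) = ennreal (N n)"
          using split[of n] unfolding TN by simp
        finally show ?thesis using N[of "Suc n"] by (simp add: ennreal_minus)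
      qed
      \<comment> \<open>At least half of each tail sits in its first annulus, so tails and annulus
        masses are interchangeable up to the factor 2.\<close>
      have mass_ge: "N n / 2 \<le> N n - N (Suc n)" for n using halving[of n] by simp
      define k where "k = K powr q"
      have k: "0 < k" using K by (simp add: k_def)
      have xq: "(1 - x n) powr q = 1 / k ^ n" for n
      proof -
        have "(1 / K ^ n) powr q = 1 / (K ^ n) powr q" using K by (simp add: powr_divide)
        also have "(K ^ n) powr q = k ^ n"
          using K by (simp add: k_def powr_realpow[symmetric] powr_powr mult.commute)
        finally show ?thesis by (simp add: x_def)
      qed
      \<comment> \<open>This is \<open>D_hat_q\<close> at the radius \<open>x m\<close>: on an
        earlier annulus \<open>n\<close> the factor \<open>1 / (1 - s) powr q\<close> is at least
        \<open>k ^ n\<close>. The 2 replaces annulus masses by tails, and the added 1 keeps the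
        constant positive even if \<open>B0\<close> is 0.\<close>
      have growth: "(\<Sum>n<m. N n * k ^ n) \<le> (2 * B0 + 1) * (N m * k ^ m)" for m
      proof -
        define S where "S = (\<Sum>n<m. k ^ n * (N n - N (Suc n)))"
        have dn: "0 \<le> N n - N (Suc n)" for n using mass_ge[of n] N[of n] by linarith
        have kn: "0 \<le> k ^ n" for n using k by simp
        have S0: "0 \<le> S" unfolding S_def by (intro sum_nonneg mult_nonneg_nonneg dn kn)
        define c where "c n = (if n < m then ennreal (k ^ n) else 0)" for n
        have "ennreal S = (\<Sum>n<m. ennreal (k ^ n * (N n - N (Suc n))))"
          unfolding S_def by (intro sum_ennreal[symmetric] mult_nonneg_nonneg dn kn)
        also have "\<dots> = (\<Sum>n<m. c n * emeasure \<mu> (level K n))"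
          by (intro sum.cong) (simp_all add: c_def mass ennreal_mult'[OF kn])
        also have "\<dots> = (\<Sum>n. c n * emeasure \<mu> (level K n))"
          by (subst suminf_finite[of "{..<m}"]) (auto simp: c_def)
        also have "\<dots> \<le> (\<integral>\<^sup>+ s\<in>{0..<x m}. ennreal (\<nu> (of_real s) / (1 - s) powr q) \<partial>lebesgue)"
        proof (rule lower[OF K(3)])
          fix n s assume s: "s \<in> level K n"
          have s01: "0 \<le> s" "s < 1" using level_bounds[OF K(3) s] by auto
          show "c n * ennreal (\<nu> (of_real s)) \<le> ennreal (\<nu> (of_real s) / (1 - s) powr q) * indicator {0..<x m} s"
          proof (cases "n < m")
            case True
            have sm: "s < x m" using s mono_x[of "Suc n" m] True by (simp add: lev)
            have "(1 - s) powr q \<le> (1 - x n) powr q" using s s01 q by (intro powr_mono2) (auto simp: lev)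
            then have "(1 - s) powr q * k ^ n \<le> 1" using k by (simp add: xq field_simps)
            then have "k ^ n * \<nu> (of_real s) \<le> \<nu> (of_real s) / (1 - s) powr q"
              using s01 nn[OF s01] mult_right_mono[of "(1 - s) powr q * k ^ n" 1 "\<nu> (of_real s)"] by (simp add: field_simps)
            then show ?thesis using True s01 sm k by (simp add: c_def ennreal_leI flip: ennreal_mult')
          qed (simp add: c_def)
        qed (simp add: c_def)
        finally have "ennreal ((1 - x m) powr q) / T (x m) * ennreal S \<le> ennreal B0"
          using B0(1)[OF x, of m] by (meson mult_left_mono order_trans zero_le)
        then have "1 / k ^ m / N m * S \<le> B0"
          using k N[of m] S0 B0(2) by (simp add: TN xq divide_ennreal ennreal_le_iff flip: ennreal_mult')
        then have "S \<le> B0 * (N m * k ^ m)" using k N[of m] by (simp add: field_simps)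
        moreover have "(\<Sum>n<m. N n * k ^ n) \<le> 2 * S"
          unfolding S_def sum_distrib_left
        proof (rule sum_mono)
          fix n
          have "N n \<le> 2 * (N n - N (Suc n))" using halving[of n] by simp
          then have "k ^ n * N n \<le> k ^ n * (2 * (N n - N (Suc n)))" by (intro mult_left_mono kn)
          then show "N n * k ^ n \<le> 2 * (k ^ n * (N n - N (Suc n)))"
            by (simp only: mult.commute[of "N n"] mult.left_commute[of 2])
        qed
        moreover have "0 < N m * k ^ m" using k N[of m] by simp
        ultimately have "(\<Sum>n<m. N n * k ^ n) \<le> 2 * (B0 * (N m * k ^ m)) + N m * k ^ m" by linarith
        then show ?thesis by (simp only: distrib_right mult_1 mult.assoc)
      qed
      have sm: "summable (\<lambda>n. N n * H n powr q)"
      proof -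
        have "(\<Sum>n. ennreal (N n * H n powr q / 2)) \<le> (\<Sum>n. ennreal (H n powr q) * emeasure \<mu> (level K n))"
        proof (intro suminf_le summableI)
          fix n
          have "N n * H n powr q / 2 \<le> H n powr q * (N n - N (Suc n))"
            using mult_left_mono[OF mass_ge[of n], of "H n powr q"] by (simp add: mult.commute)
          then show "ennreal (N n * H n powr q / 2) \<le> ennreal (H n powr q) * emeasure \<mu> (level K n)"
            by (simp add: mass ennreal_leI flip: ennreal_mult')
        qed
        then have "(\<Sum>n. ennreal (N n * H n powr q / 2)) \<noteq> \<infinity>" using low by (auto simp: top_unique)
        then have "summable (\<lambda>n. N n * H n powr q / 2)"
          by (intro summable_suminf_not_top) (simp_all add: less_imp_le[OF N])
        then have "summable (\<lambda>n. N n * H n powr q / 2 * 2)" by (rule summable_mult2)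
        then show ?thesis by simp
      qed
      have B: "0 < 2 * B0 + 1" and C: "0 < C1 ^ k1" using B0(2) C1(1) by auto
      note hardy = N K(3) q B C doubling halving growth[unfolded k_def] H sm
      have "(\<integral>\<^sup>+ s\<in>{0..<1}. ennreal (G s powr q * \<nu> (of_real s)) \<partial>lebesgue) < \<infinity>"
        if G: "\<forall>n. \<forall>s\<in>level K n. 0 \<le> G s \<and> G s \<le> C * (\<Sum>j\<le>Suc n. tail_mean K (\<lambda>n. h (x n)) j)" for G C
      proof -
        define W where "W n = (\<Sum>j\<le>Suc n. tail_mean K H j)" for n
        have W: "0 \<le> W n" for n unfolding W_def by (intro sum_nonneg tail_mean_nonneg[OF hardy])
        \<comment> \<open>\<open>C\<close> may have any sign, whereas the upper step function needs
          a nonnegative multiple of \<open>W n\<close>.\<close>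
        have "G s \<le> \<bar>C\<bar> * W n" if "s \<in> level K n" for n s
        proof -
          have "G s \<le> C * W n" using G that by (simp add: W_def H_def[abs_def])
          also have "\<dots> \<le> \<bar>C\<bar> * W n" using W by (intro mult_right_mono) auto
          finally show ?thesis .
        qed
        then have "(\<integral>\<^sup>+ s\<in>{0..<1}. ennreal (G s powr q * \<nu> (of_real s)) \<partial>lebesgue)
            \<le> (\<Sum>n. ennreal ((\<bar>C\<bar> * W n) powr q) * emeasure \<mu> (level K n))"
          using G by (intro up) auto
        also have "\<dots> \<le> (\<Sum>n. ennreal (\<bar>C\<bar> powr q * (N n * W n powr q)))"
        proof (intro suminf_le summableI)
          fix n
          have "(\<bar>C\<bar> * W n) powr q * (N n - N (Suc n)) \<le> \<bar>C\<bar> powr q * (N n * W n powr q)"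
            using N[of "Suc n"] W[of n] mult_left_mono[of "N n - N (Suc n)" "N n" "\<bar>C\<bar> powr q * W n powr q"]
            by (simp add: powr_mult mult_ac)
          then show "ennreal ((\<bar>C\<bar> * W n) powr q) * emeasure \<mu> (level K n) \<le> ennreal (\<bar>C\<bar> powr q * (N n * W n powr q))"
            by (simp add: mass ennreal_leI flip: ennreal_mult')
        qed
        also have "\<dots> < \<infinity>"
        proof -
          have "summable (\<lambda>n. \<bar>C\<bar> powr q * (N n * W n powr q))"
            unfolding W_def by (intro summable_mult discrete_hardy[OF hardy])
          then show ?thesis
            by (subst suminf_ennreal2) (simp_all add: less_imp_le[OF N])
        qed
        finally show ?thesis .
      qed
      moreover have "summable (\<lambda>i. h (x (n + i + 1)) / K ^ i)" for n
        using discrete_hardy_tail(1)[OF hardy, of n] by (simp add: H_def)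
      ultimately show ?thesis by blast
    qed
  qed
  show ?thesis
    using claim K(1) unfolding x_def by (intro exI[of _ K]) (auto simp: Ball_def)
qed

section \<open>The defect of an inner factor\<close>

text \<open>Distance in L^p between two dilated and rotated copies of \<open>f\<close>. It satisfies
  the triangle inequality in the complex parameters, so a displacement can be routed through
  intermediate points.\<close>

definition circle_dist :: "real \<Rightarrow> (complex \<Rightarrow> complex) \<Rightarrow> complex \<Rightarrow> complex \<Rightarrow> real" where
  "circle_dist p f c c' = cnorm p (\<lambda>t. cmod (f (c * cis t) - f (c' * cis t)))"

lemma circle_dist_sym: "circle_dist p f c c' = circle_dist p f c' c"
  by (simp add: circle_dist_def norm_minus_commute)

lemma circle_dist_self: "0 < p \<Longrightarrow> circle_dist p f c c = 0"
  by (simp add: circle_dist_def cnorm_const)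

lemma circle_dist_triangle:
  assumes f: "continuous_on (ball 0 1) f" and c: "cmod a < 1" "cmod b < 1" "cmod c < 1" and p: "1 \<le> p"
  shows "circle_dist p f a c \<le> circle_dist p f a b + circle_dist p f b c"
proof -
  have cont: "continuous_on {0..2 * pi} (\<lambda>t. f (x * cis t))" if "cmod x < 1" for x
    using that by (intro continuous_on_circle_compose[OF f] continuous_intros)
  have "circle_dist p f a c \<le> cnorm p (\<lambda>t. cmod (f (a * cis t) - f (b * cis t)) + cmod (f (b * cis t) - f (c * cis t)))"
    unfolding circle_dist_def using p c norm_triangle_ineq[of "f (a * cis t) - f (b * cis t)" "f (b * cis t) - f (c * cis t)" for t]
    by (intro cnorm_mono continuous_intros cont) auto
  also have "\<dots> \<le> circle_dist p f a b + circle_dist p f b c"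
    unfolding circle_dist_def using p c by (intro cnorm_add_le continuous_intros cont) auto
  finally show ?thesis .
qed

lemma cmod_cis_minus_1_le: "cmod (cis s - 1) \<le> \<bar>s\<bar>"
proof -
  have "cmod (cis s - 1) = 2 * \<bar>sin (s / 2)\<bar>"
    using dist_exp_i_1[of s] by (simp add: cis_conv_exp)
  also have "\<dots> \<le> 2 * \<bar>s / 2\<bar>" using abs_sin_x_le_abs_x[of "s / 2"] by simp
  finally show ?thesis by simp
qed

text \<open>The inner function enters only through \<open>I1\<close> and \<open>defect\<close>, the
  weight only through \<open>summ\<close>, which makes the tail means converge. \<open>H\<close>
  collects the norms of \<open>deriv F\<close> at the radii \<open>1 - 1 / K ^ n\<close>, without
  the normalising factor of \<open>integral_mean\<close>.\<close>

locale disc_factor =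
  fixes p K :: real and f I F :: "complex \<Rightarrow> complex" and H :: "nat \<Rightarrow> real"
  assumes p: "1 \<le> p" and K: "2 \<le> K"
    and hf: "f holomorphic_on ball 0 1" and hI: "I holomorphic_on ball 0 1"
    and I1: "\<And>z. cmod z < 1 \<Longrightarrow> cmod (I z) \<le> 1"
    and defect: "(\<lambda>k. integral {0..2 * pi} (\<lambda>t. cmod (f (of_real (unit_seq k) * cis t))
      * (1 - cmod (I (of_real (unit_seq k) * cis t))))) \<longlonglongrightarrow> 0"
    and F_def: "F = (\<lambda>z. f z * I z)"
    and H_def: "H = (\<lambda>n. cnorm p (\<lambda>t. cmod (deriv F (of_real (1 - 1 / K ^ n) * cis t))))"
    and summ: "\<And>n. summable (\<lambda>i. H (n + i + 1) / K ^ i)"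
begin

definition x :: "nat \<Rightarrow> real" where "x n = 1 - 1 / K ^ n"
text \<open>Equals the sum of \<open>H (m + 1) / K ^ m\<close> over all \<open>m \<ge> n\<close> and
  will bound the displacement of \<open>F\<close> between radius \<open>x n\<close> and any larger
  one.\<close>

definition E :: "nat \<Rightarrow> real" where "E n = tail_mean K H n / K ^ n"
definition \<Phi> :: "complex \<Rightarrow> real" where "\<Phi> z = cmod (f z) * (1 - cmod (I z))"

lemma hF: "F holomorphic_on ball 0 1" unfolding F_def by (intro holomorphic_intros hf hI)

lemma cF: "continuous_on (ball 0 1) F" by (rule holomorphic_on_imp_continuous_on[OF hF])

lemma c\<Phi>: "continuous_on (ball 0 1) \<Phi>"
  unfolding \<Phi>_def by (intro continuous_intros holomorphic_on_imp_continuous_on hf hI)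

lemma \<Phi>_nonneg: "z \<in> ball 0 1 \<Longrightarrow> 0 \<le> \<Phi> z" unfolding \<Phi>_def using I1[of z] by simp

lemma \<Phi>_eq: "\<Phi> z = cmod (f z) - cmod (F z)" by (simp add: \<Phi>_def F_def norm_mult algebra_simps)

lemma x_bounds: "0 \<le> x n" "x n < 1"
  using K one_le_power[of K n] by (auto simp: x_def divide_le_eq)

lemma x_mono: "m \<le> n \<Longrightarrow> x m \<le> x n"
  unfolding x_def using K by (intro diff_left_mono divide_left_mono power_increasing) auto

lemma H_nonneg: "0 \<le> H n" by (simp add: H_def)

lemma H_x: "H n = cnorm p (\<lambda>t. cmod (deriv F (of_real (x n) * cis t)))" by (simp add: H_def x_def)

lemma hF': "deriv F holomorphic_on ball 0 1" by (intro holomorphic_deriv hF) auto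

lemma H_mono: "m \<le> n \<Longrightarrow> H m \<le> H n"
  unfolding H_x using x_bounds x_mono p by (intro cnorm_holomorphic_mono[OF hF']) auto

lemma tail_mean_nonneg': "0 \<le> tail_mean K H n"
  unfolding tail_mean_def using K by (intro suminf_nonneg summ) (auto intro: H_nonneg divide_nonneg_nonneg)

lemma E_rec: "E n = H (Suc n) / K ^ n + E (Suc n)"
proof -
  have "tail_mean K H n = H (Suc n) + (\<Sum>i. H (n + Suc i + 1) / K ^ Suc i)"
    unfolding tail_mean_def using suminf_split_head[OF summ[of n]] by simp
  also have "(\<Sum>i. H (n + Suc i + 1) / K ^ Suc i) = (\<Sum>i. H (Suc n + i + 1) / K ^ i / K)"
    by (simp add: mult.commute)
  also have "\<dots> = tail_mean K H (Suc n) / K"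
    unfolding tail_mean_def by (rule suminf_divide[OF summ])
  finally show ?thesis by (simp add: E_def add_divide_distrib)
qed

lemma E_nonneg: "0 \<le> E n" unfolding E_def using tail_mean_nonneg' K by simp

lemma H_le_E: "H (Suc n) / K ^ n \<le> E n" using E_rec[of n] E_nonneg[of "Suc n"] by simp

section \<open>Displacement of \<open>F\<close> in radial and angular direction\<close>

lemma circle_dist_segment:
  assumes "cmod a \<le> x n" "cmod b \<le> x n"
  shows "circle_dist p F a b \<le> cmod (a - b) * H n"
  unfolding circle_dist_def H_x using assms x_bounds p by (intro cnorm_diff_segment_le[OF hF]) auto

text \<open>Telescoping over the radii \<open>x j\<close>, \<open>x (Suc j)\<close> and so on:
  annulus \<open>j\<close> contributes at most \<open>1 / K ^ j\<close> times the norm at its outer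
  end, and \<open>E_rec\<close> adds this up. The bound does not depend on \<open>r\<close>.\<close>

lemma circle_dist_radial:
  assumes "cmod w = 1" "x j \<le> r" "r < 1"
  shows "circle_dist p F (w * of_real r) (w * of_real (x j)) \<le> E j"
proof -
  have step: "circle_dist p F (w * of_real s) (w * of_real (x j)) \<le> H (Suc j) / K ^ j"
    if s: "x j \<le> s" "s \<le> x (Suc j)" for s j
  proof -
    have "0 \<le> s" using s x_bounds[of j] by simp
    have "circle_dist p F (w * of_real s) (w * of_real (x j)) \<le> cmod (w * of_real s - w * of_real (x j)) * H (Suc j)"
      using assms(1) s x_bounds[of j] x_mono[of j "Suc j"] \<open>0 \<le> s\<close>
      by (intro circle_dist_segment) (auto simp: norm_mult)
    also have "w * of_real s - w * of_real (x j) = w * of_real (s - x j)" by (simp add: algebra_simps)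
    also have "cmod (w * of_real (s - x j)) * H (Suc j) = (s - x j) * H (Suc j)"
      using s assms(1) by (simp add: norm_mult del: of_real_diff)
    also have "\<dots> \<le> (1 / K ^ j) * H (Suc j)"
    proof (intro mult_right_mono H_nonneg)
      have "s \<le> 1" using s(2) x_bounds(2)[of "Suc j"] by simp
      then show "s - x j \<le> 1 / K ^ j" by (simp add: x_def)
    qed
    finally show ?thesis by simp
  qed
  have "circle_dist p F (w * of_real r) (w * of_real (x j)) \<le> E j" if "r \<le> x (j + m)" "x j \<le> r" for m j
    using that
  proof (induction m arbitrary: j)
    case 0
    then have "r = x j" by simp
    then show ?case using E_nonneg p by (simp add: circle_dist_self)
  next
    case (Suc m)
    show ?case
    proof (cases "r \<le> x (Suc j)")
      case True
      then show ?thesis using step[of j r] Suc.prems H_le_E[of j] by simp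
    next
      case False
      have "circle_dist p F (w * of_real r) (w * of_real (x j))
        \<le> circle_dist p F (w * of_real r) (w * of_real (x (Suc j))) + circle_dist p F (w * of_real (x (Suc j))) (w * of_real (x j))"
        using assms p x_bounds Suc.prems order_trans[OF x_bounds(1) Suc.prems(2)]
        by (intro circle_dist_triangle[OF cF]) (auto simp: norm_mult)
      also have "\<dots> \<le> E (Suc j) + H (Suc j) / K ^ j"
        using Suc.IH[of "Suc j"] Suc.prems False step[of j "x (Suc j)"] x_mono[of j "Suc j"] by (intro add_mono) auto
      finally show ?thesis using E_rec[of j] by simp
    qed
  qed
  moreover obtain m where "r \<in> level K m"
    using level_cover[of K r] K assms order_trans[OF x_bounds(1) assms(2)] by auto
  then have "r \<le> x (j + Suc m)" using x_mono[of "Suc m" "j + Suc m"] by (simp add: level_def x_def)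
  ultimately show ?thesis using assms(2) by blast
qed

text \<open>The path leads from radius \<open>\<rho>\<close> down to \<open>x j\<close>, turns by
  \<open>s\<close> there and climbs to \<open>r\<close>; each of the three parts costs at most
  \<open>E j\<close>. Turning is cheap when \<open>|s|\<close> is at most \<open>1 / K ^ j\<close>,
  the distance of \<open>x j\<close> from 1. For \<open>j = 0\<close> it happens at the centre, so
  every \<open>s\<close> is allowed.\<close>

lemma circle_dist_rotated:
  assumes r: "x j \<le> r" "r < 1" "x j \<le> \<rho>" "\<rho> < 1" and s: "j = 0 \<or> \<bar>s\<bar> \<le> 1 / K ^ j"
  shows "circle_dist p F (cis s * of_real \<rho>) (of_real r) \<le> 3 * E j"
proof -
  have r0: "0 \<le> r" "0 \<le> \<rho>" using r x_bounds[of j] by auto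
  have mid: "circle_dist p F (cis s * of_real (x j)) (of_real (x j)) \<le> E j"
  proof (cases "j = 0")
    case True
    then show ?thesis using E_nonneg p by (simp add: x_def circle_dist_self)
  next
    case False
    have "circle_dist p F (cis s * of_real (x j)) (of_real (x j)) \<le> cmod (cis s * of_real (x j) - of_real (x j)) * H j"
      using x_bounds by (intro circle_dist_segment) (auto simp: norm_mult)
    also have "cis s * of_real (x j) - of_real (x j) = (cis s - 1) * of_real (x j)" by (simp add: algebra_simps)
    also have "cmod ((cis s - 1) * of_real (x j)) = cmod (cis s - 1) * x j"
      using x_bounds by (simp add: norm_mult)
    also have "cmod (cis s - 1) * x j * H j \<le> (1 / K ^ j) * 1 * H (Suc j)"
      using s False cmod_cis_minus_1_le[of s] x_bounds[of j] H_nonneg K H_mono[of j "Suc j"]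
      by (intro mult_mono) auto
    also have "\<dots> \<le> E j" using H_le_E[of j] by simp
    finally show ?thesis .
  qed
  have "circle_dist p F (cis s * of_real \<rho>) (of_real r) \<le> circle_dist p F (cis s * of_real \<rho>) (cis s * of_real (x j))
      + circle_dist p F (cis s * of_real (x j)) (of_real r)"
    using r r0 x_bounds p by (intro circle_dist_triangle[OF cF]) (auto simp: norm_mult)
  also have "circle_dist p F (cis s * of_real (x j)) (of_real r)
      \<le> circle_dist p F (cis s * of_real (x j)) (of_real (x j)) + circle_dist p F (of_real (x j)) (of_real r)"
    using r r0 x_bounds p by (intro circle_dist_triangle[OF cF]) (auto simp: norm_mult)
  finally show ?thesis
    using circle_dist_radial[of "cis s" j \<rho>] circle_dist_radial[of 1 j r] mid r
      circle_dist_sym[of p F "of_real (x j)" "of_real r"] by simp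
qed

section \<open>The Poisson mean of the displacement and the norm of the defect\<close>

definition W :: "nat \<Rightarrow> real" where "W n = (\<Sum>j\<le>n. tail_mean K H j)"

lemma W_nonneg: "0 \<le> W n" unfolding W_def by (intro sum_nonneg tail_mean_nonneg')

lemma W_mono: "m \<le> n \<Longrightarrow> W m \<le> W n"
  unfolding W_def by (intro sum_mono2) (auto intro: tail_mean_nonneg')

text \<open>The circle is cut into a central arc \<open>|s| \<le> 1 / K ^ n\<close> and arcs
  \<open>1 / K ^ Suc j < |s| \<le> 1 / K ^ j\<close> for \<open>j < n\<close>, the one for
  \<open>j = 0\<close> extending to \<open>pi\<close>. On the central arc the full mass of the
  kernel meets \<open>3 * E n\<close>. On the others kernel decay times arc length is of order
  \<open>(1 - r) * K ^ j\<close>, which turns \<open>E j\<close> into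
  \<open>(1 - r) * tail_mean K H j\<close>; thus all terms share the factor
  \<open>1 / K ^ n\<close>.\<close>

lemma poisson_average_le:
  assumes r: "r \<in> level K n" and \<rho>: "r < \<rho>" "1 / 2 \<le> \<rho>" "\<rho> < 1"
  shows "integral {-pi..pi} (\<lambda>s. poisson_kernel r \<rho> s * circle_dist p F (cis s * of_real \<rho>) (of_real r))
    \<le> 2 * pi * (24 * pi\<^sup>2 * K\<^sup>2 / K ^ n * W n)"
proof -
  have rx: "x n \<le> r" "r < 1" "0 \<le> r" using r level_bounds[of K r n] K by (auto simp: level_def x_def)
  define D where "D s = circle_dist p F (cis s * of_real \<rho>) (of_real r)" for s
  \<comment> \<open>Kernel decay beyond \<open>1 / K ^ Suc j\<close>, times the displacement
    \<open>3 * E j\<close>; 24 is 8 times 3.\<close>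
  define b where "b j = 24 * pi\<^sup>2 * (1 - r) * E j * (K ^ Suc j)\<^sup>2" for j
  have b: "0 \<le> b j" for j unfolding b_def using E_nonneg rx K by (intro mult_nonneg_nonneg) auto
  \<comment> \<open>The arcs of half-length \<open>pi / K ^ j\<close> overlap, which is harmless for
    an upper bound; for \<open>j = 0\<close> they give the whole circle.\<close>
  define e where "e s = poisson_kernel r \<rho> s * (3 * E n) + (\<Sum>j<n. if s \<in> {-(pi / K ^ j)..pi / K ^ j} then b j else 0)" for s
  have pk: "0 \<le> poisson_kernel r \<rho> s" for s using poisson_kernel_pos[of r \<rho> s] rx \<rho> by simp
  have pke: "0 \<le> poisson_kernel r \<rho> s * (3 * E n)" for s using pk E_nonneg by simp
  have bs: "0 \<le> (\<Sum>j<n. if s \<in> {-(pi / K ^ j)..pi / K ^ j} then b j else 0)" for s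
    by (intro sum_nonneg) (auto simp: b)
  have le: "poisson_kernel r \<rho> s * D s \<le> e s" if s: "s \<in> {-pi..pi}" for s
  proof (cases "n = 0 \<or> \<bar>s\<bar> \<le> 1 / K ^ n")
    case True
    then have "D s \<le> 3 * E n" unfolding D_def using rx \<rho> by (intro circle_dist_rotated) auto
    then have "poisson_kernel r \<rho> s * D s \<le> poisson_kernel r \<rho> s * (3 * E n)" using pk by (intro mult_left_mono)
    then show ?thesis using bs[of s] by (simp add: e_def)
  next
    case False
    \<comment> \<open>The arc that contains \<open>s\<close>. Minimality gives
      \<open>|s| \<le> 1 / K ^ j\<close>, except for \<open>j = 0\<close>, where
      \<open>circle_dist_rotated\<close> asks for no bound.\<close>
    define j where "j = (LEAST j. 1 / K ^ Suc j < \<bar>s\<bar>)"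
    have "\<exists>j. 1 / K ^ Suc j < \<bar>s\<bar>" using False by (intro exI[of _ "n - 1"]) auto
    then have j: "1 / K ^ Suc j < \<bar>s\<bar>" unfolding j_def by (rule LeastI_ex)
    have jn: "j < n"
    proof -
      have "j \<le> n - 1" unfolding j_def by (rule Least_le) (use False in auto)
      then show ?thesis using False by auto
    qed
    have js: "j = 0 \<or> \<bar>s\<bar> \<le> 1 / K ^ j"
    proof (cases j)
      case (Suc i)
      then have "\<not> 1 / K ^ Suc i < \<bar>s\<bar>" using not_less_Least[of i "\<lambda>j. 1 / K ^ Suc j < \<bar>s\<bar>"] by (simp add: j_def)
      then show ?thesis using Suc by simp
    qed simp
    have "D s \<le> 3 * E j"
      unfolding D_def using rx \<rho> js x_mono[of j n] jn by (intro circle_dist_rotated) auto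
    moreover have "poisson_kernel r \<rho> s \<le> 8 * pi\<^sup>2 * (1 - r) / (1 / K ^ Suc j)\<^sup>2"
      using rx \<rho> s j K by (intro poisson_kernel_decay) auto
    ultimately have "poisson_kernel r \<rho> s * D s \<le> 8 * pi\<^sup>2 * (1 - r) / (1 / K ^ Suc j)\<^sup>2 * (3 * E j)"
      using rx E_nonneg by (intro mult_mono) (auto simp: D_def circle_dist_def)
    also have "\<dots> = b j" by (simp add: b_def power_divide)
    also have "\<dots> \<le> (\<Sum>j<n. if s \<in> {-(pi / K ^ j)..pi / K ^ j} then b j else 0)"
    proof -
      have "\<bar>s\<bar> \<le> pi / K ^ j"
      proof (cases "j = 0")
        case True
        then show ?thesis using s by auto
      next
        case False
        then have "\<bar>s\<bar> \<le> 1 / K ^ j" using js by simp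
        also have "\<dots> \<le> pi / K ^ j" using pi_gt3 K by (intro divide_right_mono) auto
        finally show ?thesis .
      qed
      then have "b j = (if s \<in> {-(pi / K ^ j)..pi / K ^ j} then b j else 0)" by auto
      also have "\<dots> \<le> (\<Sum>j<n. if s \<in> {-(pi / K ^ j)..pi / K ^ j} then b j else 0)"
        using jn b by (intro member_le_sum) auto
      finally show ?thesis .
    qed
    finally show ?thesis using pke[of s] unfolding e_def by linarith
  qed
  have ind: "((\<lambda>s. if s \<in> {-(pi / K ^ j)..pi / K ^ j} then b j else 0) has_integral (2 * pi / K ^ j * b j)) {-pi..pi}" for j
  proof -
    have "pi / K ^ j \<le> pi" using one_le_power[of K j] K by (simp add: divide_le_eq)
    then have sub: "{-(pi / K ^ j)..pi / K ^ j} \<subseteq> {-pi..pi}" by auto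
    have "((\<lambda>s. b j) has_integral (2 * pi / K ^ j * b j)) {-(pi / K ^ j)..pi / K ^ j}"
      using has_integral_const_real[of "b j" "-(pi / K ^ j)" "pi / K ^ j"] K by simp
    then show ?thesis using has_integral_restrict[OF sub, of "\<lambda>s. b j"] by simp
  qed
  have P: "((\<lambda>s. poisson_kernel r \<rho> s) has_integral 2 * pi) {-pi..pi}"
    using integral_poisson_kernel[of r \<rho>] rx \<rho>
    by (simp add: has_integral_iff) (intro integrable_continuous_interval continuous_intros, auto)
  have e: "(e has_integral (2 * pi * (3 * E n) + (\<Sum>j<n. 2 * pi / K ^ j * b j))) {-pi..pi}"
    unfolding e_def by (intro has_integral_add has_integral_sum has_integral_mult_left P ind) auto
  have "integral {-pi..pi} (\<lambda>s. poisson_kernel r \<rho> s * D s) \<le> integral {-pi..pi} e"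
  proof (rule integral_le[OF _ _ le])
    have "continuous_on {-pi..pi} D"
      unfolding D_def circle_dist_def using p rx \<rho>
      by (intro continuous_on_cnorm) (auto simp: case_prod_unfold norm_mult intro!: continuous_intros
          continuous_on_compose2[OF cF])
    then show "(\<lambda>s. poisson_kernel r \<rho> s * D s) integrable_on {-pi..pi}"
      using rx \<rho> by (intro integrable_continuous_interval continuous_intros)
    show "e integrable_on {-pi..pi}" using e by blast
  qed
  also have "\<dots> = 2 * pi * (3 * E n) + (\<Sum>j<n. 2 * pi / K ^ j * b j)" using e by (rule integral_unique)
  also have "\<dots> \<le> 2 * pi * (24 * pi\<^sup>2 * K\<^sup>2 / K ^ n * tail_mean K H n)
      + (\<Sum>j<n. 2 * pi * (24 * pi\<^sup>2 * K\<^sup>2 / K ^ n * tail_mean K H j))"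
  proof (intro add_mono sum_mono)
    have "1 * 1 \<le> pi\<^sup>2 * K\<^sup>2" using K pi_gt3 by (intro mult_mono one_le_power) auto
    then have "3 \<le> 24 * pi\<^sup>2 * K\<^sup>2" by linarith
    then have "3 * E n \<le> (24 * pi\<^sup>2 * K\<^sup>2) * E n" using E_nonneg by (intro mult_right_mono) auto
    then show "2 * pi * (3 * E n) \<le> 2 * pi * (24 * pi\<^sup>2 * K\<^sup>2 / K ^ n * tail_mean K H n)"
      by (intro mult_left_mono) (auto simp: E_def)
    fix j
    have "1 - r \<le> 1 / K ^ n" using rx by (simp add: x_def)
    then have le: "24 * pi\<^sup>2 * K\<^sup>2 * (1 - r) * tail_mean K H j \<le> 24 * pi\<^sup>2 * K\<^sup>2 * (1 / K ^ n) * tail_mean K H j"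
      using tail_mean_nonneg' by (intro mult_right_mono mult_left_mono) auto
    have "2 * pi / K ^ j * b j = 2 * pi * (24 * pi\<^sup>2 * K\<^sup>2 * (1 - r) * tail_mean K H j)"
      using K by (simp add: b_def E_def power2_eq_square)
    also have "\<dots> \<le> 2 * pi * (24 * pi\<^sup>2 * K\<^sup>2 * (1 / K ^ n) * tail_mean K H j)"
      by (intro mult_left_mono le) auto
    finally show "2 * pi / K ^ j * b j \<le> 2 * pi * (24 * pi\<^sup>2 * K\<^sup>2 / K ^ n * tail_mean K H j)"
      by simp
  qed
  also have "\<dots> = 2 * pi * (24 * pi\<^sup>2 * K\<^sup>2 / K ^ n * W n)"
  proof -
    have "W n = tail_mean K H n + (\<Sum>j<n. tail_mean K H j)"
      by (simp add: W_def add.commute flip: lessThan_Suc_atMost)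
    then show ?thesis by (simp only: distrib_left sum_distrib_left)
  qed
  finally show ?thesis by (simp add: D_def)
qed

definition A :: "real \<Rightarrow> real" where "A r = cnorm p (\<lambda>t. \<Phi> (of_real r * cis t))"

text \<open>The pointwise bound has two parts: the mean defect \<open>d k\<close> times the maximum
  of the kernel, and the Poisson mean of a displacement of \<open>F\<close>. The first is constant
  in \<open>t\<close> and vanishes as \<open>k\<close> grows; its factor \<open>4 / (1 - r)\<close>
  is harmless because \<open>r\<close> stays fixed. The second is bounded independently of
  \<open>\<rho>\<close> by \<open>poisson_average_le\<close>.\<close>

lemma A_le:
  assumes r: "r \<in> level K n"
  shows "A r \<le> 24 * pi\<^sup>2 * K\<^sup>2 / K ^ n * W n"
proof -
  have rx: "x n \<le> r" "r < 1" "0 \<le> r" using r level_bounds[of K r n] K by (auto simp: level_def x_def)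
  define B where "B = 24 * pi\<^sup>2 * K\<^sup>2 / K ^ n * W n"
  define d where "d k = integral {0..2 * pi} (\<lambda>t. \<Phi> (of_real (unit_seq k) * cis t))" for k
  have d: "d \<longlonglongrightarrow> 0" using defect by (simp add: d_def[abs_def] \<Phi>_def)
  have "\<forall>\<^sub>F k in sequentially. max (1 / 2) ((1 + r) / 2) < unit_seq k"
    using rx by (intro order_tendstoD(1)[OF unit_seq_lim]) auto
  then have "\<forall>\<^sub>F k in sequentially. 2 * pi * A r \<le> 4 / (1 - r) * d k * (2 * pi) powr (1 / p) + 2 * pi * B"
  proof eventually_elim
    case (elim k)
    define \<rho> where "\<rho> = unit_seq k"
    have \<rho>: "r < \<rho>" "1 / 2 \<le> \<rho>" "\<rho> < 1" "0 \<le> \<rho>" "(1 - r) / 2 \<le> \<rho> - r"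
      using elim rx unit_seq_bounds[of k] by (auto simp: \<rho>_def field_simps)
    define P where "P = poisson_kernel r \<rho>"
    have P: "0 \<le> P s" "P s \<le> 4 / (1 - r)" for s
    proof -
      show "0 \<le> P s" using poisson_kernel_pos[of r \<rho> s] rx \<rho> by (simp add: P_def)
      have "P s \<le> (\<rho> + r) / (\<rho> - r)" unfolding P_def using rx \<rho> by (intro poisson_kernel_le) auto
      also have "\<dots> \<le> 2 / ((1 - r) / 2)" using rx \<rho> by (intro frac_le) auto
      finally show "P s \<le> 4 / (1 - r)" by simp
    qed
    have cP: "continuous_on S (\<lambda>y. P (g y))" if "continuous_on S g" for S :: "'z::topological_space set" and g
      unfolding P_def using that rx \<rho> by (intro continuous_intros) auto
    define \<phi> where "\<phi> t s = P s * cmod (F (of_real \<rho> * cis (t + s)) - F (of_real r * cis t))" for t s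
    have c\<phi>: "continuous_on (S \<times> S') (\<lambda>(t, s). \<phi> t s)" for S S'
      unfolding \<phi>_def case_prod_unfold using rx \<rho>
      by (intro continuous_intros cP continuous_on_circle_compose[OF cF]) auto
    have d0: "0 \<le> d k"
      unfolding d_def \<rho>_def[symmetric] using \<rho>
      by (intro integral_nonneg circle_integrable[OF c\<Phi>] \<Phi>_nonneg) (auto simp: norm_mult)
    have pw: "2 * pi * \<Phi> (of_real r * cis t) \<le> 4 / (1 - r) * d k + integral {-pi..pi} (\<phi> t)" for t
    proof -
      define z where "z = of_real r * cis t"
      have ct: "continuous_on {-pi..pi} (\<lambda>s. \<Psi> (of_real \<rho> * cis (t + s)))"
        if "continuous_on (ball 0 1) \<Psi>" for \<Psi> :: "complex \<Rightarrow> 'w::topological_space"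
        using \<rho> by (intro continuous_on_circle_compose[OF that] continuous_intros) auto
      have cf: "continuous_on (ball 0 1) f" by (rule holomorphic_on_imp_continuous_on[OF hf])
      have int: "u integrable_on {-pi..pi}" if "continuous_on {-pi..pi} u" for u :: "real \<Rightarrow> real"
        using that by (rule integrable_continuous_interval)
      have F: "2 * pi * cmod (F z) = integral {-pi..pi} (\<lambda>s. P s * cmod (F z))"
        using integral_poisson_kernel[of r \<rho>] rx \<rho> by (simp add: P_def)
      have "2 * pi * \<Phi> z = 2 * pi * cmod (f z) - 2 * pi * cmod (F z)" by (simp add: \<Phi>_eq algebra_simps)
      also have "\<dots> \<le> integral {-pi..pi} (\<lambda>s. P s * cmod (f (of_real \<rho> * cis (t + s)))) - integral {-pi..pi} (\<lambda>s. P s * cmod (F z))"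
      proof -
        have "2 * pi * cmod (f z) \<le> integral {-pi..pi} (\<lambda>s. P s * cmod (f (of_real \<rho> * cis (t + s))))"
          unfolding P_def z_def using rx \<rho> by (intro poisson_submean[OF hf]) auto
        then show ?thesis using F by linarith
      qed
      also have "\<dots> = integral {-pi..pi} (\<lambda>s. P s * cmod (f (of_real \<rho> * cis (t + s))) - P s * cmod (F z))"
        by (intro integral_diff[symmetric] int continuous_intros cP ct[OF cf])
      also have "\<dots> \<le> integral {-pi..pi} (\<lambda>s. 4 / (1 - r) * \<Phi> (of_real \<rho> * cis (t + s)) + \<phi> t s)"
      proof (intro integral_le int continuous_intros cP ct[OF cf] ct[OF c\<Phi>])
        show "continuous_on {-pi..pi} (\<phi> t)"
          using continuous_on_slice(1)[OF c\<phi>[of UNIV "{-pi..pi}"], of t] by simp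
        fix s
        define y where "y = of_real \<rho> * cis (t + s)"
        have y: "y \<in> ball 0 1" using \<rho> by (simp add: y_def norm_mult)
        have "P s * cmod (f y) - P s * cmod (F z) = P s * \<Phi> y + P s * (cmod (F y) - cmod (F z))"
          by (simp add: \<Phi>_eq algebra_simps)
        also have "\<dots> \<le> 4 / (1 - r) * \<Phi> y + P s * cmod (F y - F z)"
          using P[of s] \<Phi>_nonneg[OF y] by (intro add_mono mult_right_mono mult_left_mono norm_triangle_ineq2) auto
        finally show "P s * cmod (f (of_real \<rho> * cis (t + s))) - P s * cmod (F z)
            \<le> 4 / (1 - r) * \<Phi> (of_real \<rho> * cis (t + s)) + \<phi> t s"
          by (simp add: \<phi>_def y_def z_def)
      qed
      also have "\<dots> = integral {-pi..pi} (\<lambda>s. 4 / (1 - r) * \<Phi> (of_real \<rho> * cis (t + s))) + integral {-pi..pi} (\<phi> t)"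
        using continuous_on_slice(1)[OF c\<phi>[of UNIV "{-pi..pi}"], of t]
        by (intro integral_add int continuous_intros ct[OF c\<Phi>]) auto
      also have "integral {-pi..pi} (\<lambda>s. 4 / (1 - r) * \<Phi> (of_real \<rho> * cis (t + s))) = 4 / (1 - r) * d k"
        using circle_integral_shift[OF c\<Phi>, of "of_real \<rho>" t] \<rho> by (simp add: d_def \<rho>_def)
      finally show ?thesis by (simp add: z_def)
    qed
    have c\<Phi>r: "continuous_on {0..2 * pi} (\<lambda>t. \<Phi> (of_real r * cis t))"
      using rx by (intro continuous_on_circle_compose[OF c\<Phi>] continuous_intros) auto
    have c\<phi>i: "continuous_on {0..2 * pi} (\<lambda>t. integral {-pi..pi} (\<phi> t))"
      using integral_continuous_on_param[of "{0..2 * pi}" "-pi" pi \<phi>] c\<phi> by simp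
    have \<phi>0: "0 \<le> \<phi> t s" for t s using P by (simp add: \<phi>_def)
    have \<phi>i0: "0 \<le> integral {-pi..pi} (\<phi> t)" for t
      using continuous_on_slice(1)[OF c\<phi>[of UNIV "{-pi..pi}"], of t] \<phi>0
      by (intro integral_nonneg integrable_continuous_interval) auto
    have rn: "0 \<le> \<Phi> (of_real r * cis t)" for t using rx by (intro \<Phi>_nonneg) (simp add: norm_mult)
    have "2 * pi * A r = cnorm p (\<lambda>t. 2 * pi * \<Phi> (of_real r * cis t))"
      unfolding A_def using p rn by (subst cnorm_cmult) auto
    also have "\<dots> \<le> cnorm p (\<lambda>t. 4 / (1 - r) * d k + integral {-pi..pi} (\<phi> t))"
      using p rn pw by (intro cnorm_mono continuous_intros c\<Phi>r c\<phi>i) auto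
    also have "\<dots> \<le> cnorm p (\<lambda>t. 4 / (1 - r) * d k) + cnorm p (\<lambda>t. integral {-pi..pi} (\<phi> t))"
      using p \<phi>i0 d0 rx by (intro cnorm_add_le continuous_intros c\<phi>i) auto
    also have "cnorm p (\<lambda>t. 4 / (1 - r) * d k) = 4 / (1 - r) * d k * (2 * pi) powr (1 / p)"
      using p d0 rx by (subst cnorm_const) auto
    also have "cnorm p (\<lambda>t. integral {-pi..pi} (\<phi> t)) \<le> integral {-pi..pi} (\<lambda>s. cnorm p (\<lambda>t. \<phi> t s))"
      using p \<phi>0 by (intro cnorm_integral_le c\<phi>) auto
    also have "\<dots> = integral {-pi..pi} (\<lambda>s. P s * circle_dist p F (cis s * of_real \<rho>) (of_real r))"
    proof (rule integral_cong)
      fix s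
      \<comment> \<open>Regrouping makes \<open>cis s * of_real \<rho>\<close> the complex dilation
        parameter of \<open>circle_dist\<close>.\<close>
      have eq: "of_real \<rho> * cis (t + s) = cis s * of_real \<rho> * cis t" for t
        by (simp add: cis_mult[symmetric])
      show "cnorm p (\<lambda>t. \<phi> t s) = P s * circle_dist p F (cis s * of_real \<rho>) (of_real r)"
        unfolding \<phi>_def circle_dist_def eq using p P by (subst cnorm_cmult) auto
    qed
    also have "\<dots> \<le> 2 * pi * B"
      unfolding B_def P_def using poisson_average_le[OF r] \<rho> by simp
    finally show ?case by simp
  qed
  moreover have "(\<lambda>k. 4 / (1 - r) * d k * (2 * pi) powr (1 / p) + 2 * pi * B)
      \<longlonglongrightarrow> 4 / (1 - r) * 0 * (2 * pi) powr (1 / p) + 2 * pi * B"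
    by (intro tendsto_intros d)
  ultimately have "2 * pi * A r \<le> 4 / (1 - r) * 0 * (2 * pi) powr (1 / p) + 2 * pi * B"
    by (intro tendsto_lowerbound[where F = sequentially]) auto
  then have "A r \<le> B" by simp
  then show ?thesis by (simp add: B_def)
qed

text \<open>Since \<open>1 - r\<close> exceeds \<open>1 / K ^ Suc n\<close>, the division cancels
  the decay in \<open>A_le\<close> and leaves one more factor \<open>K\<close>. The index
  \<open>Suc n\<close> is the one in the hypothesis on \<open>G\<close> in
  \<open>weighted_hardy\<close>.\<close>

lemma A_quotient_le:
  assumes r: "r \<in> level K n"
  shows "A r / (1 - r) \<le> 24 * pi\<^sup>2 * K ^ 3 * W (Suc n)"
proof -
  have "r < 1 - 1 / K ^ Suc n" using r by (simp add: level_def)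
  then have r1: "1 / K ^ Suc n \<le> 1 - r" "0 < 1 / K ^ Suc n" using K by auto
  have "A r / (1 - r) \<le> (24 * pi\<^sup>2 * K\<^sup>2 / K ^ n * W (Suc n)) / (1 / K ^ Suc n)"
  proof (rule frac_le)
    have "A r \<le> 24 * pi\<^sup>2 * K\<^sup>2 / K ^ n * W n" by (rule A_le[OF r])
    also have "\<dots> \<le> 24 * pi\<^sup>2 * K\<^sup>2 / K ^ n * W (Suc n)"
      using K W_mono[of n "Suc n"] by (intro mult_left_mono) auto
    finally show "A r \<le> 24 * pi\<^sup>2 * K\<^sup>2 / K ^ n * W (Suc n)" .
    show "0 \<le> 24 * pi\<^sup>2 * K\<^sup>2 / K ^ n * W (Suc n)" using K W_nonneg by simp
  qed (use r1 in auto)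
  also have "\<dots> = 24 * pi\<^sup>2 * K ^ 3 * W (Suc n)"
    using K by (simp add: power2_eq_square power3_eq_cube)
  finally show ?thesis .
qed

text \<open>Take norms in \<open>deriv_factor_le\<close>; Minkowski's inequality leaves, for each
  \<open>\<theta>\<close>, the quantity \<open>A\<close> at radius \<open>cmod (c \<theta>)\<close>.
  This radius lies between \<open>r - R\<close> and \<open>r + R\<close>, hence at most one annulus
  beyond that of \<open>r\<close>, which is the origin of \<open>Suc n\<close>. There
  \<open>A\<close> has the decay \<open>1 / K ^ n\<close>, and this cancels against
  \<open>1 / R\<close>.\<close>

lemma deriv_norm_le:
  assumes r: "r \<in> level K n"
  shows "cnorm p (\<lambda>t. cmod (deriv f (of_real r * cis t))) \<le> (1 + 192 * pi\<^sup>2 * K ^ 5) * W (Suc n)"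
proof -
  have rx: "x n \<le> r" "r < 1" "0 \<le> r" "r < x (Suc n)" using r level_bounds[of K r n] K by (auto simp: level_def x_def)
  define R where "R = (1 - r) / 2"
  have R: "0 < R" "r + R < 1" using rx by (auto simp: R_def field_simps)
  define c where "c \<theta> = of_real r + of_real R * cis \<theta>" for \<theta>
  have c1: "cmod (c \<theta>) \<le> r + R" for \<theta>
    using norm_triangle_ineq[of "of_real r :: complex" "of_real R * cis \<theta>"] rx R by (simp add: c_def norm_mult)
  have c2: "r - R \<le> cmod (c \<theta>)" for \<theta>
    using norm_triangle_ineq2[of "of_real r :: complex" "- of_real R * cis \<theta>"] rx R by (simp add: c_def norm_mult)
  define \<phi> where "\<phi> t \<theta> = 2 / (pi * R) * \<Phi> (c \<theta> * cis t)" for t \<theta>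
  have inb: "cmod (c \<theta>) < 1" for \<theta> using c1[of \<theta>] R by simp
  have c\<phi>: "continuous_on (S \<times> S') (\<lambda>(t, \<theta>). \<phi> t \<theta>)" for S S'
    unfolding \<phi>_def case_prod_unfold
    by (intro continuous_intros continuous_on_compose2[OF c\<Phi>])
       (use inb in \<open>auto simp: c_def norm_mult intro!: continuous_intros\<close>)
  have \<phi>0: "0 \<le> \<phi> t \<theta>" for t \<theta>
    unfolding \<phi>_def using inb[of \<theta>] R by (intro mult_nonneg_nonneg \<Phi>_nonneg) (auto simp: norm_mult)
  have \<phi>i0: "0 \<le> integral {0..2 * pi} (\<phi> t)" for t
    using continuous_on_slice(1)[OF c\<phi>[of UNIV "{0..2 * pi}"], of t] \<phi>0
    by (intro integral_nonneg integrable_continuous_interval) auto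
  have c\<phi>i: "continuous_on {0..2 * pi} (\<lambda>t. integral {0..2 * pi} (\<phi> t))"
    using integral_continuous_on_param[of "{0..2 * pi}" 0 "2 * pi" \<phi>] c\<phi> by simp
  have hf': "deriv f holomorphic_on ball 0 1" by (intro holomorphic_deriv hf) auto
  have cd: "continuous_on {0..2 * pi} (\<lambda>t. deriv f (of_real r * cis t))" "continuous_on {0..2 * pi} (\<lambda>t. deriv F (of_real r * cis t))"
    using rx by (auto intro!: continuous_on_circle_compose[OF holomorphic_on_imp_continuous_on[OF hf']]
        continuous_on_circle_compose[OF holomorphic_on_imp_continuous_on[OF hF']] continuous_intros)
  have "cnorm p (\<lambda>t. cmod (deriv f (of_real r * cis t)))
      \<le> cnorm p (\<lambda>t. cmod (deriv F (of_real r * cis t)) + integral {0..2 * pi} (\<phi> t))"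
  proof (intro cnorm_mono continuous_intros cd c\<phi>i)
    show "cmod (deriv f (of_real r * cis t)) \<le> cmod (deriv F (of_real r * cis t)) + integral {0..2 * pi} (\<phi> t)" for t
      using deriv_factor_le[OF hf hI I1 rx(3,2), of t]
      by (simp add: F_def \<phi>_def[abs_def] \<Phi>_def c_def R_def)
  qed (use p in auto)
  also have "\<dots> \<le> cnorm p (\<lambda>t. cmod (deriv F (of_real r * cis t))) + cnorm p (\<lambda>t. integral {0..2 * pi} (\<phi> t))"
    using p \<phi>i0 by (intro cnorm_add_le continuous_intros cd c\<phi>i) auto
  also have "cnorm p (\<lambda>t. cmod (deriv F (of_real r * cis t))) \<le> H (Suc n)"
    unfolding H_x using rx x_bounds[of "Suc n"] p by (intro cnorm_holomorphic_mono[OF hF']) auto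
  also have "H (Suc n) \<le> W (Suc n)"
  proof -
    have "H (Suc n) \<le> tail_mean K H n" using H_le_E[of n] K by (simp add: E_def divide_le_cancel)
    also have "\<dots> \<le> W (Suc n)" unfolding W_def using tail_mean_nonneg' by (intro member_le_sum) auto
    finally show ?thesis .
  qed
  also have "cnorm p (\<lambda>t. integral {0..2 * pi} (\<phi> t)) \<le> integral {0..2 * pi} (\<lambda>\<theta>. cnorm p (\<lambda>t. \<phi> t \<theta>))"
    using p \<phi>0 by (intro cnorm_integral_le c\<phi>) auto
  also have "\<dots> \<le> integral {0..2 * pi} (\<lambda>\<theta>::real. 2 / (pi * R) * (24 * pi\<^sup>2 * K ^ 4 / K ^ n * W (Suc n)))"
  proof (rule integral_le)
    show "(\<lambda>\<theta>. cnorm p (\<lambda>t. \<phi> t \<theta>)) integrable_on {0..2 * pi}"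
      using p \<phi>0 by (intro integrable_continuous_interval continuous_on_cnorm c\<phi>) auto
    fix \<theta> :: real
    define y where "y = cmod (c \<theta>)"
    have y: "0 \<le> y" "y < 1" "r - R \<le> y" "y \<le> r + R" using inb c1 c2 by (auto simp: y_def)
    obtain m where m: "y \<in> level K m" using level_cover[of K y] K y by auto
    have my: "1 - 1 / K ^ m \<le> y" "y < 1 - 1 / K ^ Suc m" using m by (auto simp: level_def)
    have rd: "1 - r \<le> 1 / K ^ n" "1 / K ^ Suc n < 1 - r" using rx by (auto simp: x_def)
    \<comment> \<open>\<open>1 - y\<close> is at least \<open>(1 - r) / 2\<close>, and by
      \<open>2 \<le> K\<close> this is more than \<open>1 / K ^ Suc (Suc n)\<close>.\<close>
    have "m \<le> Suc n"
    proof (rule ccontr)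
      assume "\<not> m \<le> Suc n"
      then have "1 / K ^ m \<le> 1 / K ^ Suc (Suc n)" using K by (intro divide_left_mono power_increasing) auto
      also have "\<dots> \<le> (1 / K ^ Suc n) / 2" using K by (simp add: field_simps)
      also have "\<dots> < (1 - r) / 2" using rd by simp
      also have "\<dots> \<le> 1 - y" using y by (simp add: R_def field_simps)
      finally show False using my by simp
    qed
    \<comment> \<open>Nor is \<open>y\<close> far inside: \<open>1 - y\<close> is at most
      \<open>3 / 2 * (1 - r)\<close>, so \<open>1 / K ^ m\<close> exceeds \<open>1 / K ^ n\<close>
      by at most the factor \<open>K\<^sup>2\<close>.\<close>
    have "1 / K ^ m = K * (1 / K ^ Suc m)" using K by simp
    also have "\<dots> \<le> K * (1 - y)" using my K by (intro mult_left_mono) auto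
    also have "\<dots> \<le> K * (K * (1 / K ^ n))"
    proof (intro mult_left_mono)
      have "1 - y \<le> 2 * (1 - r)" using y rx by (simp add: R_def field_simps)
      also have "\<dots> \<le> K * (1 / K ^ n)" using K rd rx by (intro mult_mono) auto
      finally show "1 - y \<le> K * (1 / K ^ n)" .
    qed (use K in auto)
    finally have Km: "1 / K ^ m \<le> K\<^sup>2 / K ^ n" by (simp add: power2_eq_square)
    have "A y \<le> 24 * pi\<^sup>2 * K\<^sup>2 / K ^ m * W m" by (rule A_le[OF m])
    also have "\<dots> = 24 * pi\<^sup>2 * K\<^sup>2 * (1 / K ^ m) * W m" by simp
    also have "\<dots> \<le> 24 * pi\<^sup>2 * K\<^sup>2 * (K\<^sup>2 / K ^ n) * W (Suc n)"
      using Km W_mono[OF \<open>m \<le> Suc n\<close>] W_nonneg K by (intro mult_mono) auto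
    also have "\<dots> = 24 * pi\<^sup>2 * K ^ 4 / K ^ n * W (Suc n)" by (simp flip: power_add)
    finally have Ay: "A y \<le> 24 * pi\<^sup>2 * K ^ 4 / K ^ n * W (Suc n)" .
    have "cnorm p (\<lambda>t. \<phi> t \<theta>) = 2 / (pi * R) * cnorm p (\<lambda>t. \<Phi> (c \<theta> * cis t))"
      unfolding \<phi>_def using p R inb[of \<theta>] by (intro cnorm_cmult \<Phi>_nonneg) (auto simp: norm_mult)
    also have "cnorm p (\<lambda>t. \<Phi> (c \<theta> * cis t)) = A y"
      unfolding A_def y_def using p inb \<Phi>_nonneg by (intro cnorm_rotate[OF c\<Phi>]) auto
    also have "2 / (pi * R) * A y \<le> 2 / (pi * R) * (24 * pi\<^sup>2 * K ^ 4 / K ^ n * W (Suc n))"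
      using R by (intro mult_left_mono Ay) auto
    finally show "cnorm p (\<lambda>t. \<phi> t \<theta>) \<le> 2 / (pi * R) * (24 * pi\<^sup>2 * K ^ 4 / K ^ n * W (Suc n))" .
  qed (auto intro: integrable_continuous_interval)
  \<comment> \<open>96 is 24 times \<open>2 / pi\<close> times the length \<open>2 * pi\<close> of
    the interval; the bound \<open>2 * K\<close> for \<open>1 / K ^ n / R\<close> then doubles
    it.\<close>
  also have "\<dots> = 96 * pi\<^sup>2 * K ^ 4 * W (Suc n) * (1 / K ^ n / R)"
    using R by (simp add: mult_ac)
  also have "\<dots> \<le> 96 * pi\<^sup>2 * K ^ 4 * W (Suc n) * (2 * K)"
  proof (intro mult_left_mono)
    have "1 / K ^ Suc n < 1 - r" using rx by (simp add: x_def)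
    then show "1 / K ^ n / R \<le> 2 * K" using K R by (simp add: R_def field_simps)
  qed (use K W_nonneg in auto)
  also have "\<dots> = 192 * pi\<^sup>2 * K ^ 5 * W (Suc n)" by (simp add: eval_nat_numeral)
  finally show ?thesis by (simp add: algebra_simps)
qed

end

section \<open>The Besov space\<close>

lemma set_lint_eq_integral:
  fixes u :: "real \<Rightarrow> real"
  shows "continuous_on {a..b} u \<Longrightarrow> (LINT t:{a..b}|lebesgue. u t) = integral {a..b} u"
  by (intro set_lebesgue_integral_eq_integral(2) absolutely_integrable_continuous_real)

lemma cnorm_eq_set_lint:
  assumes "0 < p" "continuous_on {0..2 * pi} u" "\<And>t. t \<in> {0..2 * pi} \<Longrightarrow> 0 \<le> u t"
  shows "cnorm p u = (LINT t:{0..2 * pi}|lebesgue. u t powr p) powr (1 / p)"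
  unfolding cnorm_def using assms by (subst set_lint_eq_integral) (auto intro: continuous_on_powr_const)

lemma integral_mean_eq:
  assumes "continuous_on (ball 0 1) g" "0 \<le> r" "r < 1" "0 < p"
  shows "integral_mean p r g = (1 / (2 * pi)) powr (1 / p) * cnorm p (\<lambda>t. cmod (g (of_real r * cis t)))"
proof -
  have c: "continuous_on {0..2 * pi} (\<lambda>t. cmod (g (of_real r * cis t)))"
    using assms by (intro continuous_intros continuous_on_circle_compose[OF assms(1)]) auto
  have "integral_mean p r g = (1 / (2 * pi) * integral {0..2 * pi} (\<lambda>t. cmod (g (of_real r * cis t)) powr p)) powr (1 / p)"
    unfolding integral_mean_def using assms c
    by (subst set_lint_eq_integral) (auto intro: continuous_on_powr_const)
  also have "\<dots> = (1 / (2 * pi)) powr (1 / p) * integral {0..2 * pi} (\<lambda>t. cmod (g (of_real r * cis t)) powr p) powr (1 / p)"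
    by (rule powr_mult)
  finally show ?thesis by (simp add: cnorm_def)
qed

lemma hardy_space_mean_bound:
  assumes "f \<in> hardy_space p"
  shows "\<exists>M. \<forall>r. 0 \<le> r \<longrightarrow> r < 1 \<longrightarrow> integral_mean p r f \<le> M"
proof (intro exI allI impI)
  fix r :: real assume "0 \<le> r" "r < 1"
  then show "integral_mean p r f \<le> (SUP r\<in>{0..<1}. integral_mean p r f)"
    using assms by (intro cSUP_upper) (auto simp: hardy_space_def)
qed

text \<open>Means of order \<open>p\<close> control those of order 1 through
  \<open>y \<le> 1 + y powr p\<close>, which serves in place of Hoelder's inequality.\<close>

lemma hardy_space_integral_bound:
  assumes f: "f \<in> hardy_space p" and p: "1 \<le> p"
  shows "\<exists>L. \<forall>r. 0 \<le> r \<longrightarrow> r < 1 \<longrightarrow> integral {0..2 * pi} (\<lambda>t. cmod (f (of_real r * cis t))) \<le> L"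
proof -
  have hol: "f holomorphic_on ball 0 1" using f by (simp add: hardy_space_def)
  then have cf: "continuous_on (ball 0 1) f" by (rule holomorphic_on_imp_continuous_on)
  obtain M where M: "\<And>r. 0 \<le> r \<Longrightarrow> r < 1 \<Longrightarrow> integral_mean p r f \<le> M"
    using hardy_space_mean_bound[OF f] by blast
  define \<kappa> where "\<kappa> = (1 / (2 * pi)) powr (1 / p)"
  have \<kappa>: "0 < \<kappa>" by (simp add: \<kappa>_def)
  have "integral {0..2 * pi} (\<lambda>t. cmod (f (of_real r * cis t))) \<le> 2 * pi + (\<bar>M\<bar> / \<kappa>) powr p"
    if r: "0 \<le> r" "r < 1" for r
  proof -
    have c: "continuous_on {0..2 * pi} (\<lambda>t. cmod (f (of_real r * cis t)))"
      using r by (intro continuous_intros continuous_on_circle_compose[OF cf]) auto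
    have "\<kappa> * cnorm p (\<lambda>t. cmod (f (of_real r * cis t))) \<le> \<bar>M\<bar>"
      using M[OF r] integral_mean_eq[OF cf r, of p] p by (simp add: \<kappa>_def)
    then have "cnorm p (\<lambda>t. cmod (f (of_real r * cis t))) \<le> \<bar>M\<bar> / \<kappa>" using \<kappa> by (simp add: field_simps)
    then have le: "integral {0..2 * pi} (\<lambda>t. cmod (f (of_real r * cis t)) powr p) \<le> (\<bar>M\<bar> / \<kappa>) powr p"
      using p \<kappa> by (subst (asm) cnorm_le_iff) auto
    have int: "(\<lambda>t. cmod (f (of_real r * cis t)) powr p) integrable_on {0..2 * pi}"
      using p c by (intro powr_integrable_circle) auto
    have "y \<le> 1 + y powr p" if "0 \<le> y" for y :: real
    proof (cases "y \<le> 1")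
      case False
      then have "y powr 1 \<le> y powr p" using p by (intro powr_mono) auto
      then show ?thesis using False by simp
    qed (simp add: add_increasing2)
    then have "integral {0..2 * pi} (\<lambda>t. cmod (f (of_real r * cis t)))
        \<le> integral {0..2 * pi} (\<lambda>t. 1 + cmod (f (of_real r * cis t)) powr p)"
      by (intro integral_le integrable_continuous_interval[OF c] integrable_add int) auto
    also have "\<dots> = 2 * pi + integral {0..2 * pi} (\<lambda>t. cmod (f (of_real r * cis t)) powr p)"
      by (subst integral_add) (auto intro: int)
    finally show ?thesis using le by simp
  qed
  then show ?thesis by blast
qed

lemma continuous_on_radial_cnorm:
  assumes p: "0 < p" and \<Phi>: "continuous_on (ball 0 1) \<Phi>" "\<And>z. z \<in> ball 0 1 \<Longrightarrow> 0 \<le> \<Phi> z"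
  shows "continuous_on {0..<1} (\<lambda>r. cnorm p (\<lambda>t. \<Phi> (of_real r * cis t)))"
proof (unfold continuous_on_eq_continuous_within, rule ballI)
  fix r :: real assume r: "r \<in> {0..<1}"
  \<comment> \<open>Continuity at \<open>r\<close> is local, so the compact interval up to
    \<open>b\<close> suffices.\<close>
  define b where "b = (1 + r) / 2"
  have b: "r < b" "b < 1" using r by (auto simp: b_def)
  have "continuous_on {0..b} (\<lambda>r. cnorm p (\<lambda>t. \<Phi> (of_real r * cis t)))"
  proof (rule continuous_on_cnorm[OF p])
    show "continuous_on ({0..2 * pi} \<times> {0..b}) (\<lambda>(t, r). \<Phi> (of_real r * cis t))"
      unfolding case_prod_unfold using b
      by (intro continuous_on_compose2[OF \<Phi>(1)]) (auto simp: norm_mult intro!: continuous_intros)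
  qed (use b \<Phi>(2) in \<open>auto simp: norm_mult\<close>)
  then have "continuous (at r within {0..b}) (\<lambda>r. cnorm p (\<lambda>t. \<Phi> (of_real r * cis t)))"
    using r b by (simp add: continuous_on_eq_continuous_within)
  moreover have "at r within {0..b} = at r within {0..<1}"
    using r b by (intro at_within_nhd[of _ "{..<b}"]) auto
  ultimately show "continuous (at r within {0..<1}) (\<lambda>r. cnorm p (\<lambda>t. \<Phi> (of_real r * cis t)))" by simp
qed

text \<open>Additivity comes from the measure of the minorant and requires measurable functions,
  hence the continuity of \<open>X\<close> and \<open>Y\<close>; \<open>Z\<close> is merely
  dominated. The inequality \<open>(a + b) powr q \<le> (2 * a) powr q + (2 * b) powr q\<close> for
  nonnegative \<open>a\<close> and \<open>b\<close> holds for all \<open>q > 0\<close>.\<close>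

lemma weighted_sum_finite:
  assumes \<nu>: "\<And>s. 0 \<le> s \<Longrightarrow> s < 1 \<Longrightarrow> 0 \<le> \<nu> (complex_of_real s)" and q: "0 < q" and c: "0 \<le> c"
    and X: "continuous_on {0..<1} X" "\<And>s. 0 \<le> s \<Longrightarrow> s < 1 \<Longrightarrow> 0 \<le> X s"
      "(\<integral>\<^sup>+ s\<in>{0..<1}. ennreal (X s powr q * \<nu> (of_real s)) \<partial>lebesgue) < \<infinity>"
    and Y: "continuous_on {0..<1} Y" "\<And>s. 0 \<le> s \<Longrightarrow> s < 1 \<Longrightarrow> 0 \<le> Y s"
      "(\<integral>\<^sup>+ s\<in>{0..<1}. ennreal (Y s powr q * \<nu> (of_real s)) \<partial>lebesgue) < \<infinity>"
    and Z: "\<And>s. 0 \<le> s \<Longrightarrow> s < 1 \<Longrightarrow> 0 \<le> Z s" "\<And>s. 0 \<le> s \<Longrightarrow> s < 1 \<Longrightarrow> Z s \<le> X s + c * Y s"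
  shows "(\<integral>\<^sup>+ s\<in>{0..<1}. ennreal (Z s powr q * \<nu> (of_real s)) \<partial>lebesgue) < \<infinity>"
proof -
  define u where "u s = ennreal (\<nu> (of_real s)) * indicator {0..<1} s" for s :: real
  have "u s < \<infinity>" for s by (simp add: u_def ennreal_mult_less_top indicator_def)
  then obtain \<mu> where \<mu>: "sets \<mu> = sets lebesgue" "\<forall>a\<in>borel_measurable lebesgue. (\<forall>x. a x < \<infinity>) \<longrightarrow>
      (\<integral>\<^sup>+ x. a x * u x \<partial>lebesgue) = (\<integral>\<^sup>+ x. a x \<partial>\<mu>)"
    using lebesgue_minorant_measure[of u] by blast
  define pw where "pw V s = ennreal (V s powr q) * indicator {0..<1} s" for V :: "real \<Rightarrow> real" and s :: real
  have pw_meas: "pw V \<in> borel_measurable lebesgue"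
    if V: "continuous_on {0..<1} V" "\<And>s. 0 \<le> s \<Longrightarrow> s < 1 \<Longrightarrow> 0 \<le> V s" for V
  proof -
    have "continuous_on {0..<1} (\<lambda>s. V s powr q)" using V q by (intro continuous_on_powr_const) auto
    then have "(\<lambda>s. indicator {0..<1} s *\<^sub>R (V s powr q)) \<in> borel_measurable borel"
      by (intro borel_measurable_continuous_on_indicator) auto
    then have "(\<lambda>s. ennreal (indicator {0..<1} s *\<^sub>R (V s powr q))) \<in> borel_measurable lebesgue"
      by (intro measurable_compose[OF _ measurable_ennreal] measurable_completion) simp
    moreover have "(\<lambda>s. ennreal (indicator {0..<1} s *\<^sub>R (V s powr q))) = pw V"
      by (auto simp: pw_def indicator_def fun_eq_iff)
    ultimately show ?thesis by metis
  qed
  have pw_fin: "pw V s < \<infinity>" for V s by (simp add: pw_def ennreal_mult_less_top indicator_def)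
  have pw_int: "(\<integral>\<^sup>+ s\<in>{0..<1}. ennreal (V s powr q * \<nu> (of_real s)) \<partial>lebesgue) = (\<integral>\<^sup>+ s. pw V s * u s \<partial>lebesgue)" for V
    using \<nu> by (intro nn_integral_cong) (auto simp: pw_def u_def indicator_def ennreal_mult')
  define c1 c2 where "c1 = 2 powr q" and "c2 = (2 * c) powr q"
  define a where "a s = ennreal c1 * pw X s + ennreal c2 * pw Y s" for s
  have a: "a \<in> borel_measurable lebesgue"
    unfolding a_def by (intro borel_measurable_add borel_measurable_times_ennreal borel_measurable_const pw_meas X Y)
  have a_fin: "a s < \<infinity>" for s
    using pw_fin[of X s] pw_fin[of Y s] by (simp add: a_def ennreal_mult_less_top)
  have "(\<integral>\<^sup>+ s\<in>{0..<1}. ennreal (Z s powr q * \<nu> (of_real s)) \<partial>lebesgue) = (\<integral>\<^sup>+ s. pw Z s * u s \<partial>lebesgue)" by (rule pw_int)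
  also have "\<dots> \<le> (\<integral>\<^sup>+ s. a s * u s \<partial>lebesgue)"
  proof (intro nn_integral_mono mult_right_mono)
    fix s
    show "pw Z s \<le> a s"
    proof (cases "0 \<le> s \<and> s < 1")
      case True
      have "Z s powr q \<le> (X s + c * Y s) powr q" using Z True q by (intro powr_mono2) auto
      also have "\<dots> \<le> (2 * X s) powr q + ((2 * c) * Y s) powr q"
      proof (cases "c * Y s \<le> X s")
        case True
        then have "(X s + c * Y s) powr q \<le> (2 * X s) powr q"
          using X(2)[of s] Y(2)[of s] c \<open>0 \<le> s \<and> s < 1\<close> q by (intro powr_mono2) auto
        then show ?thesis by (simp add: add_increasing2)
      next
        case False
        then have "(X s + c * Y s) powr q \<le> ((2 * c) * Y s) powr q"
          using X(2)[of s] Y(2)[of s] c \<open>0 \<le> s \<and> s < 1\<close> q by (intro powr_mono2) auto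
        then show ?thesis by (simp add: add_increasing)
      qed
      also have "\<dots> = c1 * X s powr q + c2 * Y s powr q"
        using X(2)[of s] Y(2)[of s] c True by (simp add: c1_def c2_def powr_mult)
      finally have "ennreal (Z s powr q) \<le> ennreal (c1 * X s powr q + c2 * Y s powr q)" by (rule ennreal_leI)
      also have "\<dots> = ennreal c1 * ennreal (X s powr q) + ennreal c2 * ennreal (Y s powr q)"
        by (simp add: c1_def c2_def ennreal_plus ennreal_mult)
      finally show ?thesis using True by (simp add: pw_def a_def)
    qed (auto simp: pw_def indicator_def)
  qed simp
  also have "\<dots> = (\<integral>\<^sup>+ s. a s \<partial>\<mu>)" using \<mu>(2) a a_fin by blast
  also have "\<dots> = ennreal c1 * (\<integral>\<^sup>+ s. pw X s \<partial>\<mu>) + ennreal c2 * (\<integral>\<^sup>+ s. pw Y s \<partial>\<mu>)"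
  proof -
    have m: "pw X \<in> borel_measurable \<mu>" "pw Y \<in> borel_measurable \<mu>"
      using pw_meas[OF X(1,2)] pw_meas[OF Y(1,2)] by (simp_all cong: measurable_cong_sets add: \<mu>(1))
    then show ?thesis unfolding a_def by (simp add: nn_integral_add nn_integral_cmult)
  qed
  also have "(\<integral>\<^sup>+ s. pw X s \<partial>\<mu>) = (\<integral>\<^sup>+ s. pw X s * u s \<partial>lebesgue)"
    using \<mu>(2) pw_meas[OF X(1,2)] pw_fin[of X] by simp
  also have "(\<integral>\<^sup>+ s. pw Y s \<partial>\<mu>) = (\<integral>\<^sup>+ s. pw Y s * u s \<partial>lebesgue)"
    using \<mu>(2) pw_meas[OF Y(1,2)] pw_fin[of Y] by simp
  also have "ennreal c1 * (\<integral>\<^sup>+ s. pw X s * u s \<partial>lebesgue) + ennreal c2 * (\<integral>\<^sup>+ s. pw Y s * u s \<partial>lebesgue) < \<infinity>"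
    using X(3) Y(3) unfolding pw_int by (simp add: ennreal_mult_less_top)
  finally show ?thesis .
qed

lemma deriv_mult_inner_le:
  assumes hf: "f holomorphic_on ball 0 1" and hI: "I holomorphic_on ball 0 1"
    and I1: "\<And>z. cmod z < 1 \<Longrightarrow> cmod (I z) \<le> 1" and z: "cmod z < 1"
  shows "cmod (deriv (\<lambda>z. f z * I z) z) \<le> cmod (deriv f z) + 2 * (cmod (f z) * (1 - cmod (I z)) / (1 - cmod z))"
proof -
  have d: "(f has_field_derivative deriv f z) (at z)" "(I has_field_derivative deriv I z) (at z)"
    using z by (auto intro!: holomorphic_derivI[of _ "ball 0 1"] hf hI)
  have "((\<lambda>z. f z * I z) has_field_derivative deriv f z * I z + f z * deriv I z) (at z)"
    by (auto intro!: derivative_eq_intros d)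
  then have "deriv (\<lambda>z. f z * I z) z = deriv f z * I z + f z * deriv I z" by (rule DERIV_imp_deriv)
  then have "cmod (deriv (\<lambda>z. f z * I z) z) \<le> cmod (deriv f z) * cmod (I z) + cmod (f z) * cmod (deriv I z)"
    using norm_triangle_ineq[of "deriv f z * I z" "f z * deriv I z"] by (simp add: norm_mult)
  also have "cmod (deriv f z) * cmod (I z) \<le> cmod (deriv f z)" using I1[OF z] by (simp add: mult_left_le)
  also have "cmod (f z) * cmod (deriv I z) \<le> cmod (f z) * (2 * (1 - cmod (I z)) / (1 - cmod z))"
  proof (intro mult_left_mono)
    have "cmod (deriv I z) * (1 - cmod z) \<le> cmod (deriv I z) * (1 - (cmod z)\<^sup>2)"
      using z by (intro mult_left_mono) (auto simp: power2_eq_square mult_left_le)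
    also have "\<dots> \<le> 1 - (cmod (I z))\<^sup>2" by (rule schwarz_pick_deriv[OF hI I1 z])
    also have "\<dots> \<le> 2 * (1 - cmod (I z))"
      using zero_le_power2[of "1 - cmod (I z)"] by (simp add: power2_eq_square algebra_simps)
    finally show "cmod (deriv I z) \<le> 2 * (1 - cmod (I z)) / (1 - cmod z)" using z by (simp add: field_simps)
  qed simp
  also have "cmod (f z) * (2 * (1 - cmod (I z)) / (1 - cmod z)) = 2 * (cmod (f z) * (1 - cmod (I z)) / (1 - cmod z))"
    by (simp only: times_divide_eq_right mult.left_commute)
  finally show ?thesis by simp
qed

theorem theorem7:
  fixes p q :: real and \<nu> :: "complex \<Rightarrow> real" and f I :: "complex \<Rightarrow> complex"
  assumes "1 \<le> p" and "0 < q"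
    and "\<nu> \<in> D_class \<inter> D_hat_q q"
    and "f \<in> hardy_space p"
    and "inner_function I"
  shows "(\<lambda>z. f z * I z) \<in> besov_space p q \<nu> \<longleftrightarrow>
     f \<in> besov_space p q \<nu> \<and>
     (\<integral>\<^sup>+ r\<in>{0..<1}.
        ennreal ((LINT t:{0..2 * pi}|lebesgue.
            (cmod (f (of_real r * cis t)) * (1 - cmod (I (of_real r * cis t))) / (1 - r)) powr p)
          powr (q / p) * \<nu> (of_real r)) \<partial>lebesgue) < \<infinity>"
proof -
  note p = assms(1) and q = assms(2)
  define F where "F = (\<lambda>z. f z * I z)"
  define \<Phi> where "\<Phi> z = cmod (f z) * (1 - cmod (I z))" for z
  define Y where "Y r = cnorm p (\<lambda>t. \<Phi> (of_real r * cis t)) / (1 - r)" for r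
  define \<kappa> where "\<kappa> = (1 / (2 * pi)) powr (1 / p)"
  have \<kappa>: "0 < \<kappa>" by (simp add: \<kappa>_def)
  have hf: "f holomorphic_on ball 0 1" using assms(4) by (simp add: hardy_space_def)
  have hI: "I holomorphic_on ball 0 1" by (rule inner_function_holomorphic[OF assms(5)])
  have I1: "cmod (I z) \<le> 1" if "cmod z < 1" for z using inner_function_le_1[OF assms(5) that] .
  have hF: "F holomorphic_on ball 0 1" unfolding F_def by (intro holomorphic_intros hf hI)
  have hf': "deriv f holomorphic_on ball 0 1" and hF': "deriv F holomorphic_on ball 0 1"
    by (auto intro!: holomorphic_deriv hf hF)
  have cf: "continuous_on (ball 0 1) f" and cI: "continuous_on (ball 0 1) I" and cF: "continuous_on (ball 0 1) F"
    and cf': "continuous_on (ball 0 1) (deriv f)" and cF': "continuous_on (ball 0 1) (deriv F)"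
    using hf hI hF hf' hF' by (auto intro: holomorphic_on_imp_continuous_on)
  have c\<Phi>: "continuous_on (ball 0 1) \<Phi>" unfolding \<Phi>_def by (intro continuous_intros cf cI)
  have \<Phi>0: "0 \<le> \<Phi> z" if "z \<in> ball 0 1" for z using I1[of z] that by (simp add: \<Phi>_def)
  have w: "weight \<nu>" using assms(3) unfolding D_class_def D_hat_def by blast
  have \<nu>0: "0 \<le> \<nu> (of_real s)" if "0 \<le> s" "s < 1" for s
  proof -
    have "complex_of_real s \<in> ball 0 1" using that by simp
    then show ?thesis using w unfolding weight_def by blast
  qed
  \<comment> \<open>The exponent \<open>q / p\<close> is \<open>1 / p\<close> followed by
    \<open>q\<close>, so the integral condition becomes a weighted integral of
    \<open>Y r powr q\<close>.\<close>
  have Y_eq: "(LINT t:{0..2 * pi}|lebesgue.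
      (cmod (f (of_real r * cis t)) * (1 - cmod (I (of_real r * cis t))) / (1 - r)) powr p) powr (q / p) = Y r powr q"
    if r: "0 \<le> r" "r < 1" for r
  proof -
    have c: "continuous_on {0..2 * pi} (\<lambda>t. 1 / (1 - r) * \<Phi> (of_real r * cis t))"
      using r by (intro continuous_intros continuous_on_circle_compose[OF c\<Phi>]) auto
    have 0: "0 \<le> \<Phi> (of_real r * cis t)" for t using r by (intro \<Phi>0) (simp add: norm_mult)
    have "Y r = cnorm p (\<lambda>t. 1 / (1 - r) * \<Phi> (of_real r * cis t))"
      unfolding Y_def using p r 0 by (subst cnorm_cmult) auto
    also have "\<dots> = (LINT t:{0..2 * pi}|lebesgue. (1 / (1 - r) * \<Phi> (of_real r * cis t)) powr p) powr (1 / p)"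
      using p c 0 r by (intro cnorm_eq_set_lint) auto
    finally show ?thesis using p by (simp add: powr_powr \<Phi>_def)
  qed
  have int_Y: "(\<integral>\<^sup>+ r\<in>{0..<1}. ennreal ((LINT t:{0..2 * pi}|lebesgue.
      (cmod (f (of_real r * cis t)) * (1 - cmod (I (of_real r * cis t))) / (1 - r)) powr p) powr (q / p) * \<nu> (of_real r)) \<partial>lebesgue)
    = (\<integral>\<^sup>+ r\<in>{0..<1}. ennreal (Y r powr q * \<nu> (of_real r)) \<partial>lebesgue)"
    by (intro nn_integral_cong) (auto simp: indicator_def Y_eq)
  have im: "integral_mean p r g = \<kappa> * cnorm p (\<lambda>t. cmod (g (of_real r * cis t)))"
    if "continuous_on (ball 0 1) g" "0 \<le> r" "r < 1" for r g
    using integral_mean_eq[OF that] p by (simp add: \<kappa>_def)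
  have F_hardy: "F \<in> hardy_space p"
  proof -
    obtain M where M: "\<And>r. 0 \<le> r \<Longrightarrow> r < 1 \<Longrightarrow> integral_mean p r f \<le> M"
      using hardy_space_mean_bound[OF assms(4)] by blast
    have "integral_mean p r F \<le> M" if r: "0 \<le> r" "r < 1" for r
    proof -
      have "cnorm p (\<lambda>t. cmod (F (of_real r * cis t))) \<le> cnorm p (\<lambda>t. cmod (f (of_real r * cis t)))"
      proof (intro cnorm_mono continuous_intros continuous_on_circle_compose[OF cF] continuous_on_circle_compose[OF cf])
        fix t
        have "cmod (of_real r * cis t) < 1" using r by (simp add: norm_mult)
        then show "cmod (F (of_real r * cis t)) \<le> cmod (f (of_real r * cis t))"
          using I1 by (simp add: F_def norm_mult mult_left_le)
      qed (use p r in auto)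
      then have "integral_mean p r F \<le> integral_mean p r f"
        using r \<kappa> by (simp add: im cF cf)
      then show ?thesis using M[OF r] by simp
    qed
    then show ?thesis using hF by (auto simp: hardy_space_def bdd_above_def intro!: exI[of _ M])
  qed
  have forward: "mixed_norm_pow p q \<nu> (deriv f) < \<infinity> \<and>
      (\<integral>\<^sup>+ r\<in>{0..<1}. ennreal (Y r powr q * \<nu> (of_real r)) \<partial>lebesgue) < \<infinity>"
    if fin: "mixed_norm_pow p q \<nu> (deriv F) < \<infinity>"
  proof -
    define h where "h r = integral_mean p r (deriv F)" for r
    \<comment> \<open>\<open>K\<close> depends on the weight and on \<open>q\<close> only, so the
      decomposition into annuli is fixed before \<open>h\<close> is considered.\<close>
    obtain K where K: "2 \<le> K" and hardy: "\<forall>h. (\<forall>r s. 0 \<le> r \<longrightarrow> r \<le> s \<longrightarrow> s < 1 \<longrightarrow> h r \<le> h s) \<longrightarrow> (\<forall>r\<in>{0..<1}. 0 \<le> h r)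
      \<longrightarrow> (\<integral>\<^sup>+ s\<in>{0..<1}. ennreal (h s powr q * \<nu> (of_real s)) \<partial>lebesgue) < \<infinity> \<longrightarrow>
      (\<forall>n. summable (\<lambda>i. h (1 - 1 / K ^ (n + i + 1)) / K ^ i)) \<and>
      (\<forall>G C. (\<forall>n. \<forall>s\<in>level K n. 0 \<le> G s \<and> G s \<le> C * (\<Sum>j\<le>Suc n. tail_mean K (\<lambda>n. h (1 - 1 / K ^ n)) j))
        \<longrightarrow> (\<integral>\<^sup>+ s\<in>{0..<1}. ennreal (G s powr q * \<nu> (of_real s)) \<partial>lebesgue) < \<infinity>)"
      using weighted_hardy[OF assms(3) q] by blast
    have h_eq: "h r = \<kappa> * cnorm p (\<lambda>t. cmod (deriv F (of_real r * cis t)))" if "0 \<le> r" "r < 1" for r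
      unfolding h_def using im[OF cF' that] .
    have h_mono: "h r \<le> h s" if "0 \<le> r" "r \<le> s" "s < 1" for r s
      using that \<kappa> p cnorm_holomorphic_mono[OF hF', of r s p] by (simp add: h_eq)
    have h0: "0 \<le> h r" if "r \<in> {0..<1}" for r using that \<kappa> by (simp add: h_eq)
    have hfin: "(\<integral>\<^sup>+ s\<in>{0..<1}. ennreal (h s powr q * \<nu> (of_real s)) \<partial>lebesgue) < \<infinity>"
      using fin by (simp add: mixed_norm_pow_def h_def)
    have concl: "\<And>n. summable (\<lambda>i. h (1 - 1 / K ^ (n + i + 1)) / K ^ i)"
      "\<And>G C. (\<And>n s. s \<in> level K n \<Longrightarrow> 0 \<le> G s \<and> G s \<le> C * (\<Sum>j\<le>Suc n. tail_mean K (\<lambda>n. h (1 - 1 / K ^ n)) j))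
        \<Longrightarrow> (\<integral>\<^sup>+ s\<in>{0..<1}. ennreal (G s powr q * \<nu> (of_real s)) \<partial>lebesgue) < \<infinity>"
      using hardy[rule_format, of h] h_mono h0 hfin by blast+
    \<comment> \<open>\<open>h\<close> carries the normalisation of \<open>integral_mean\<close> and
      \<open>H\<close> does not; the factor \<open>\<kappa>\<close> passes through the tail means
      because they are linear.\<close>
    define H where "H = (\<lambda>n. cnorm p (\<lambda>t. cmod (deriv F (of_real (1 - 1 / K ^ n) * cis t))))"
    have hH: "h (1 - 1 / K ^ n) = \<kappa> * H n" for n
      unfolding H_def using K one_le_power[of K n] by (intro h_eq) (auto simp: divide_le_eq)
    have summ: "summable (\<lambda>i. H (n + i + 1) / K ^ i)" for n
    proof -
      have "summable (\<lambda>i. h (1 - 1 / K ^ (n + i + 1)) / K ^ i / \<kappa>)" by (intro summable_divide concl)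
      then show ?thesis using \<kappa> by (simp only: hH) simp
    qed
    have tm: "tail_mean K (\<lambda>n. h (1 - 1 / K ^ n)) j = \<kappa> * tail_mean K H j" for j
      unfolding tail_mean_def hH using suminf_mult[OF summ[of j], of \<kappa>] by simp
    obtain L where L: "\<And>r. 0 \<le> r \<Longrightarrow> r < 1 \<Longrightarrow> integral {0..2 * pi} (\<lambda>t. cmod (f (of_real r * cis t))) \<le> L"
      using hardy_space_integral_bound[OF assms(4) p] by blast
    interpret D: disc_factor p K f I F H
      by unfold_locales (use p K hf hI I1 hardy1_inner_defect_lim[OF hf assms(5) L] F_def H_def summ in auto)
    have W: "D.W n = (\<Sum>j\<le>n. tail_mean K (\<lambda>n. h (1 - 1 / K ^ n)) j) / \<kappa>" for n
      unfolding D.W_def tm using \<kappa> by (simp flip: sum_distrib_left)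
    have "(\<integral>\<^sup>+ s\<in>{0..<1}. ennreal (Y s powr q * \<nu> (of_real s)) \<partial>lebesgue) < \<infinity>"
    proof (rule concl(2))
      fix n s assume s: "s \<in> level K n"
      have "s < 1" using level_bounds[of K s n] s K by simp
      then show "0 \<le> Y s \<and> Y s \<le> (24 * pi\<^sup>2 * K ^ 3 / \<kappa>) * (\<Sum>j\<le>Suc n. tail_mean K (\<lambda>n. h (1 - 1 / K ^ n)) j)"
        using D.A_quotient_le[OF s] unfolding W by (simp add: Y_def D.A_def \<Phi>_def[abs_def] D.\<Phi>_def[abs_def])
    qed
    moreover have "(\<integral>\<^sup>+ s\<in>{0..<1}. ennreal (integral_mean p s (deriv f) powr q * \<nu> (of_real s)) \<partial>lebesgue) < \<infinity>"
    proof (rule concl(2))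
      fix n s assume s: "s \<in> level K n"
      have s1: "0 \<le> s" "s < 1" using level_bounds[of K s n] s K by auto
      have "integral_mean p s (deriv f) = \<kappa> * cnorm p (\<lambda>t. cmod (deriv f (of_real s * cis t)))"
        by (rule im[OF cf' s1])
      moreover have "\<kappa> * cnorm p (\<lambda>t. cmod (deriv f (of_real s * cis t))) \<le> \<kappa> * ((1 + 192 * pi\<^sup>2 * K ^ 5) * D.W (Suc n))"
        using \<kappa> by (intro mult_left_mono D.deriv_norm_le[OF s]) auto
      ultimately show "0 \<le> integral_mean p s (deriv f) \<and> integral_mean p s (deriv f)
          \<le> (1 + 192 * pi\<^sup>2 * K ^ 5) * (\<Sum>j\<le>Suc n. tail_mean K (\<lambda>n. h (1 - 1 / K ^ n)) j)"
        using \<kappa> unfolding W by simp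
    qed
    ultimately show ?thesis by (simp add: mixed_norm_pow_def)
  qed
  have backward: "mixed_norm_pow p q \<nu> (deriv F) < \<infinity>"
    if fin: "mixed_norm_pow p q \<nu> (deriv f) < \<infinity>"
      "(\<integral>\<^sup>+ r\<in>{0..<1}. ennreal (Y r powr q * \<nu> (of_real r)) \<partial>lebesgue) < \<infinity>"
    unfolding mixed_norm_pow_def
  proof (rule weighted_sum_finite[where X = "\<lambda>r. integral_mean p r (deriv f)" and Y = Y and c = "2 * \<kappa>"])
    have "continuous_on {0..<1} (\<lambda>r. \<kappa> * cnorm p (\<lambda>t. cmod (deriv f (of_real r * cis t))))"
      using p by (intro continuous_intros continuous_on_radial_cnorm[where \<Phi> = "\<lambda>z. cmod (deriv f z)"] cf') auto
    then show "continuous_on {0..<1} (\<lambda>r. integral_mean p r (deriv f))"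
      by (rule continuous_on_eq) (simp add: im[OF cf'])
    show "continuous_on {0..<1} Y"
      unfolding Y_def using p \<Phi>0 by (intro continuous_intros continuous_on_radial_cnorm c\<Phi>) auto
    show "0 \<le> Y s" if "0 \<le> s" "s < 1" for s using that by (simp add: Y_def)
    show "0 \<le> integral_mean p s (deriv f)" "0 \<le> integral_mean p s (deriv F)" if "0 \<le> s" "s < 1" for s
      by (simp_all add: integral_mean_def)
    fix r :: real assume r: "0 \<le> r" "r < 1"
    have cc: "continuous_on {0..2 * pi} (\<lambda>t. deriv f (of_real r * cis t))" "continuous_on {0..2 * pi} (\<lambda>t. deriv F (of_real r * cis t))"
      "continuous_on {0..2 * pi} (\<lambda>t. \<Phi> (of_real r * cis t))"
      using r by (auto intro!: continuous_on_circle_compose[OF cf'] continuous_on_circle_compose[OF cF']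
          continuous_on_circle_compose[OF c\<Phi>] continuous_intros)
    have \<Phi>r: "0 \<le> \<Phi> (of_real r * cis t)" for t using r by (intro \<Phi>0) (simp add: norm_mult)
    have "cnorm p (\<lambda>t. cmod (deriv F (of_real r * cis t)))
        \<le> cnorm p (\<lambda>t. cmod (deriv f (of_real r * cis t)) + 2 / (1 - r) * \<Phi> (of_real r * cis t))"
    proof (intro cnorm_mono continuous_intros cc)
      fix t
      show "cmod (deriv F (of_real r * cis t)) \<le> cmod (deriv f (of_real r * cis t)) + 2 / (1 - r) * \<Phi> (of_real r * cis t)"
        using deriv_mult_inner_le[OF hf hI I1, of "of_real r * cis t"] r by (simp add: F_def \<Phi>_def norm_mult)
    qed (use p r in auto)
    also have "\<dots> \<le> cnorm p (\<lambda>t. cmod (deriv f (of_real r * cis t))) + cnorm p (\<lambda>t. 2 / (1 - r) * \<Phi> (of_real r * cis t))"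
      using p r \<Phi>r by (intro cnorm_add_le continuous_intros cc) auto
    also have "cnorm p (\<lambda>t. 2 / (1 - r) * \<Phi> (of_real r * cis t)) = 2 * Y r"
      using p r \<Phi>r by (subst cnorm_cmult) (auto simp: Y_def)
    finally have "\<kappa> * cnorm p (\<lambda>t. cmod (deriv F (of_real r * cis t)))
        \<le> \<kappa> * (cnorm p (\<lambda>t. cmod (deriv f (of_real r * cis t))) + 2 * Y r)"
      using \<kappa> by (intro mult_left_mono) auto
    \<comment> \<open>The 2 is that of the Schwarz-Pick bound; \<open>\<kappa>\<close> appears
      because \<open>Y\<close> is not normalised.\<close>
    then show "integral_mean p r (deriv F) \<le> integral_mean p r (deriv f) + 2 * \<kappa> * Y r"
      by (simp add: im[OF cf' r] im[OF cF' r] algebra_simps)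
  qed (use \<nu>0 q \<kappa> fin in \<open>auto simp: mixed_norm_pow_def\<close>)
  show ?thesis
    unfolding int_Y besov_space_def F_def[symmetric]
    using forward backward F_hardy assms(4) by blast
qed

end
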